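(* Let $\delta:\mathbb{R}^n\to(0,n)$, let $p(\cdot),q(\cdot),r(\cdot)\in\mathcal{P}^{\log}(\mathbb{R}^n)$ and let $\beta\in(1,p_-)$ satisfy: (i) $\delta_->0$, $(r\delta)_+<n$ and $r_\infty\,\delta_+<n$; (ii) $p(x)\ge p_\infty$ for a.e. $x\in\mathbb{R}^n$, and $\frac1\beta+\frac{1}{(p')_+}>1$; (iii) $\frac1\beta-\frac{1}{p(x)}=\frac{\delta(x)}{n}=\frac{1}{r(x)}-\frac{1}{q(x)}$ for $x\in\mathbb{R}^n$. Let $b$ be a real-valued locally integrable function on $\mathbb{R}^n$. Then $b\in\mathbb{L}(\delta(\cdot))$ and $b\ge0$ if and only if the commutator $[b,\mathcal{M}]$ is bounded from $L^{r(\cdot)}(\mathbb{R}^n)$ to $L^{q(\cdot)}(\mathbb{R}^n)$.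
   Context: For a real function $g$ on $\mathbb{R}^n$ put $g_-:=\inf_{x\in\mathbb{R}^n}g(x)$ and $g_+:=\sup_{x\in\mathbb{R}^n}g(x)$; e.g. $(r\delta)_+=\sup_x r(x)\delta(x)$. $\mathcal{P}(\mathbb{R}^n)$ is the set of measurable $p(\cdot):\mathbb{R}^n\to(1,\infty)$ with $1<p_-\le p_+<\infty$. The conjugate exponent $p'(\cdot)$ is defined by $1/p(\cdot)+1/p'(\cdot)=1$. $\mathcal{P}^{\log}(\mathbb{R}^n)$ is the set of $p(\cdot)\in\mathcal{P}(\mathbb{R}^n)$ for which there exist $C_{\log}(p),C_\infty\in(0,\infty)$ and $p_\infty\in\mathbb{R}$ with $|p(x)-p(y)|\le \frac{C_{\log}(p)}{\ln(e+1/|x-y|)}$ and $|p(x)-p_\infty|\le\frac{C_\infty}{\ln(e+|x|)}$ for all $x,y\in\mathbb{R}^n$. Thus $p_\infty=\lim_{|x|\to\infty}p(x)$, and similarly for $r_\infty$. For $p(\cdot)\in\mathcal{P}(\mathbb{R}^n)$, $L^{p(\cdot)}(\mathbb{R}^n)$ is the space of measurable $f$ with $\int_{\mathbb{R}^n}(|f(x)|/\lambda)^{p(x)}dx<\infty$ for some $\lambda>0$, with norm $\|f\|_{L^{p(\cdot)}(\mathbb{R}^n)}=\inf\{\lambda>0:\int_{\mathbb{R}^n}(|f(x)|/\lambda)^{p(x)}dx\le1\}$. Variable Lipschitz space: $b\in\mathbb{L}(\delta(\cdot))$ if there is a constant $C$ with $|b(x)-b(y)|\le C|x-y|^{\delta(x)}$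 for all $x,y\in\mathbb{R}^n$. Functions equal almost everywhere are identified (so $b\in\mathbb{L}(\delta(\cdot))$ and $b\ge0$ are understood after possibly changing $b$ on a null set). Cubes $Q\subset\mathbb{R}^n$ have sides parallel to the coordinate axes and $|Q|$ is Lebesgue measure. The Hardy–Littlewood maximal function is $\mathcal{M}f(x):=\sup_{Q\ni x}\frac{1}{|Q|}\int_Q|f(y)|\,dy$, the supremum being over all cubes containing $x$. The (nonlinear) commutator is $[b,\mathcal{M}](f)(x):=b(x)\mathcal{M}(f)(x)-\mathcal{M}(bf)(x)$. An operator $T$ (possibly nonlinear) is bounded from $L^{r(\cdot)}(\mathbb{R}^n)$ to $L^{q(\cdot)}(\mathbb{R}^n)$ if there is a constant $C$ such that, for all $f\in L^{r(\cdot)}(\mathbb{R}^n)$, $Tf$ is well defined a.e. and $\|Tf\|_{L^{q(\cdot)}(\mathbb{R}^n)}\le C\|f\|_{L^{r(\cdot)}(\mathbb{R}^n)}$. *)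

theory Defs
  imports "HOL-Analysis.Analysis"
begin

section \<open>Variable exponents\<close>

text \<open>
  \<open>finf g\<close> and \<open>fsup g\<close> are the infimum and supremum of \<open>g\<close> over the whole space.  They carry their intended meaning only for
  functions bounded below, respectively above, since \<open>Inf\<close> and \<open>Sup\<close> on the reals are
  unspecified otherwise.
\<close>

definition finf :: "('a \<Rightarrow> real) \<Rightarrow> real"
  where "finf g = (INF x. g x)"

definition fsup :: "('a \<Rightarrow> real) \<Rightarrow> real"
  where "fsup g = (SUP x. g x)"

definition var_exponent :: "(real ^ 'n \<Rightarrow> real) \<Rightarrow> bool"
  where "var_exponent p \<longleftrightarrow>
    p \<in> borel_measurable lebesgue \<and> (\<forall>x. 1 < p x) \<and> 1 < finf p \<and> bdd_above (range p)"

definition conj_exponent :: "('a \<Rightarrow> real) \<Rightarrow> 'a \<Rightarrow> real"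
  where "conj_exponent p x = 1 / (1 - 1 / p x)"

lemma conj_exponent_eq: "1 < p x \<Longrightarrow> 1 / p x + 1 / conj_exponent p x = 1"
  by (simp add: conj_exponent_def)

text \<open>
  For \<open>x = y\<close> the first bound reads \<open>0 \<le> C\<close>, as \<open>1 / 0 = 0\<close>; so the diagonal imposes nothing.
\<close>

definition log_exponent :: "(real ^ 'n \<Rightarrow> real) \<Rightarrow> bool"
  where "log_exponent p \<longleftrightarrow> var_exponent p \<and>
    (\<exists>C>0. \<forall>x y. \<bar>p x - p y\<bar> \<le> C / ln (exp 1 + 1 / norm (x - y))) \<and>
    (\<exists>D>0. \<exists>l. \<forall>x. \<bar>p x - l\<bar> \<le> D / ln (exp 1 + norm x))"

definition exponent_at_infinity :: "(real ^ 'n \<Rightarrow> real) \<Rightarrow> real"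
  where "exponent_at_infinity p = Lim at_infinity p"

section \<open>Function spaces\<close>

definition modular :: "(real ^ 'n \<Rightarrow> real) \<Rightarrow> (real ^ 'n \<Rightarrow> real) \<Rightarrow> ennreal"
  where "modular p f = (\<integral>\<^sup>+ x. ennreal (\<bar>f x\<bar> powr p x) \<partial>lebesgue)"

definition var_Lp :: "(real ^ 'n \<Rightarrow> real) \<Rightarrow> (real ^ 'n \<Rightarrow> real) set"
  where "var_Lp p =
    {f \<in> borel_measurable lebesgue. \<exists>t>0. modular p (\<lambda>x. f x / t) < \<infinity>}"

text \<open>
  The infimum is over a nonempty set whenever \<open>var_exponent p\<close> and \<open>f \<in> var_Lp p\<close>; for other
  \<open>f\<close> the value is meaningless, so every use is paired with membership in \<open>var_Lp p\<close>.
\<close>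

definition var_Lp_norm :: "(real ^ 'n \<Rightarrow> real) \<Rightarrow> (real ^ 'n \<Rightarrow> real) \<Rightarrow> real"
  where "var_Lp_norm p f = Inf {t. 0 < t \<and> modular p (\<lambda>x. f x / t) \<le> 1}"

definition var_Lipschitz :: "(real ^ 'n \<Rightarrow> real) \<Rightarrow> (real ^ 'n \<Rightarrow> real) set"
  where "var_Lipschitz \<delta> = {b. \<exists>C. \<forall>x y. \<bar>b x - b y\<bar> \<le> C * norm (x - y) powr \<delta> x}"

definition locally_integrable :: "(real ^ 'n \<Rightarrow> real) \<Rightarrow> bool"
  where "locally_integrable b \<longleftrightarrow> (\<forall>K. compact K \<longrightarrow> b absolutely_integrable_on K)"

section \<open>The maximal operator and its commutator\<close>

definition cubes :: "(real ^ 'n) set set"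
  where "cubes = {cbox a (a + s *\<^sub>R One) | a s. 0 < s}"

definition maximal :: "(real ^ 'n \<Rightarrow> real) \<Rightarrow> real ^ 'n \<Rightarrow> ennreal"
  where "maximal f x =
    (SUP Q \<in> {Q \<in> cubes. x \<in> Q}.
      (\<integral>\<^sup>+ y \<in> Q. ennreal \<bar>f y\<bar> \<partial>lebesgue) / emeasure lebesgue Q)"

text \<open>
  The difference defining the commutator makes sense as a real number exactly where both
  maximal functions are finite; elsewhere \<open>enn2real\<close> makes \<open>maximal_commutator\<close> a dummy value.
\<close>

definition commutator_defined ::
    "(real ^ 'n \<Rightarrow> real) \<Rightarrow> (real ^ 'n \<Rightarrow> real) \<Rightarrow> real ^ 'n \<Rightarrow> bool"
  where "commutator_defined b f x \<longleftrightarrow>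
    maximal f x < \<infinity> \<and> maximal (\<lambda>y. b y * f y) x < \<infinity>"

definition maximal_commutator ::
    "(real ^ 'n \<Rightarrow> real) \<Rightarrow> (real ^ 'n \<Rightarrow> real) \<Rightarrow> real ^ 'n \<Rightarrow> real"
  where "maximal_commutator b f x =
    b x * enn2real (maximal f x) - enn2real (maximal (\<lambda>y. b y * f y) x)"

text \<open>\<open>D f x\<close> expresses that the possibly nonlinear operator \<open>T\<close> is well defined on \<open>f\<close> at \<open>x\<close>.\<close>

definition var_Lp_bounded_operator ::
    "(real ^ 'n \<Rightarrow> real) \<Rightarrow> (real ^ 'n \<Rightarrow> real) \<Rightarrow>
     ((real ^ 'n \<Rightarrow> real) \<Rightarrow> real ^ 'n \<Rightarrow> bool) \<Rightarrow>
     ((real ^ 'n \<Rightarrow> real) \<Rightarrow> real ^ 'n \<Rightarrow> real) \<Rightarrow> bool"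
  where "var_Lp_bounded_operator r q D T \<longleftrightarrow>
    (\<exists>C. \<forall>f \<in> var_Lp r. (AE x in lebesgue. D f x) \<and> T f \<in> var_Lp q \<and>
      var_Lp_norm q (T f) \<le> C * var_Lp_norm r f)"

end

theory Submission imports Defs begin

text \<open>
  For nonnegative \<open>b \<in> L(\<delta>)\<close> the commutator is dominated pointwise by the fractional maximal
  function \<open>sup s^(\<delta>(x) - n) \<integral>_Q \<bar>f\<bar>\<close> over the cubes \<open>Q\<close> of side \<open>s\<close> through \<open>x\<close>. If \<open>f\<close> has modular at most 1,
  the a priori bound \<open>avg_Q \<bar>f\<bar> \<le> K s^(-n / r(x))\<close> for small cubes (\<open>r_\<infinity>\<close> instead of \<open>r(x)\<close> for
  large ones) turns its \<open>q(x)\<close>-th power into \<open>(M f)(x)^r(x)\<close> plus an integrable error, and log-Hoelder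
  continuity bounds that by \<open>M(f^(r(.)/c) + h)(x)^c\<close> with the constant exponent \<open>c = r_- > 1\<close> and
  \<open>h\<close> a negative power of \<open>e + \<bar>x\<bar>\<close>; the classical maximal theorem finishes this direction.

  Conversely, testing on \<open>f = \<chi>_Q\<close> bounds the mean oscillation of \<open>b\<close> and the mean of its negative
  part over \<open>Q\<close>, because \<open>M(b \<chi>_Q)\<close> dominates both \<open>\<bar>b\<bar>\<close> and its mean on \<open>Q\<close>. Telescoping over cubes
  shrinking to Lebesgue points gives the Lipschitz estimate; \<open>p \<ge> p_\<infinity>\<close> means \<open>\<delta> \<ge> \<delta>_\<infinity>\<close>, which
  is what large cubes need.
\<close>

section \<open>Averages over cubes and the weak type inequality\<close>

text \<open>A variable exponent leaves neither Jensen's inequality nor a convenient use of duality.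
  Both are replaced by one device: split a function at a height \<open>a\<close> and estimate the
  excess by \<open>t powr k * a powr (1 - k)\<close>. The exponent may then be changed wherever
  \<open>a\<close> lies in the range in which one of the two log-Hoelder conditions bounds
  \<open>a\<close> raised to the difference of exponents. Heights below a negative power of
  \<open>e + |x|\<close> escape both conditions and are paid for by the weight \<open>h\<close>. The
  a priori bound for averages serves both directions: applied to \<open>f\<close> with exponent
  \<open>r(.)\<close> it controls the fractional maximal function, applied to the commutator of an
  indicator with exponent \<open>q(.)\<close> it bounds its mean over the cube. On a large cube
  \<open>r(x)\<close> and \<open>r_\<infinity>\<close> disagree, and the side to the power
  \<open>\<delta>(x)\<close> becomes the average to the power
  \<open>- \<delta>(x) r_\<infinity> / n\<close>. The condition
  \<open>r_\<infinity> \<delta>_+ < n\<close> keeps the remaining exponent above a fixed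
  \<open>\<theta> > 0\<close>, and the order \<open>(n + 1) / \<theta>\<close> of the weight is
  chosen so that its power \<open>\<theta>\<close> is still integrable.\<close>

definition avg :: "(real ^ 'n) set \<Rightarrow> (real ^ 'n \<Rightarrow> ennreal) \<Rightarrow> ennreal"
  where "avg Q g = (\<integral>\<^sup>+ y \<in> Q. g y \<partial>lebesgue) / emeasure lebesgue Q"

text \<open>Arguments and values are \<open>ennreal\<close>, so averages exist without any
  integrability and \<open>\<infinity>\<close> is an ordinary value.\<close>

definition maxi :: "(real ^ 'n \<Rightarrow> ennreal) \<Rightarrow> real ^ 'n \<Rightarrow> ennreal"
  where "maxi g x = (SUP Q \<in> {Q \<in> cubes. x \<in> Q}. avg Q g)"

lemma maximal_eq_maxi: "maximal f = maxi (\<lambda>y. ennreal \<bar>f y\<bar>)"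
  by (simp add: fun_eq_iff maximal_def maxi_def avg_def)

lemma emeasure_cube:
  "0 \<le> s \<Longrightarrow> emeasure lebesgue (cbox a (a + s *\<^sub>R (One :: real ^ 'n))) = ennreal (s ^ CARD('n))"
  by (subst emeasure_completion)
    (auto simp: emeasure_lborel_cbox_eq algebra_simps inner_Basis)

lemma sum_Basis_nth [simp]: "(\<Sum>x\<in>(Basis :: (real ^ 'n) set). x $ i) = 1"
proof -
  have "(One :: real ^ 'n) $ i = 1"
    by (simp add: cart_eq_inner_axis inner_sum_left inner_Basis axis_in_Basis_iff del: sum_component)
  then show ?thesis by simp
qed

lemma mem_cube: "x \<in> cbox a (a + s *\<^sub>R (One :: real ^ 'n)) \<longleftrightarrow> (\<forall>i. a $ i \<le> x $ i \<and> x $ i \<le> a $ i + s)"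
  by (simp add: mem_box_cart)

lemma cubesE:
  assumes "Q \<in> cubes"
  obtains a s where "0 < s" "Q = cbox a (a + s *\<^sub>R (One :: real ^ 'n))"
    "emeasure lebesgue Q = ennreal (s ^ CARD('n))"
proof -
  from assms obtain a s where "0 < s" "Q = cbox a (a + s *\<^sub>R One)" by (auto simp: cubes_def)
  with that show thesis using emeasure_cube[of s a] by force
qed

lemma cubesI: "0 < s \<Longrightarrow> cbox a (a + s *\<^sub>R One) \<in> cubes"
  by (auto simp: cubes_def)

lemma norm_diff_cube:
  fixes x y :: "real ^ 'n"
  assumes "x \<in> cbox a (a + s *\<^sub>R One)" "y \<in> cbox a (a + s *\<^sub>R One)"
  shows "norm (x - y) \<le> real CARD('n) * s"
proof -
  have "norm (x - y) \<le> (\<Sum>i\<in>UNIV. \<bar>(x - y) $ i\<bar>)" by (rule norm_le_l1_cart)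
  also have "\<dots> \<le> (\<Sum>i\<in>(UNIV :: 'n set). s)"
  proof (rule sum_mono)
    fix i
    show "\<bar>(x - y) $ i\<bar> \<le> s" using assms[unfolded mem_cube, rule_format, of i] by auto
  qed
  finally show ?thesis by simp
qed

lemma sets_cubes [simp, intro]: "Q \<in> cubes \<Longrightarrow> Q \<in> sets lebesgue"
  by (auto elim!: cubesE)

lemma avg_mono:
  assumes "\<And>y. y \<in> Q \<Longrightarrow> f y \<le> g y"
  shows "avg Q f \<le> avg Q g"
  unfolding avg_def
  by (intro divide_right_mono_ennreal nn_integral_mono) (auto simp: indicator_def assms)

lemma avg_add:
  assumes [measurable]: "f \<in> borel_measurable lebesgue" "g \<in> borel_measurable lebesgue" and "Q \<in> cubes"
  shows "avg Q (\<lambda>y. f y + g y) = avg Q f + avg Q g"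
proof -
  have [measurable]: "Q \<in> sets lebesgue" using assms by auto
  show ?thesis
    unfolding avg_def by (simp add: distrib_right nn_integral_add add_divide_distrib_ennreal)
qed

lemma avg_cmult:
  assumes [measurable]: "f \<in> borel_measurable lebesgue" and "Q \<in> cubes"
  shows "avg Q (\<lambda>y. c * f y) = c * avg Q f"
proof -
  have [measurable]: "Q \<in> sets lebesgue" using assms by auto
  show ?thesis
    unfolding avg_def by (simp add: mult.assoc nn_integral_cmult ennreal_times_divide)
qed

lemma avg_const:
  assumes "Q \<in> cubes"
  shows "avg Q (\<lambda>y. c) = c"
proof -
  have [measurable]: "Q \<in> sets lebesgue" using assms by auto
  from assms obtain a s where *: "0 < s" "emeasure lebesgue Q = ennreal (s ^ CARD('a))"
    by (auto elim: cubesE)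
  have "emeasure lebesgue Q \<noteq> 0" "emeasure lebesgue Q \<noteq> \<infinity>" using * by auto
  then show ?thesis unfolding avg_def
    by (simp add: nn_integral_cmult ennreal_mult_divide_eq)
qed

lemma avg_mult_emeasure:
  assumes "Q \<in> cubes"
  shows "avg Q g * emeasure lebesgue Q = (\<integral>\<^sup>+ y \<in> Q. g y \<partial>lebesgue)"
proof -
  from assms obtain a s where *: "0 < s" "emeasure lebesgue Q = ennreal (s ^ CARD('a))"
    by (auto elim: cubesE)
  have "emeasure lebesgue Q \<noteq> 0" "emeasure lebesgue Q \<noteq> \<infinity>" using * by auto
  then show ?thesis unfolding avg_def
    by (simp add: ennreal_divide_times less_top)
qed

lemma avg_le_maxi: "Q \<in> cubes \<Longrightarrow> x \<in> Q \<Longrightarrow> avg Q g \<le> maxi g x"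
  unfolding maxi_def by (auto intro: SUP_upper)

text \<open>Vitali covering: among the cubes with average above \<open>t\<close> a disjoint
  subfamily is kept whose surrounding balls, enlarged five times, still cover \<open>S\<close>. The
  enlarged ball of a cube of side \<open>s\<close> has radius \<open>5 * n * s / 2\<close> and fits
  into a cube of side \<open>5 * n * s\<close>, whence the constant. Stating it for measurable sets
  \<open>S\<close> inside the superlevel set lets it be used before \<open>maxi g\<close> is known
  to be measurable.\<close>

lemma maximal_weak_type:
  fixes g :: "real ^ 'n \<Rightarrow> ennreal"
  assumes [measurable]: "g \<in> borel_measurable lebesgue" "S \<in> sets lebesgue"
    and lam: "0 < t" and S: "\<And>x. x \<in> S \<Longrightarrow> ennreal t < maxi g x"
  shows "ennreal t * emeasure lebesgue S
    \<le> ennreal ((5 * real CARD('n)) ^ CARD('n)) * (\<integral>\<^sup>+ y. g y \<partial>lebesgue)"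
proof (cases "(\<integral>\<^sup>+ y. g y \<partial>lebesgue) = \<infinity>")
  case True
  then show ?thesis by (simp add: ennreal_mult_top)
next
  case False
  define n where "n = CARD('n)"
  have n: "1 \<le> n" unfolding n_def by (simp add: Suc_leI)
  from False obtain G where G: "0 \<le> G" "(\<integral>\<^sup>+ y. g y \<partial>lebesgue) = ennreal G"
    by (metis ennreal_cases infinity_ennreal_def)
  define Q where "Q = (\<lambda>(a, s). cbox a (a + s *\<^sub>R (One :: real ^ 'n)))"
  \<comment> \<open>centre and radius of a ball around the cube: disjoint balls contain disjoint cubes\<close>
  define c where "c = (\<lambda>(a, s). a + (s / 2) *\<^sub>R (One :: real ^ 'n))"
  define \<rho> where "\<rho> = (\<lambda>(a :: real ^ 'n, s). real n * s / 2)"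
  define K where "K = {(a, s). 0 < s \<and> ennreal t * emeasure lebesgue (Q (a, s))
     \<le> (\<integral>\<^sup>+ y \<in> Q (a, s). g y \<partial>lebesgue)}"
  have Qcube: "Q i \<in> cubes" if "i \<in> K" for i
    using that by (auto simp: K_def Q_def intro: cubesI)
  have Qc: "Q i \<subseteq> cball (c i) (\<rho> i)" if "i \<in> K" for i
  proof
    fix x assume x: "x \<in> Q i"
    obtain a s where i: "i = (a, s)" by force
    have "norm (c i - x) \<le> (\<Sum>k\<in>UNIV. \<bar>(c i - x) $ k\<bar>)" by (rule norm_le_l1_cart)
    also have "\<dots> \<le> (\<Sum>k\<in>(UNIV :: 'n set). s / 2)"
    proof (rule sum_mono)
      fix k
      have "a $ k \<le> x $ k" "x $ k \<le> a $ k + s"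
        using x[unfolded i Q_def prod.case mem_cube] by auto
      then have "\<bar>a $ k + s / 2 - x $ k\<bar> \<le> s / 2" by linarith
      then show "\<bar>(c i - x) $ k\<bar> \<le> s / 2" by (simp add: c_def i)
    qed
    finally show "x \<in> cball (c i) (\<rho> i)" by (simp add: \<rho>_def i n_def dist_norm)
  qed
  have cover: "S \<subseteq> (\<Union>i\<in>K. cball (c i) (\<rho> i))"
  proof
    fix x assume "x \<in> S"
    from S[OF this] obtain P where P: "P \<in> cubes" "x \<in> P" "ennreal t < avg P g"
      unfolding maxi_def less_SUP_iff by blast
    then obtain a s where as: "0 < s" "P = Q (a, s)" by (auto elim: cubesE simp: Q_def)
    have "ennreal t * emeasure lebesgue P \<le> avg P g * emeasure lebesgue P"
      using P by (intro mult_right_mono) auto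
    then have "(a, s) \<in> K" using as P avg_mult_emeasure[of P g] by (simp add: K_def)
    then show "x \<in> (\<Union>i\<in>K. cball (c i) (\<rho> i))" using Qc P as by blast
  qed
  have emQ: "emeasure lebesgue (Q i) = ennreal (snd i ^ n)" if "i \<in> K" for i
    using that by (auto simp: K_def Q_def emeasure_cube n_def simp del: emeasure_completion)
  \<comment> \<open>The covering lemma needs bounded radii. The integral of \<open>g\<close> bounds
    \<open>t * s ^ n\<close>, and \<open>s \<le> s ^ n\<close> once \<open>1 \<le> s\<close>. This
    is why an infinite integral was split off.\<close>
  have rad: "0 < \<rho> i \<and> \<rho> i \<le> real n * max 1 (G / t) / 2" if i: "i \<in> K" for i
  proof -
    obtain a s where ias: "i = (a, s)" by force
    have s: "0 < s" using i by (auto simp: K_def ias)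
    have "ennreal (t * s ^ n) = ennreal t * emeasure lebesgue (Q i)"
      using s lam unfolding emQ[OF i] by (simp add: ennreal_mult ias)
    also have "\<dots> \<le> (\<integral>\<^sup>+ y \<in> Q i. g y \<partial>lebesgue)" using i by (auto simp: K_def)
    also have "\<dots> \<le> (\<integral>\<^sup>+ y. g y \<partial>lebesgue)"
      by (intro nn_integral_mono) (auto simp: indicator_def)
    finally have "t * s ^ n \<le> G" using G by simp
    then have "s ^ n \<le> G / t" using lam by (simp add: field_simps)
    moreover have "s \<le> s ^ n" if "1 \<le> s" using that n self_le_power[of s n] by auto
    ultimately have "s \<le> max 1 (G / t)" by linarith
    then show ?thesis using s n by (simp add: \<rho>_def ias)
  qed
  obtain C where C: "countable C" "C \<subseteq> K"
    "pairwise (\<lambda>i j. disjnt (cball (c i) (\<rho> i)) (cball (c j) (\<rho> j))) C"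
    "S \<subseteq> (\<Union>i\<in>C. cball (c i) (5 * \<rho> i))"
    by (rule Vitali_covering_lemma_cballs[OF cover rad]) auto
  have disj: "disjoint_family_on Q C"
    unfolding disjoint_family_on_def
  proof (intro ballI impI)
    fix i j assume ij: "i \<in> C" "j \<in> C" "i \<noteq> j"
    then have "cball (c i) (\<rho> i) \<inter> cball (c j) (\<rho> j) = {}"
      using C(3) by (auto simp: pairwise_def disjnt_def)
    then show "Q i \<inter> Q j = {}" using Qc ij C(2) by blast
  qed
  have five: "emeasure lebesgue (cball (c i) (5 * \<rho> i)) \<le> ennreal ((5 * real n) ^ n) * emeasure lebesgue (Q i)"
    if i: "i \<in> K" for i
  proof -
    obtain a s where ias: "i = (a, s)" by force
    have s: "0 < s" using i by (auto simp: K_def ias)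
    define b where "b = c i - (5 * \<rho> i) *\<^sub>R (One :: real ^ 'n)"
    have "cball (c i) (5 * \<rho> i) \<subseteq> cbox b (b + (10 * \<rho> i) *\<^sub>R One)"
    proof
      fix x assume "x \<in> cball (c i) (5 * \<rho> i)"
      then have "norm (c i - x) \<le> 5 * \<rho> i" by (simp add: dist_norm)
      then have "\<bar>(c i - x) $ k\<bar> \<le> 5 * \<rho> i" for k
        using component_le_norm_cart[of "c i - x" k] by linarith
      then have "\<bar>c i $ k - x $ k\<bar> \<le> 5 * \<rho> i" for k by simp
      then show "x \<in> cbox b (b + (10 * \<rho> i) *\<^sub>R One)"
        unfolding mem_cube b_def by (auto simp: abs_le_iff algebra_simps)
    qed
    then have "emeasure lebesgue (cball (c i) (5 * \<rho> i))
        \<le> emeasure lebesgue (cbox b (b + (10 * \<rho> i) *\<^sub>R One))"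
      by (intro emeasure_mono) auto
    also have "\<dots> = ennreal ((10 * \<rho> i) ^ n)"
      using s by (subst emeasure_cube) (auto simp: \<rho>_def ias n_def)
    also have "10 * \<rho> i = (5 * real n) * s" by (simp add: \<rho>_def ias)
    also have "\<dots> ^ n = (5 * real n) ^ n * s ^ n" by (rule power_mult_distrib)
    also have "ennreal \<dots> = ennreal ((5 * real n) ^ n) * emeasure lebesgue (Q i)"
      using s unfolding emQ[OF i] by (simp add: ennreal_mult ias)
    finally show ?thesis .
  qed
  let ?B = "\<lambda>i. cball (c i) (5 * \<rho> i)"
  have "emeasure lebesgue S = (\<integral>\<^sup>+ x. indicator S x \<partial>lebesgue)" by simp
  \<comment> \<open>Sums over the countable family are integrals over \<open>count_space C\<close>,
    so that they can be exchanged with the Lebesgue integral.\<close>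
  also have "\<dots> \<le> (\<integral>\<^sup>+ x. \<integral>\<^sup>+ i. indicator (?B i) x \<partial>count_space C \<partial>lebesgue)"
  proof (rule nn_integral_mono)
    fix x
    show "indicator S x \<le> (\<integral>\<^sup>+ i. indicator (?B i) x \<partial>count_space C :: ennreal)"
    proof (cases "x \<in> S")
      case True
      then obtain i where i: "i \<in> C" "x \<in> ?B i" using C(4) by blast
      from nn_integral_ge_point[OF i(1), of "\<lambda>i. indicator (?B i) x"] i(2) True
      show ?thesis by simp
    qed simp
  qed
  also have "\<dots> = (\<integral>\<^sup>+ i. emeasure lebesgue (?B i) \<partial>count_space C)"
    by (subst nn_integral_count_space_nn_integral)
      (auto simp: C(1) simp del: emeasure_completion intro!: borel_measurable_indicator)
  also have "\<dots> \<le> (\<integral>\<^sup>+ i. ennreal ((5 * real n) ^ n) * emeasure lebesgue (Q i) \<partial>count_space C)"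
    using five C(2) by (intro nn_integral_mono) auto
  finally have "ennreal t * emeasure lebesgue S
    \<le> ennreal t * (\<integral>\<^sup>+ i. ennreal ((5 * real n) ^ n) * emeasure lebesgue (Q i) \<partial>count_space C)"
    by (intro mult_left_mono) auto
  also have "\<dots> = ennreal ((5 * real n) ^ n) * (\<integral>\<^sup>+ i. ennreal t * emeasure lebesgue (Q i) \<partial>count_space C)"
    by (simp add: nn_integral_cmult mult.left_commute)
  \<comment> \<open>Disjointness enters here: the integrals over the cubes add up to the measure of
    their union under the measure with density \<open>g\<close>.\<close>
  also have "\<dots> \<le> ennreal ((5 * real n) ^ n) * (\<integral>\<^sup>+ i. emeasure (density lebesgue g) (Q i) \<partial>count_space C)"
  proof (intro mult_left_mono nn_integral_mono)
    fix i assume "i \<in> space (count_space C)"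
    then have i: "i \<in> K" using C by auto
    then have "Q i \<in> sets lebesgue" using Qcube by auto
    then show "ennreal t * emeasure lebesgue (Q i) \<le> emeasure (density lebesgue g) (Q i)"
      using i by (auto simp: K_def emeasure_density)
  qed auto
  also have "\<dots> \<le> ennreal ((5 * real n) ^ n) * (\<integral>\<^sup>+ y. g y \<partial>lebesgue)"
  proof (rule mult_left_mono)
    have "(\<integral>\<^sup>+ i. emeasure (density lebesgue g) (Q i) \<partial>count_space C)
        = emeasure (density lebesgue g) (\<Union>i\<in>C. Q i)"
      by (rule emeasure_UN_countable[symmetric]) (use C Qcube disj in auto)
    also have "\<dots> \<le> emeasure (density lebesgue g) (space lebesgue)"
      by (metis emeasure_space space_density)
    also have "\<dots> = (\<integral>\<^sup>+ y. g y \<partial>lebesgue)"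
      by (subst emeasure_density) auto
    finally show "(\<integral>\<^sup>+ i. emeasure (density lebesgue g) (Q i) \<partial>count_space C)
        \<le> (\<integral>\<^sup>+ y. g y \<partial>lebesgue)" .
  qed simp
  finally show ?thesis by (simp only: n_def)
qed

section \<open>The strong type inequality\<close>

text \<open>Averages of the part of \<open>g\<close> below \<open>t / 2\<close> are at most
  \<open>t / 2\<close>, so where the maximal function exceeds \<open>t\<close>, that of the part
  above \<open>t / 2\<close> exceeds \<open>t / 2\<close>. The weak type bound for this part only
  sees the set where \<open>t / 2 < g\<close>, which is what makes the later sum over levels
  converge.\<close>

lemma maximal_weak_type_truncated:
  fixes g u :: "real ^ 'n \<Rightarrow> real"
  assumes [measurable]: "g \<in> borel_measurable lebesgue" "u \<in> borel_measurable lebesgue"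
    and g: "\<And>x. 0 \<le> g x" and u: "\<And>x. ennreal (u x) \<le> maxi (\<lambda>y. ennreal (g y)) x" and t: "0 < t"
  shows "emeasure lebesgue {x. t < u x}
    \<le> ennreal (2 * (5 * real CARD('n)) ^ CARD('n) / t) *
       (\<integral>\<^sup>+ y. ennreal (g y) * indicator {y. t / 2 < g y} y \<partial>lebesgue)"
proof -
  let ?S = "{x. t < u x}" and ?A = "(5 * real CARD('n)) ^ CARD('n)"
  have [measurable]: "?S \<in> sets lebesgue" 
    using borel_measurable_less[of "\<lambda>_. t" lebesgue u] by simp
  define h where "h y = ennreal (g y) * indicator {y. t / 2 < g y} y" for y
  have [measurable]: "{y. t / 2 < g y} \<in> sets lebesgue"
    using borel_measurable_less[of "\<lambda>_. t / 2" lebesgue g] by simp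
  have h [measurable]: "h \<in> borel_measurable lebesgue" unfolding h_def by measurable
  have "ennreal (t / 2) < maxi h x" if x: "x \<in> ?S" for x
  proof (rule ccontr)
    assume "\<not> ?thesis"
    then have le: "maxi h x \<le> ennreal (t / 2)" by simp
    have "maxi (\<lambda>y. ennreal (g y)) x \<le> ennreal t"
      unfolding maxi_def
    proof (rule SUP_least)
      fix Q assume Q: "Q \<in> {Q \<in> cubes. x \<in> Q}"
      have "avg Q (\<lambda>y. ennreal (g y)) \<le> avg Q (\<lambda>y. h y + ennreal (t / 2))"
        by (rule avg_mono) (auto simp: h_def indicator_def g intro!: ennreal_leI)
      also have "\<dots> = avg Q h + ennreal (t / 2)"
        using Q by (simp add: avg_add avg_const)
      also have "\<dots> \<le> ennreal (t / 2) + ennreal (t / 2)"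
        using Q avg_le_maxi[of Q x h] le by (intro add_right_mono) auto
      also have "\<dots> = ennreal t" using t by (simp add: ennreal_plus[symmetric] del: ennreal_plus)
      finally show "avg Q (\<lambda>y. ennreal (g y)) \<le> ennreal t" .
    qed
    then have "ennreal (u x) \<le> ennreal t" using u[of x] by (rule order_trans[rotated])
    then show False using x t by (simp add: ennreal_le_iff)
  qed
  from maximal_weak_type[OF h _ _ this, of ?S] t
  have "ennreal (t / 2) * emeasure lebesgue ?S \<le> ennreal ?A * (\<integral>\<^sup>+ y. h y \<partial>lebesgue)" by simp
  then have "ennreal (2 / t) * (ennreal (t / 2) * emeasure lebesgue ?S)
    \<le> ennreal (2 / t) * (ennreal ?A * (\<integral>\<^sup>+ y. h y \<partial>lebesgue))"
    by (rule mult_left_mono) simp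
  moreover have "ennreal (2 / t) * (ennreal (t / 2) * emeasure lebesgue ?S) = emeasure lebesgue ?S"
    using t by (simp add: mult.assoc[symmetric] ennreal_mult[symmetric])
  moreover have "ennreal (2 / t) * (ennreal ?A * (\<integral>\<^sup>+ y. h y \<partial>lebesgue))
      = ennreal (2 * ?A / t) * (\<integral>\<^sup>+ y. h y \<partial>lebesgue)"
    using t by (simp add: mult.assoc[symmetric] ennreal_mult[symmetric])
  ultimately show ?thesis by (simp add: h_def)
qed

lemma dyadic_bracket:
  assumes "0 < (v :: real)"
  obtains k :: int where "2 powr real_of_int k < v" "v \<le> 2 powr (real_of_int k + 1)"
proof
  let ?k = "\<lceil>log 2 v\<rceil> - 1"
  have *: "real_of_int ?k < log 2 v" "log 2 v \<le> real_of_int ?k + 1" by linarith+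
  show "2 powr real_of_int ?k < v"
    by (rule less_log_iff[THEN iffD1]) (use *(1) assms in auto)
  show "v \<le> 2 powr (real_of_int ?k + 1)"
    by (rule log_le_iff[THEN iffD1]) (use *(2) assms in auto)
qed

text \<open>Read downwards from the top level \<open>K\<close> this is a geometric series of ratio
  \<open>2 powr (1 - s)\<close>, hence comparable to its first term. It is the sum over levels that
  remains at a point where \<open>g\<close> has the value \<open>G\<close>.\<close>

lemma dyadic_sum_bound:
  assumes s: "1 < s" and G: "0 \<le> G"
  shows "(\<integral>\<^sup>+ k. ennreal (2 powr (real_of_int k * (s - 1))) * indicator {k :: int. 2 powr real_of_int k < 2 * G} k \<partial>count_space UNIV)
    \<le> ennreal ((2 * G) powr (s - 1) / (1 - 2 powr (1 - s)))"
proof (cases "G = 0")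
  case True
  then show ?thesis by (simp add: not_less)
next
  case False
  with G have G: "0 < 2 * G" by simp
  obtain K :: int where K: "2 powr real_of_int K < 2 * G" "2 * G \<le> 2 powr (real_of_int K + 1)"
    using dyadic_bracket[OF G] .
  define \<rho> where "\<rho> = (2 :: real) powr (1 - s)"
  have \<rho>: "0 < \<rho>" "\<rho> < 1" using s by (auto simp: \<rho>_def powr_less_one)
  let ?f = "\<lambda>k :: int. ennreal (2 powr (real_of_int k * (s - 1)))"
  have "(\<integral>\<^sup>+ k. ?f k * indicator {k :: int. 2 powr real_of_int k < 2 * G} k \<partial>count_space UNIV)
    \<le> (\<integral>\<^sup>+ k. ?f k * indicator {..K} k \<partial>count_space UNIV)"
  proof (intro nn_integral_mono mult_left_mono)
    fix k :: int
    have "k \<le> K" if "2 powr k < 2 * G"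
    proof -
      have "2 powr real_of_int k < 2 powr (real_of_int K + 1)" using that K(2) by linarith
      then show ?thesis by simp
    qed
    then show "indicator {k :: int. 2 powr real_of_int k < 2 * G} k \<le> (indicator {..K} k :: ennreal)"
      by (auto simp: indicator_def)
  qed auto
  also have "\<dots> = (\<integral>\<^sup>+ k. ?f k \<partial>count_space {..K})"
    by (simp add: nn_integral_count_space_indicator)
  also have "\<dots> = (\<integral>\<^sup>+ j. ?f (K - int j) \<partial>count_space UNIV)"
  proof (rule nn_integral_bij_count_space[symmetric])
    show "bij_betw (\<lambda>j. K - int j) UNIV {..K}"
      by (rule bij_betwI[where g = "\<lambda>k. nat (K - k)"]) auto
  qed
  also have "\<dots> = (\<Sum>j. ?f (K - int j))" by (rule nn_integral_count_space_nat)
  also have "\<dots> = (\<Sum>j. ennreal (2 powr (K * (s - 1)) * \<rho> ^ j))"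
    by (intro suminf_cong arg_cong[where f = ennreal])
      (simp add: \<rho>_def powr_realpow[symmetric] powr_powr powr_add[symmetric] algebra_simps powr_power)
  also have "\<dots> = ennreal (\<Sum>j. 2 powr (K * (s - 1)) * \<rho> ^ j)"
    using \<rho> by (intro suminf_ennreal2) (auto intro!: summable_mult summable_geometric)
  also have "(\<Sum>j. 2 powr (K * (s - 1)) * \<rho> ^ j) = 2 powr (K * (s - 1)) / (1 - \<rho>)"
    using \<rho> by (subst suminf_mult) (auto simp: suminf_geometric intro!: summable_geometric)
  also have "\<dots> \<le> (2 * G) powr (s - 1) / (1 - \<rho>)"
  proof (rule divide_right_mono)
    have "2 powr (K * (s - 1)) = (2 powr K) powr (s - 1)" by (simp add: powr_powr)
    also have "\<dots> \<le> (2 * G) powr (s - 1)" using s K by (intro powr_mono2) auto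
    finally show "2 powr (K * (s - 1)) \<le> (2 * G) powr (s - 1)" .
  qed (use \<rho> in auto)
  finally show ?thesis by (simp add: \<rho>_def ennreal_leI)
qed

text \<open>A real minorant \<open>u\<close> of the maximal function avoids powers of \<open>\<infinity>\<close>.\<close>

lemma maximal_strong_type:
  fixes s :: real
  assumes s: "1 < s"
  obtains C where "0 \<le> C"
    "\<And>(g :: real ^ 'n \<Rightarrow> real) u. g \<in> borel_measurable lebesgue \<Longrightarrow> u \<in> borel_measurable lebesgue \<Longrightarrow>
      (\<And>x. 0 \<le> g x) \<Longrightarrow> (\<And>x. 0 \<le> u x) \<Longrightarrow> (\<And>x. ennreal (u x) \<le> maxi (\<lambda>y. ennreal (g y)) x) \<Longrightarrow>
      (\<integral>\<^sup>+ x. ennreal (u x powr s) \<partial>lebesgue) \<le> ennreal C * (\<integral>\<^sup>+ x. ennreal (g x powr s) \<partial>lebesgue)"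
proof -
  define A where "A = 2 * (5 * real CARD('n)) ^ CARD('n)"
  have A: "0 \<le> A" by (simp add: A_def)
  define \<rho> where "\<rho> = (2 :: real) powr (1 - s)"
  have \<rho>: "0 < \<rho>" "\<rho> < 1" using s by (auto simp: \<rho>_def powr_less_one)
  define c where "c = A * 2 powr s"
  have c: "0 \<le> c" using A by (simp add: c_def)
  define C where "C = c * 2 powr (s - 1) / (1 - \<rho>)"
  show ?thesis
  proof (rule that)
    show "0 \<le> C" using c \<rho> by (simp add: C_def)
    fix g u :: "real ^ 'n \<Rightarrow> real"
    assume [measurable]: "g \<in> borel_measurable lebesgue" "u \<in> borel_measurable lebesgue"
      and g: "\<And>x. 0 \<le> g x" and u0: "\<And>x. 0 \<le> u x" and u: "\<And>x. ennreal (u x) \<le> maxi (\<lambda>y. ennreal (g y)) x"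
    define E where "E k = {x. 2 powr real_of_int k < u x}" for k :: int
    define F where "F k = {y. 2 powr real_of_int k / 2 < g y}" for k :: int
    have level [measurable]: "{x. a < f x} \<in> sets lebesgue"
      if "f \<in> borel_measurable lebesgue" for a and f :: "real ^ 'n \<Rightarrow> real"
      using borel_measurable_less[OF measurable_const that, of a] by simp
    have [measurable]: "E k \<in> sets lebesgue" "F k \<in> sets lebesgue" for k
      unfolding E_def F_def by (rule level, fact)+
    \<comment> \<open>The single level with \<open>2 powr k < u x \<le> 2 powr (k + 1)\<close>
      already dominates \<open>u x powr s\<close>; all levels are summed to make the bound depend on
      \<open>x\<close> through indicators only.\<close>
    have "(\<integral>\<^sup>+ x. ennreal (u x powr s) \<partial>lebesgue)
      \<le> (\<integral>\<^sup>+ x. \<integral>\<^sup>+ k. ennreal (2 powr ((real_of_int k + 1) * s)) * indicator (E k) x \<partial>count_space UNIV \<partial>lebesgue)"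
    proof (rule nn_integral_mono)
      fix x
      show "ennreal (u x powr s) \<le> (\<integral>\<^sup>+ k. ennreal (2 powr ((real_of_int k + 1) * s)) * indicator (E k) x \<partial>count_space UNIV)"
      proof (cases "u x = 0")
        case False
        then have "0 < u x" using u0[of x] by simp
        then obtain k :: int where k: "2 powr real_of_int k < u x" "u x \<le> 2 powr (real_of_int k + 1)" by (rule dyadic_bracket)
        have "u x powr s \<le> (2 powr (real_of_int k + 1)) powr s" using k s u0 by (intro powr_mono2) auto
        then have "ennreal (u x powr s) \<le> ennreal (2 powr ((real_of_int k + 1) * s)) * indicator (E k) x"
          using k by (simp add: powr_powr ennreal_leI E_def)
        also have "\<dots> \<le> (\<integral>\<^sup>+ k. ennreal (2 powr ((real_of_int k + 1) * s)) * indicator (E k) x \<partial>count_space UNIV)"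
          by (rule nn_integral_ge_point) simp
        finally show ?thesis .
      qed simp
    qed
    also have "\<dots> = (\<integral>\<^sup>+ k. ennreal (2 powr ((real_of_int k + 1) * s)) * emeasure lebesgue (E k) \<partial>count_space UNIV)"
      by (subst nn_integral_count_space_nn_integral) (simp_all add: nn_integral_cmult del: emeasure_completion)
    also have "\<dots> \<le> (\<integral>\<^sup>+ k. \<integral>\<^sup>+ y. ennreal c * ennreal (g y) *
        (ennreal (2 powr (real_of_int k * (s - 1))) * indicator (F k) y) \<partial>lebesgue \<partial>count_space UNIV)"
    proof (rule nn_integral_mono)
      fix k :: int
      \<comment> \<open>The level contributes \<open>2 powr (k * s)\<close> and the weak type
        inequality \<open>2 powr (- k)\<close>; together they leave
        \<open>2 powr (k * (s - 1))\<close>.\<close>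
      have eq: "2 powr ((real_of_int k + 1) * s) * (A / 2 powr k) = c * 2 powr (real_of_int k * (s - 1))"
      proof -
        have "2 powr ((real_of_int k + 1) * s) = 2 powr real_of_int k * 2 powr s * 2 powr (real_of_int k * (s - 1))"
          by (simp add: powr_add[symmetric] algebra_simps)
        then show ?thesis by (simp add: c_def)
      qed
      have "emeasure lebesgue (E k) \<le> ennreal (A / 2 powr k) *
             (\<integral>\<^sup>+ y. ennreal (g y) * indicator (F k) y \<partial>lebesgue)"
        unfolding A_def E_def F_def by (rule maximal_weak_type_truncated) (use g u in auto)
      then have "ennreal (2 powr ((real_of_int k + 1) * s)) * emeasure lebesgue (E k)
        \<le> ennreal (2 powr ((real_of_int k + 1) * s)) * (ennreal (A / 2 powr k) *
             (\<integral>\<^sup>+ y. ennreal (g y) * indicator (F k) y \<partial>lebesgue))"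
        by (rule mult_left_mono) simp
      also have "\<dots> = ennreal (c * 2 powr (real_of_int k * (s - 1))) *
          (\<integral>\<^sup>+ y. ennreal (g y) * indicator (F k) y \<partial>lebesgue)"
        unfolding eq[symmetric] using A by (subst ennreal_mult) (auto simp: mult.assoc)
      also have "\<dots> = (\<integral>\<^sup>+ y. ennreal c * ennreal (g y) *
        (ennreal (2 powr (real_of_int k * (s - 1))) * indicator (F k) y) \<partial>lebesgue)"
        using c by (subst nn_integral_cmult[symmetric]) (auto intro!: nn_integral_cong simp: ennreal_mult mult_ac)
      finally show "ennreal (2 powr ((real_of_int k + 1) * s)) * emeasure lebesgue (E k) \<le> \<dots>" .
    qed
    also have "\<dots> = (\<integral>\<^sup>+ y. \<integral>\<^sup>+ k. ennreal c * ennreal (g y) *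
        (ennreal (2 powr (real_of_int k * (s - 1))) * indicator (F k) y) \<partial>count_space UNIV \<partial>lebesgue)"
      by (subst nn_integral_count_space_nn_integral) auto
    also have "\<dots> \<le> (\<integral>\<^sup>+ y. ennreal C * ennreal (g y powr s) \<partial>lebesgue)"
    proof (rule nn_integral_mono)
      fix y
      have "(\<integral>\<^sup>+ k. ennreal c * ennreal (g y) * (ennreal (2 powr (real_of_int k * (s - 1))) * indicator (F k) y) \<partial>count_space UNIV)
        = ennreal c * ennreal (g y) * (\<integral>\<^sup>+ k. ennreal (2 powr (real_of_int k * (s - 1))) * indicator {k :: int. 2 powr real_of_int k < 2 * g y} k \<partial>count_space UNIV)"
        by (subst nn_integral_cmult[symmetric]) (auto intro!: nn_integral_cong simp: indicator_def F_def)
      also have "\<dots> \<le> ennreal c * ennreal (g y) * ennreal ((2 * g y) powr (s - 1) / (1 - \<rho>))"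
        unfolding \<rho>_def by (intro mult_left_mono dyadic_sum_bound s g) auto
      also have "\<dots> = ennreal (c * g y * ((2 * g y) powr (s - 1) / (1 - \<rho>)))"
        using c g[of y] \<rho> by (subst ennreal_mult, simp, simp, subst ennreal_mult) auto
      also have "c * g y * ((2 * g y) powr (s - 1) / (1 - \<rho>)) = C * g y powr s"
      proof (cases "g y = 0")
        case False
        then have "g y powr s = g y * g y powr (s - 1)" using g[of y] by (simp add: powr_diff)
        then show ?thesis using g[of y] by (simp add: C_def powr_mult)
      qed (use s in simp)
      also have "ennreal \<dots> = ennreal C * ennreal (g y powr s)"
        using c \<rho> by (intro ennreal_mult) (auto simp: C_def)
      finally show "(\<integral>\<^sup>+ k. ennreal c * ennreal (g y) * (ennreal (2 powr (real_of_int k * (s - 1))) * indicator (F k) y) \<partial>count_space UNIV)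
        \<le> ennreal C * ennreal (g y powr s)" .
    qed
    also have "\<dots> = ennreal C * (\<integral>\<^sup>+ x. ennreal (g x powr s) \<partial>lebesgue)"
      by (simp add: nn_integral_cmult)
    finally show "(\<integral>\<^sup>+ x. ennreal (u x powr s) \<partial>lebesgue) \<le> ennreal C * (\<integral>\<^sup>+ x. ennreal (g x powr s) \<partial>lebesgue)" .
  qed
qed

section \<open>Semicontinuity, measurability and finiteness of the maximal function\<close>

text \<open>The cubes are closed, so a cube through \<open>x\<close> need not contain the points
  near \<open>x\<close>. Enlarging it by a small \<open>e\<close> on every side repairs this: the
  integral does not decrease and the volume changes continuously, so the average stays above
  \<open>t\<close>.\<close>

lemma open_maxi_superlevel: "open {x :: real ^ 'n. t < maxi g x}"
proof (rule openI)
  fix x :: "real ^ 'n" assume "x \<in> {x. t < maxi g x}"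
  then obtain Q where Q: "Q \<in> cubes" "x \<in> Q" "t < avg Q g"
    by (auto simp: maxi_def less_SUP_iff)
  from Q(1) obtain a s where s: "0 < s" and Qeq: "Q = cbox a (a + s *\<^sub>R One)"
    by (auto elim: cubesE)
  define n where "n = CARD('n)"
  define I where "I = (\<integral>\<^sup>+ y \<in> Q. g y \<partial>lebesgue)"
  have avgQ: "avg Q g = I / ennreal (s ^ n)"
    unfolding avg_def I_def n_def Qeq using s by (simp add: emeasure_cube del: emeasure_completion)
  have "t \<noteq> top" using Q(3) by auto
  then obtain t' where t': "0 \<le> t'" "t = ennreal t'" by (cases t) auto
  obtain e where e: "0 < e" "t < I / ennreal ((s + 2 * e) ^ n)"
  proof (cases "I = \<infinity>")
    case True
    then show ?thesis using that[of 1] s t' by (simp add: ennreal_top_divide)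
  next
    case False
    then obtain I' where I': "0 \<le> I'" "I = ennreal I'" by (cases I) auto
    have "t' < I' / s ^ n" using Q(3) s t' I' unfolding avgQ by (simp add: divide_ennreal ennreal_less_iff)
    then have *: "t' * (s + 2 * 0) ^ n < I'" using s by (simp add: field_simps)
    have "((\<lambda>e. t' * (s + 2 * e) ^ n) \<longlongrightarrow> t' * (s + 2 * 0) ^ n) (at_right 0)"
      by (intro tendsto_intros)
    then have "\<forall>\<^sub>F e in at_right 0. t' * (s + 2 * e) ^ n < I'"
      using * by (rule order_tendstoD)
    then have "\<forall>\<^sub>F e in at_right 0. t' * (s + 2 * e) ^ n < I' \<and> 0 < e"
      using eventually_at_right_less[of "0 :: real"] by eventually_elim auto
    then obtain e where e: "t' * (s + 2 * e) ^ n < I'" "0 < e"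
      using eventually_happens' trivial_limit_at_right_real by blast
    then have "t' < I' / (s + 2 * e) ^ n" using s by (simp add: field_simps)
    then show ?thesis using that[of e] e s t' I' by (simp add: divide_ennreal ennreal_less_iff)
  qed
  define a' where "a' = a - e *\<^sub>R (One :: real ^ 'n)"
  define P where "P = cbox a' (a' + (s + 2 * e) *\<^sub>R One)"
  have P: "P \<in> cubes" unfolding P_def using s e by (intro cubesI) auto
  have QP: "Q \<subseteq> P"
  proof
    fix y assume "y \<in> Q"
    then have "a $ i \<le> y $ i" "y $ i \<le> a $ i + s" for i unfolding Qeq mem_cube by auto
    then show "y \<in> P" unfolding P_def mem_cube a'_def using e
      by (auto simp: algebra_simps intro: order_trans[rotated] add_increasing)
  qed
  have lt: "t < avg P g"
  proof -
    have "I \<le> (\<integral>\<^sup>+ y \<in> P. g y \<partial>lebesgue)"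
      unfolding I_def using QP by (intro nn_integral_mono) (auto simp: indicator_def)
    moreover have "emeasure lebesgue P = ennreal ((s + 2 * e) ^ n)"
      unfolding P_def n_def using s e by (intro emeasure_cube) auto
    ultimately have "I / ennreal ((s + 2 * e) ^ n) \<le> avg P g"
      unfolding avg_def by (auto intro: divide_right_mono_ennreal)
    with e show ?thesis by (rule_tac less_le_trans)
  qed
  have "ball x e \<subseteq> {x. t < maxi g x}"
  proof
    fix y assume "y \<in> ball x e"
    then have "\<bar>(x - y) $ i\<bar> < e" for i
      using component_le_norm_cart[of "x - y" i] by (simp add: dist_norm)
    then have *: "\<bar>x $ i - y $ i\<bar> < e" for i by simp
    have "y \<in> P" unfolding P_def mem_cube
    proof
      fix i
      have "a $ i \<le> x $ i" "x $ i \<le> a $ i + s" using Q(2) unfolding Qeq mem_cube by auto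
      then show "a' $ i \<le> y $ i \<and> y $ i \<le> a' $ i + (s + 2 * e)"
        using *[of i] by (auto simp: a'_def)
    qed
    then show "y \<in> {x. t < maxi g x}" using lt P avg_le_maxi[of P y g] by auto
  qed
  with e show "\<exists>e>0. ball x e \<subseteq> {x. t < maxi g x}" by blast
qed

lemma maxi_measurable [measurable]: "maxi g \<in> borel_measurable lebesgue"
proof (rule borel_measurableI_greater)
  fix t
  show "{x \<in> space lebesgue. t < maxi g x} \<in> sets lebesgue"
    using open_maxi_superlevel[of t g] by simp
qed

text \<open>On the set \<open>S\<close> where the maximal function is infinite, every multiple
  \<open>N * indicator S\<close> is a real minorant of it. The strong type inequality bounds
  \<open>N powr c\<close> times the measure of \<open>S\<close> independently of \<open>N\<close>,
  so \<open>S\<close> is a null set.\<close>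

lemma maxi_finite_AE:
  fixes g :: "real ^ 'n \<Rightarrow> real"
  assumes [measurable]: "g \<in> borel_measurable lebesgue" and g: "\<And>x. 0 \<le> g x" and c: "1 < c"
    and fin: "(\<integral>\<^sup>+ x. ennreal (g x powr c) \<partial>lebesgue) < \<infinity>"
  shows "AE x in lebesgue. maxi (\<lambda>y. ennreal (g y)) x < \<infinity>"
proof -
  let ?M = "maxi (\<lambda>y. ennreal (g y))"
  define S where "S = {x. ?M x = \<infinity>}"
  have S [measurable]: "S \<in> sets lebesgue"
    using borel_measurable_eq[OF maxi_measurable[of "\<lambda>y. ennreal (g y)"] measurable_const[of \<infinity>]]
    by (simp add: S_def)
  obtain K where K: "0 \<le> K"
    "\<And>(g :: real ^ 'n \<Rightarrow> real) u. g \<in> borel_measurable lebesgue \<Longrightarrow> u \<in> borel_measurable lebesgue \<Longrightarrow>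
      (\<And>x. 0 \<le> g x) \<Longrightarrow> (\<And>x. 0 \<le> u x) \<Longrightarrow> (\<And>x. ennreal (u x) \<le> maxi (\<lambda>y. ennreal (g y)) x) \<Longrightarrow>
      (\<integral>\<^sup>+ x. ennreal (u x powr c) \<partial>lebesgue) \<le> ennreal K * (\<integral>\<^sup>+ x. ennreal (g x powr c) \<partial>lebesgue)"
    by (rule maximal_strong_type[OF c, where 'n = 'n]) blast
  obtain G where G: "0 \<le> G" "(\<integral>\<^sup>+ x. ennreal (g x powr c) \<partial>lebesgue) = ennreal G"
    using fin by (cases "\<integral>\<^sup>+ x. ennreal (g x powr c) \<partial>lebesgue") auto
  have bound: "ennreal T * emeasure lebesgue S \<le> ennreal (K * G)" if T: "0 < T" for T
  proof -
    define N where "N = T powr (1 / c)"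
    have N: "N powr c = T" using T c by (simp add: N_def powr_powr)
    have m: "(\<lambda>x. N * indicator S x) \<in> borel_measurable lebesgue" using S by measurable
    have "ennreal T * emeasure lebesgue S = (\<integral>\<^sup>+ x. ennreal T * indicator S x \<partial>lebesgue)"
      by (rule nn_integral_cmult_indicator[symmetric, OF S])
    also have "\<dots> = (\<integral>\<^sup>+ x. ennreal ((N * indicator S x) powr c) \<partial>lebesgue)"
      using N c by (intro nn_integral_cong) (auto simp: indicator_def)
    also have "\<dots> \<le> ennreal K * (\<integral>\<^sup>+ x. ennreal (g x powr c) \<partial>lebesgue)"
      by (rule K(2)) (use m g in \<open>auto simp: N_def S_def indicator_def\<close>)
    also have "\<dots> = ennreal (K * G)" using K G by (simp add: ennreal_mult)
    finally show ?thesis .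
  qed
  have "emeasure lebesgue S = 0"
  proof (rule ccontr)
    assume nz: "emeasure lebesgue S \<noteq> 0"
    have "emeasure lebesgue S \<noteq> \<infinity>" using bound[of 1] by (auto simp: top_unique)
    then obtain \<mu> where \<mu>: "0 \<le> \<mu>" "emeasure lebesgue S = ennreal \<mu>"
      by (cases "emeasure lebesgue S") auto
    with nz have \<mu>0: "0 < \<mu>" by (cases "\<mu> = 0") auto
    have "ennreal ((K * G + 1) / \<mu>) * ennreal \<mu> \<le> ennreal (K * G)"
      using bound[of "(K * G + 1) / \<mu>"] \<mu> \<mu>0 K G by (simp add: add_nonneg_pos)
    then have "ennreal (K * G + 1) \<le> ennreal (K * G)"
      using \<mu>0 K G by (subst (asm) ennreal_mult[symmetric]) auto
    then show False using K G by (subst (asm) ennreal_le_iff) auto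
  qed
  then have "AE x in lebesgue. x \<notin> S" using S by (intro AE_not_in) (auto intro: null_setsI)
  then show ?thesis by eventually_elim (auto simp: S_def less_top)
qed

section \<open>Log-Hoelder continuous exponents\<close>

text \<open>The base is the one in the decay condition at infinity, so
  \<open>- ln (decay m x)\<close> is exactly \<open>m\<close> times the denominator there.\<close>

definition decay :: "real \<Rightarrow> real ^ 'n \<Rightarrow> real"
  where "decay m x = (exp 1 + norm x) powr (- m)"

lemma base_ge_1: "1 \<le> exp 1 + norm (x :: real ^ 'n)"
  using exp_ge_add_one_self[of 1] norm_ge_zero[of x] by linarith

lemma decay_pos: "0 < decay m x"
  using base_ge_1[of x] by (simp add: decay_def)

lemma decay_le_1: "0 \<le> m \<Longrightarrow> decay m x \<le> 1"
  using base_ge_1[of x] powr_mono[of "- m" 0 "exp 1 + norm x"] by (simp add: decay_def)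

lemma decay_powr: "decay m x powr k = decay (m * k) x"
  by (simp add: decay_def powr_powr)

lemma decay_measurable [measurable]: "decay m \<in> borel_measurable lebesgue"
proof -
  have "decay m \<in> borel_measurable lborel" unfolding decay_def by measurable
  then show ?thesis by (rule measurable_completion)
qed

text \<open>On the shell where \<open>2 ^ (k - 1) < norm x \<le> 2 ^ k\<close> the weight is at most
  of order \<open>2 powr (- k * (n + 1))\<close>, while the cube \<open>I k\<close> around it has
  volume of order \<open>2 ^ (k * n)\<close>. The products form a geometric series of ratio
  \<open>1 / 2\<close>.\<close>

lemma decay_integral_finite:
  "(\<integral>\<^sup>+ x. ennreal (decay (real CARD('n) + 1) (x :: real ^ 'n)) \<partial>lebesgue) < \<infinity>"
proof -
  define n where "n = CARD('n)"
  define I where "I k = cbox (- (2 ^ k) *\<^sub>R One :: real ^ 'n) (- (2 ^ k) *\<^sub>R One + (2 * 2 ^ k) *\<^sub>R One)" for k :: nat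
  have I: "emeasure lebesgue (I k) = ennreal ((2 * 2 ^ k) ^ n)" for k
    unfolding I_def n_def by (rule emeasure_cube) simp
  have [measurable]: "I k \<in> sets lebesgue" for k unfolding I_def by simp
  let ?c = "\<lambda>k :: nat. 2 powr ((1 - real k) * (real n + 1))"
  have le: "ennreal (decay (real n + 1) x) \<le> (\<integral>\<^sup>+ k. ennreal (?c k) * indicator (I k) x \<partial>count_space UNIV)"
    for x :: "real ^ 'n"
  proof -
    obtain k0 where "norm x \<le> 2 ^ k0"
      using real_arch_pow[of 2 "norm x"] by (auto intro: less_imp_le)
    define k where "k = (LEAST k. norm x \<le> 2 ^ k)"
    have k: "norm x \<le> 2 ^ k" unfolding k_def by (rule LeastI) fact
    have "x \<in> I k" unfolding I_def mem_cube
    proof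
      fix i show "(- (2 ^ k) *\<^sub>R One :: real ^ 'n) $ i \<le> x $ i \<and> x $ i \<le> (- (2 ^ k) *\<^sub>R One :: real ^ 'n) $ i + 2 * 2 ^ k"
        using component_le_norm_cart[of x i] k by auto
    qed
    moreover have "2 powr (real k - 1) \<le> exp 1 + norm x"
    proof (cases k)
      case 0
      then show ?thesis using base_ge_1[of x] by (simp add: powr_minus)
    next
      case (Suc j)
      then have "\<not> norm x \<le> 2 ^ j" using not_less_Least[of j "\<lambda>k. norm x \<le> 2 ^ k"] by (simp add: k_def)
      then show ?thesis using Suc by (simp add: powr_realpow add_increasing)
    qed
    then have "decay (real n + 1) x \<le> (2 powr (real k - 1)) powr (- (real n + 1))"
      unfolding decay_def by (intro powr_mono2') auto
    then have "decay (real n + 1) x \<le> ?c k" by (simp add: powr_powr algebra_simps)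
    ultimately have "ennreal (decay (real n + 1) x) \<le> ennreal (?c k) * indicator (I k) x"
      by (simp add: ennreal_leI)
    also have "\<dots> \<le> (\<integral>\<^sup>+ k. ennreal (?c k) * indicator (I k) x \<partial>count_space UNIV)"
      by (rule nn_integral_ge_point) simp
    finally show ?thesis .
  qed
  have "(\<integral>\<^sup>+ x. ennreal (decay (real n + 1) (x :: real ^ 'n)) \<partial>lebesgue)
    \<le> (\<integral>\<^sup>+ x. \<integral>\<^sup>+ k. ennreal (?c k) * indicator (I k) x \<partial>count_space UNIV \<partial>lebesgue)"
    by (intro nn_integral_mono le)
  also have "\<dots> = (\<integral>\<^sup>+ k. ennreal (?c k) * emeasure lebesgue (I k) \<partial>count_space UNIV)"
    by (subst nn_integral_count_space_nn_integral) (simp_all add: nn_integral_cmult del: emeasure_completion)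
  also have "\<dots> = (\<Sum>k. ennreal (?c k) * emeasure lebesgue (I k))"
    by (rule nn_integral_count_space_nat)
  also have "\<dots> = (\<Sum>k. ennreal (2 ^ (2 * n + 1) * (1 / 2) ^ k))"
  proof (intro suminf_cong)
    fix k
    have "(2 * 2 ^ k) ^ n = (2 :: real) ^ ((k + 1) * n)"
      by (simp add: power_mult[symmetric] power_mult_distrib power_add)
    also have "\<dots> = 2 powr ((real k + 1) * n)" by (subst powr_realpow[symmetric]) (auto simp: algebra_simps)
    finally have "?c k * (2 * 2 ^ k) ^ n = 2 powr (real (2 * n + 1) - real k)"
      by (simp add: powr_add[symmetric] algebra_simps)
    also have "\<dots> = 2 ^ (2 * n + 1) / 2 ^ k"
      by (subst powr_diff) (auto simp: powr_realpow simp flip: of_nat_Suc)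
    finally show "ennreal (?c k) * emeasure lebesgue (I k) = ennreal (2 ^ (2 * n + 1) * (1 / 2) ^ k)"
      unfolding I by (subst ennreal_mult[symmetric]) (auto simp: power_divide)
  qed
  also have "\<dots> = ennreal (\<Sum>k. 2 ^ (2 * n + 1) * (1 / 2) ^ k)"
    by (intro suminf_ennreal2) (auto intro!: summable_mult summable_geometric)
  also have "\<dots> < \<infinity>" by simp
  finally show ?thesis by (simp add: n_def)
qed

section \<open>Quantitative use of the two log-Hoelder conditions\<close>

text \<open>The constants are parameters and the exponent is only asked to be at least 1, so that
  \<open>r / c\<close> is again an instance for every \<open>c\<close> below all values of
  \<open>r\<close> and its limit.\<close>

locale log_hoelder =
  fixes r :: "real ^ 'n \<Rightarrow> real" and R C D l :: real
  assumes meas [measurable]: "r \<in> borel_measurable lebesgue"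
    and r_ge: "\<And>x. 1 \<le> r x" and r_le: "\<And>x. r x \<le> R" and l_ge: "1 \<le> l"
    and C_nonneg: "0 \<le> C" and D_nonneg: "0 \<le> D"
    and local: "\<And>x y. \<bar>r x - r y\<bar> \<le> C / ln (exp 1 + 1 / norm (x - y))"
    and infinity: "\<And>x. \<bar>r x - l\<bar> \<le> D / ln (exp 1 + norm x)"
begin

definition nn :: real where "nn = real CARD('n)"
definition Cloc :: real where "Cloc = exp (nn * (C * (1 + ln nn)))"

lemma nn_ge: "1 \<le> nn"
  by (simp add: nn_def Suc_leI)

lemma Cloc_ge: "1 \<le> Cloc"
  using C_nonneg nn_ge by (simp add: Cloc_def)

text \<open>Points of the cube are at distance at most \<open>nn * s\<close>, so
  \<open>ln (1 / s)\<close> exceeds the logarithm \<open>L\<close> of the local condition by at most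
  \<open>ln nn\<close>; as \<open>1 \<le> L\<close>, this summand is absorbed into the factor
  \<open>1 + ln nn\<close>.\<close>

lemma local_cube:
  assumes "x \<in> cbox a (a + s *\<^sub>R One)" "y \<in> cbox a (a + s *\<^sub>R One)" and s: "0 < s" "s \<le> 1"
  shows "\<bar>r x - r y\<bar> * ln (1 / s) \<le> C * (1 + ln nn)"
proof (cases "x = y")
  case True
  then show ?thesis using C_nonneg nn_ge by simp
next
  case False
  define d where "d = norm (x - y)"
  have d: "0 < d" "d \<le> nn * s" using False norm_diff_cube[OF assms(1,2)] by (auto simp: d_def nn_def)
  define L where "L = ln (exp 1 + 1 / d)"
  have "exp 1 \<le> exp 1 + 1 / d" using d by simp
  then have L: "1 \<le> L" unfolding L_def using d by (subst ln_ge_iff) (auto intro: add_pos_pos)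
  have "1 / s \<le> nn * (exp 1 + 1 / d)"
  proof -
    have "1 / s \<le> nn * (1 / d)" using d s by (simp add: field_simps)
    also have "\<dots> \<le> nn * (exp 1 + 1 / d)" using nn_ge by (intro mult_left_mono) auto
    finally show ?thesis .
  qed
  then have "ln (1 / s) \<le> ln (nn * (exp 1 + 1 / d))" using s by (intro ln_mono) auto
  also have "\<dots> = ln nn + L" using nn_ge d unfolding L_def by (intro ln_mult_pos) (auto intro: add_pos_pos)
  also have "\<dots> \<le> (1 + ln nn) * L"
    using L nn_ge mult_left_mono[of 1 L "ln nn"] by (simp add: algebra_simps)
  finally have 1: "ln (1 / s) \<le> (1 + ln nn) * L" .
  have 2: "\<bar>r x - r y\<bar> \<le> C / L" using local[of x y] by (simp add: L_def d_def)
  have "\<bar>r x - r y\<bar> * ln (1 / s) \<le> (C / L) * ((1 + ln nn) * L)"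
    using 1 2 s by (intro mult_mono) auto
  also have "\<dots> = C * (1 + ln nn)" using L by simp
  finally show ?thesis .
qed

text \<open>For bases up to \<open>s powr (- nn)\<close>, the reciprocal volume, \<open>ln t\<close>
  is at most \<open>nn * ln (1 / s)\<close>, which the local condition compensates. On small cubes
  the exponents at two points are thus interchangeable up to \<open>Cloc\<close>.\<close>

lemma powr_local:
  assumes "x \<in> cbox a (a + s *\<^sub>R One)" "y \<in> cbox a (a + s *\<^sub>R One)" and s: "0 < s" "s \<le> 1"
    and t: "1 \<le> t" "t \<le> s powr (- nn)"
  shows "t powr (r x - r y) \<le> Cloc"
proof -
  have "ln t \<le> ln (s powr (- nn))" using t by (intro ln_mono) auto
  also have "\<dots> = nn * ln (1 / s)" using s by (simp add: ln_powr ln_div)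
  finally have lt: "ln t \<le> nn * ln (1 / s)" .
  have "(r x - r y) * ln t \<le> \<bar>r x - r y\<bar> * (nn * ln (1 / s))"
    using lt t by (intro mult_mono) auto
  also have "\<dots> = nn * (\<bar>r x - r y\<bar> * ln (1 / s))" by simp
  also have "\<dots> \<le> nn * (C * (1 + ln nn))"
    using nn_ge by (intro mult_left_mono local_cube[OF assms(1-4)]) auto
  finally show ?thesis using t by (simp add: powr_def Cloc_def)
qed

text \<open>The lower bound on \<open>t\<close> gives
  \<open>\<bar>ln t\<bar> \<le> m * ln (exp 1 + norm x)\<close>, which cancels against the decay
  condition. Smaller \<open>t\<close> are treated separately, by bounding the power itself by the
  weight. The factor \<open>k\<close> is there because the fractional estimate meets a multiple of
  \<open>r x - l\<close>.\<close>

lemma powr_infinity: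
  assumes m: "0 \<le> m" and t: "decay m x \<le> t" "t \<le> 1" and e: "\<bar>e\<bar> \<le> k * \<bar>r x - l\<bar>" "0 \<le> k"
  shows "t powr e \<le> exp (k * m * D)"
proof -
  define L where "L = ln (exp 1 + norm x)"
  have "exp 1 \<le> exp 1 + norm x" by simp
  then have L: "1 \<le> L" unfolding L_def by (subst ln_ge_iff) (auto intro: add_pos_nonneg)
  have t0: "0 < t" using t decay_pos[of m x] by linarith
  have "ln (decay m x) \<le> ln t" using t decay_pos by (intro ln_mono) auto
  then have "- ln t \<le> m * L" using base_ge_1[of x] by (simp add: decay_def ln_powr L_def)
  moreover have "ln t \<le> 0" using t t0 by simp
  ultimately have lt: "\<bar>ln t\<bar> \<le> m * L" by simp
  have "e * ln t \<le> \<bar>e\<bar> * \<bar>ln t\<bar>" by (metis abs_ge_self abs_mult)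
  also have "\<dots> \<le> (k * (D / L)) * (m * L)"
  proof (rule mult_mono)
    show "\<bar>e\<bar> \<le> k * (D / L)" using e(1) mult_left_mono[OF infinity[of x] e(2)] by (simp add: L_def)
  qed (use lt e D_nonneg L in auto)
  also have "\<dots> = k * m * D" using L by simp
  finally show ?thesis using t0 by (simp add: powr_def)
qed

text \<open>Above the threshold \<open>decay m x\<close> the exponents can be exchanged; below it
  both powers are at most \<open>t\<close>, since both exponents are at least 1, and hence at most
  the weight.\<close>

lemma powr_swap:
  assumes m: "0 \<le> m" and t: "0 \<le> t" "t \<le> 1"
  shows "t powr r x \<le> exp (m * D) * t powr l + decay m x"
    and "t powr l \<le> exp (m * D) * t powr r x + decay m x"
proof -
  have "t powr r x \<le> exp (m * D) * t powr l + decay m x \<and> t powr l \<le> exp (m * D) * t powr r x + decay m x"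
  proof (cases "decay m x \<le> t")
    case True
    then have t0: "0 < t" using decay_pos[of m x] by linarith
    have "t powr (r x - l) \<le> exp (1 * m * D)" "t powr (l - r x) \<le> exp (1 * m * D)"
      using True t m by (intro powr_infinity[where k = 1 and x = x]; simp add: abs_minus_commute)+
    then have "t powr l * t powr (r x - l) \<le> t powr l * exp (m * D)"
      "t powr r x * t powr (l - r x) \<le> t powr r x * exp (m * D)"
      by (auto intro: mult_left_mono)
    then show ?thesis using decay_pos[of m x] by (simp add: powr_add[symmetric] mult.commute add_increasing2)
  next
    case False
    have le: "t powr k \<le> decay m x" if "1 \<le> k" for k
      using powr_mono'[of 1 k t] t False that by simp
    show ?thesis using le[OF r_ge[of x]] le[OF l_ge] by (auto intro: add_increasing)
  qed
  then show "t powr r x \<le> exp (m * D) * t powr l + decay m x"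
    and "t powr l \<le> exp (m * D) * t powr r x + decay m x" by auto
qed

end

text \<open>Replaces Jensen's inequality: unlike there, the exponent \<open>k\<close> may vary under an integral.\<close>

lemma young_threshold:
  assumes "0 \<le> (t :: real)" "0 < a" "1 \<le> k"
  shows "t \<le> a + t powr k * a powr (1 - k)"
proof (cases "t \<le> a")
  case True
  then show ?thesis by (simp add: add_increasing2)
next
  case False
  then have "t = t powr k * t powr (1 - k)" using assms by (simp add: powr_add[symmetric])
  also have "\<dots> \<le> t powr k * a powr (1 - k)"
    using False assms by (intro mult_left_mono powr_mono2') auto
  finally show ?thesis using assms by simp
qed

section \<open>A priori bounds for averages and for norms of indicators\<close>

lemma emeasure_cube_powr:
  "0 < s \<Longrightarrow> emeasure lebesgue (cbox a (a + s *\<^sub>R (One :: real ^ 'n))) = ennreal (s powr real CARD('n))"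
  by (simp add: emeasure_cube powr_realpow del: emeasure_completion)

lemma avg_le_integral:
  fixes a :: "real ^ 'n"
  assumes "0 < s" "0 \<le> B" "(\<integral>\<^sup>+ y. g y \<partial>lebesgue) \<le> ennreal B"
  shows "avg (cbox a (a + s *\<^sub>R One)) g \<le> ennreal (B / s powr real CARD('n))"
proof -
  have "(\<integral>\<^sup>+ y \<in> cbox a (a + s *\<^sub>R One). g y \<partial>lebesgue) \<le> (\<integral>\<^sup>+ y. g y \<partial>lebesgue)"
    by (intro nn_integral_mono) (auto simp: indicator_def)
  then have "(\<integral>\<^sup>+ y \<in> cbox a (a + s *\<^sub>R One). g y \<partial>lebesgue) \<le> ennreal B"
    using assms(3) by (rule order_trans)
  then show ?thesis
    unfolding avg_def emeasure_cube_powr[OF assms(1)]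
    using assms by (subst divide_ennreal[symmetric]) (auto intro: divide_right_mono_ennreal)
qed

lemma avg_affine_le:
  fixes f w :: "real ^ 'n \<Rightarrow> real"
  assumes [measurable]: "w \<in> borel_measurable lebesgue" and Q: "Q \<in> cubes"
    and le: "\<And>y. y \<in> Q \<Longrightarrow> f y \<le> \<alpha> + c * w y"
    and "0 \<le> \<alpha>" "0 \<le> c" "\<And>y. 0 \<le> w y"
  shows "avg Q (\<lambda>y. ennreal (f y)) \<le> ennreal \<alpha> + ennreal c * avg Q (\<lambda>y. ennreal (w y))"
proof -
  have "avg Q (\<lambda>y. ennreal (f y)) \<le> avg Q (\<lambda>y. ennreal \<alpha> + ennreal c * ennreal (w y))"
    by (rule avg_mono) (use assms in \<open>auto simp: ennreal_mult[symmetric] ennreal_plus[symmetric] ennreal_leI simp del: ennreal_plus\<close>)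
  also have "\<dots> = ennreal \<alpha> + ennreal c * avg Q (\<lambda>y. ennreal (w y))"
    using Q by (simp add: avg_add avg_const avg_cmult)
  finally show ?thesis .
qed

context log_hoelder
begin

definition decay_mass :: real where "decay_mass = enn2real (\<integral>\<^sup>+ x. ennreal (decay (nn + 1) (x :: real ^ 'n)) \<partial>lebesgue)"
definition Cinf :: real where "Cinf = exp ((nn + 1) * D)"
text \<open>One constant for cubes of every size: small ones cost \<open>1 + Cloc\<close>, large
  ones \<open>1 + decay_mass + Cinf\<close>.\<close>

definition Kavg :: real where "Kavg = 1 + decay_mass + Cloc + Cinf"

lemma decay_mass: "(\<integral>\<^sup>+ x. ennreal (decay (nn + 1) (x :: real ^ 'n)) \<partial>lebesgue) = ennreal decay_mass" "0 \<le> decay_mass"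
  using decay_integral_finite[where 'n = 'n] by (simp_all add: decay_mass_def nn_def less_top)

lemma Cinf_ge: "1 \<le> Cinf"
  using D_nonneg nn_ge by (simp add: Cinf_def)

lemma Kavg_ge: "1 \<le> Kavg"
  using decay_mass Cloc_ge Cinf_ge by (simp add: Kavg_def)

lemma powr_exponent_measurable:
  assumes [measurable]: "f \<in> borel_measurable lebesgue"
  shows "(\<lambda>y. f y powr r y) \<in> borel_measurable lebesgue"
  by measurable

text \<open>The function is split at the height \<open>\<alpha>\<close> with
  \<open>\<alpha> powr r x = 1 / |Q|\<close>. The part above it is controlled by the modular, once
  \<open>r y\<close> is exchanged for \<open>r x\<close>; this is allowed since
  \<open>1 \<le> \<alpha> \<le> 1 / |Q|\<close>.\<close>

lemma modular_avg_bound_small: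
  assumes f: "f \<in> borel_measurable lebesgue" "\<And>y. 0 \<le> f y"
    and mod: "(\<integral>\<^sup>+ y. ennreal (f y powr r y) \<partial>lebesgue) \<le> 1"
    and x: "x \<in> cbox a (a + s *\<^sub>R One)" and s: "0 < s" "s \<le> 1"
  shows "avg (cbox a (a + s *\<^sub>R One)) (\<lambda>y. ennreal (f y)) \<le> ennreal (Kavg * s powr (- nn / r x))"
proof -
  let ?Q = "cbox a (a + s *\<^sub>R (One :: real ^ 'n))"
  have rx: "0 < r x" using r_ge[of x] by simp
  define \<alpha> where "\<alpha> = s powr (- nn / r x)"
  have \<alpha>: "1 \<le> \<alpha>" "\<alpha> \<le> s powr (- nn)"
  proof -
    have "s powr 0 \<le> s powr (- nn / r x)" using s rx nn_ge by (intro powr_mono') auto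
    then show "1 \<le> \<alpha>" using s by (simp add: \<alpha>_def)
    have "nn / r x \<le> nn" using r_ge[of x] nn_ge by (simp add: field_simps)
    then show "\<alpha> \<le> s powr (- nn)" unfolding \<alpha>_def using s by (intro powr_mono') auto
  qed
  have pw: "f y \<le> \<alpha> + (Cloc * \<alpha> * s powr nn) * (f y powr r y)" if y: "y \<in> ?Q" for y
  proof -
    have "\<alpha> powr (1 - r y) = \<alpha> * \<alpha> powr (- r x) * \<alpha> powr (r x - r y)"
      using \<alpha> by (simp add: powr_diff powr_minus_divide)
    also have "\<alpha> powr (- r x) = s powr nn" using rx by (simp add: \<alpha>_def powr_powr)
    also have "\<alpha> * s powr nn * \<alpha> powr (r x - r y) \<le> \<alpha> * s powr nn * Cloc"
      using \<alpha> by (intro mult_left_mono powr_local[OF x y s \<alpha>]) auto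
    finally have "f y powr r y * \<alpha> powr (1 - r y) \<le> f y powr r y * (\<alpha> * s powr nn * Cloc)"
      by (rule mult_left_mono) simp
    with young_threshold[of "f y" \<alpha> "r y"] show ?thesis using f(2)[of y] \<alpha> r_ge[of y] by (simp add: mult_ac)
  qed
  have "avg ?Q (\<lambda>y. ennreal (f y)) \<le> ennreal \<alpha> + ennreal (Cloc * \<alpha> * s powr nn) * avg ?Q (\<lambda>y. ennreal (f y powr r y))"
    using \<alpha> Cloc_ge s by (intro avg_affine_le powr_exponent_measurable f pw cubesI) auto
  also have "\<dots> \<le> ennreal \<alpha> + ennreal (Cloc * \<alpha> * s powr nn) * ennreal (1 / s powr nn)"
    using avg_le_integral[of s 1 _ a] mod s by (intro add_left_mono mult_left_mono) (auto simp: nn_def)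
  also have "\<dots> = ennreal ((1 + Cloc) * \<alpha>)"
    using \<alpha> Cloc_ge s
    by (simp add: ennreal_mult[symmetric] ennreal_plus[symmetric] algebra_simps del: ennreal_plus)
  also have "\<dots> \<le> ennreal (Kavg * \<alpha>)"
    using \<alpha> decay_mass Cinf_ge by (intro ennreal_leI mult_right_mono) (auto simp: Kavg_def)
  finally show ?thesis by (simp add: \<alpha>_def)
qed

text \<open>Now \<open>\<alpha> powr l = 1 / |Q|\<close> and each \<open>r y\<close> is exchanged
  for \<open>l\<close>, which is possible only at heights not below the weight. The splitting height
  is therefore \<open>max \<alpha> (decay (nn + 1) y)\<close>; the added weight has average at most
  \<open>decay_mass / |Q|\<close>, and \<open>1 / |Q| \<le> \<alpha>\<close> because
  \<open>1 \<le> l\<close>.\<close>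

lemma modular_avg_bound_large:
  assumes f: "f \<in> borel_measurable lebesgue" "\<And>y. 0 \<le> f y"
    and mod: "(\<integral>\<^sup>+ y. ennreal (f y powr r y) \<partial>lebesgue) \<le> 1" and s: "1 \<le> s"
  shows "avg (cbox a (a + s *\<^sub>R One)) (\<lambda>y. ennreal (f y)) \<le> ennreal (Kavg * s powr (- nn / l))"
proof -
  let ?Q = "cbox a (a + s *\<^sub>R (One :: real ^ 'n))"
  define \<alpha> where "\<alpha> = s powr (- nn / l)"
  have s0: "0 < s" using s by simp
  have \<alpha>: "0 < \<alpha>" "\<alpha> \<le> 1" "1 / s powr nn \<le> \<alpha>"
  proof -
    show "0 < \<alpha>" using s by (simp add: \<alpha>_def)
    have "s powr (- nn / l) \<le> s powr 0" using s l_ge nn_ge by (intro powr_mono) auto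
    then show "\<alpha> \<le> 1" using s by (simp add: \<alpha>_def)
    have "nn / l \<le> nn" using l_ge nn_ge by (simp add: field_simps)
    then have "s powr (- nn) \<le> \<alpha>" unfolding \<alpha>_def using s by (intro powr_mono) auto
    then show "1 / s powr nn \<le> \<alpha>" by (simp add: powr_minus_divide)
  qed
  let ?h = "\<lambda>y. decay (nn + 1) y :: real"
  define c where "c = Cinf * \<alpha> * s powr nn"
  have c: "0 \<le> c" using Cinf_ge \<alpha> by (simp add: c_def)
  have pw: "f y \<le> \<alpha> + 1 * (?h y + c * (f y powr r y))" for y
  proof -
    define \<tau> where "\<tau> = max \<alpha> (?h y)"
    have \<tau>: "0 < \<tau>" "\<tau> \<le> 1" "\<alpha> \<le> \<tau>" "?h y \<le> \<tau>" "\<tau> \<le> \<alpha> + ?h y"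
      using \<alpha> decay_le_1[of "nn + 1" y] decay_pos[of "nn + 1" y] nn_ge by (auto simp: \<tau>_def)
    have "\<tau> powr (1 - r y) = \<tau> powr (1 - l) * \<tau> powr (l - r y)"
      using \<tau> by (simp add: powr_add[symmetric])
    also have "\<dots> \<le> \<alpha> powr (1 - l) * Cinf"
    proof (rule mult_mono)
      show "\<tau> powr (1 - l) \<le> \<alpha> powr (1 - l)" using \<alpha> \<tau> l_ge by (intro powr_mono2') auto
      have "\<tau> powr (l - r y) \<le> exp (1 * (nn + 1) * D)"
        using \<tau> nn_ge by (intro powr_infinity[where x = y]) auto
      then show "\<tau> powr (l - r y) \<le> Cinf" by (simp add: Cinf_def)
    qed auto
    also have "\<alpha> powr (1 - l) = \<alpha> * \<alpha> powr (- l)"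
      using \<alpha> by (simp add: powr_diff powr_minus_divide)
    also have "\<alpha> powr (- l) = s powr nn" using l_ge by (simp add: \<alpha>_def powr_powr)
    finally have "f y powr r y * \<tau> powr (1 - r y) \<le> f y powr r y * (\<alpha> * s powr nn * Cinf)"
      by (rule mult_left_mono) simp
    with young_threshold[of "f y" \<tau> "r y"] show ?thesis
      using f(2)[of y] \<tau> r_ge[of y] by (simp add: c_def mult_ac)
  qed
  note [measurable] = powr_exponent_measurable[OF f(1)]
  have hle: "avg ?Q (\<lambda>y. ennreal (?h y)) \<le> ennreal (decay_mass / s powr nn)"
    using avg_le_integral[of s decay_mass _ a] decay_mass s by (auto simp: nn_def)
  have mle: "avg ?Q (\<lambda>y. ennreal (f y powr r y)) \<le> ennreal (1 / s powr nn)"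
    using avg_le_integral[of s 1 _ a] mod s by (auto simp: nn_def)
  have "avg ?Q (\<lambda>y. ennreal (f y)) \<le> ennreal \<alpha> + ennreal 1 * avg ?Q (\<lambda>y. ennreal (?h y + c * (f y powr r y)))"
    by (rule avg_affine_le) (use \<alpha> c s0 pw decay_pos in \<open>auto intro!: cubesI add_nonneg_nonneg less_imp_le[OF decay_pos]\<close>)
  also have "avg ?Q (\<lambda>y. ennreal (?h y + c * (f y powr r y)))
      = avg ?Q (\<lambda>y. ennreal (?h y)) + ennreal c * avg ?Q (\<lambda>y. ennreal (f y powr r y))"
    using c s0 by (simp add: avg_add[symmetric] avg_cmult[symmetric] cubesI ennreal_mult less_imp_le[OF decay_pos])
  also have "ennreal \<alpha> + ennreal 1 * \<dots> \<le> ennreal \<alpha> + ennreal 1 * (ennreal (decay_mass / s powr nn) + ennreal c * ennreal (1 / s powr nn))"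
    by (intro add_left_mono mult_left_mono add_mono hle mle) auto
  also have "\<dots> = ennreal (\<alpha> + decay_mass * (1 / s powr nn) + c * (1 / s powr nn))"
    using \<alpha> c decay_mass by (simp add: ennreal_mult[symmetric] ennreal_plus[symmetric] del: ennreal_plus)
  also have "\<dots> \<le> ennreal (Kavg * \<alpha>)"
  proof (rule ennreal_leI)
    have "c * (1 / s powr nn) = Cinf * \<alpha>" using s0 by (simp add: c_def)
    moreover have "decay_mass * (1 / s powr nn) \<le> decay_mass * \<alpha>" using decay_mass \<alpha> by (intro mult_left_mono) auto
    moreover have "0 \<le> Cloc * \<alpha>" using \<alpha> Cloc_ge by simp
    ultimately show "\<alpha> + decay_mass * (1 / s powr nn) + c * (1 / s powr nn) \<le> Kavg * \<alpha>"
      by (simp add: Kavg_def algebra_simps)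
  qed
  finally show ?thesis by (simp add: \<alpha>_def)
qed

text \<open>In terms of norms: the indicator of \<open>Q\<close> has norm at most
  \<open>Kavg\<close> times \<open>|Q|\<close> to the power \<open>1 / r x\<close>. Exchanging
  \<open>r y\<close> for \<open>r x\<close> costs \<open>Cloc\<close>, which the division by
  \<open>Kavg powr r y \<ge> Kavg\<close> makes good.\<close>

lemma indicator_modular_small:
  assumes x: "x \<in> cbox a (a + s *\<^sub>R One)" and s: "0 < s" "s \<le> 1"
  shows "modular r (\<lambda>y. indicator (cbox a (a + s *\<^sub>R One)) y / (Kavg * s powr (nn / r x))) \<le> 1"
proof -
  let ?Q = "cbox a (a + s *\<^sub>R (One :: real ^ 'n))"
  have rx: "0 < r x" using r_ge[of x] by simp
  define \<alpha> where "\<alpha> = s powr (- nn / r x)"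
  have \<alpha>: "1 \<le> \<alpha>" "\<alpha> \<le> s powr (- nn)"
  proof -
    have "s powr 0 \<le> s powr (- nn / r x)" using s rx nn_ge by (intro powr_mono') auto
    then show "1 \<le> \<alpha>" using s by (simp add: \<alpha>_def)
    have "nn / r x \<le> nn" using r_ge[of x] nn_ge by (simp add: field_simps)
    then show "\<alpha> \<le> s powr (- nn)" unfolding \<alpha>_def using s by (intro powr_mono') auto
  qed
  have inv: "1 / (Kavg * s powr (nn / r x)) = \<alpha> / Kavg"
    by (simp add: \<alpha>_def powr_minus_divide)
  have "(\<alpha> / Kavg) powr r y \<le> s powr (- nn)" if y: "y \<in> ?Q" for y
  proof -
    have "(\<alpha> / Kavg) powr r y = \<alpha> powr r y / Kavg powr r y"
      by (rule powr_divide)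
    also have "\<alpha> powr r y = \<alpha> powr r x * \<alpha> powr (r y - r x)"
      using \<alpha> by (simp add: powr_add[symmetric])
    also have "\<alpha> powr r x = s powr (- nn)" using rx by (simp add: \<alpha>_def powr_powr)
    also have "s powr (- nn) * \<alpha> powr (r y - r x) / Kavg powr r y \<le> s powr (- nn) * Cloc / Kavg"
    proof (rule frac_le)
      show "s powr (- nn) * \<alpha> powr (r y - r x) \<le> s powr (- nn) * Cloc"
        by (intro mult_left_mono powr_local[OF y x s \<alpha>]) auto
      show "Kavg \<le> Kavg powr r y" using powr_mono[of 1 "r y" Kavg] Kavg_ge r_ge[of y] by simp
    qed (use Kavg_ge Cloc_ge in auto)
    also have "\<dots> \<le> s powr (- nn)" using Kavg_ge decay_mass Cinf_ge by (simp add: field_simps Kavg_def)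
    finally show ?thesis .
  qed
  then have "modular r (\<lambda>y. indicator ?Q y / (Kavg * s powr (nn / r x)))
    \<le> (\<integral>\<^sup>+ y. ennreal (s powr (- nn)) * indicator ?Q y \<partial>lebesgue)"
    unfolding modular_def using inv \<alpha> Kavg_ge
    by (intro nn_integral_mono) (auto simp: indicator_def intro!: ennreal_leI)
  also have "\<dots> = ennreal (s powr (- nn)) * ennreal (s powr nn)"
    using s by (subst nn_integral_cmult_indicator) (simp_all add: emeasure_cube_powr nn_def del: emeasure_completion)
  also have "\<dots> = 1" using s by (simp add: ennreal_mult[symmetric] powr_add[symmetric])
  finally show ?thesis .
qed

text \<open>Exchanging \<open>r y\<close> for \<open>l\<close> leaves the weight as an error term.
  It integrates to \<open>decay_mass\<close>, and \<open>Kavg\<close> was chosen above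
  \<open>Cinf + decay_mass\<close>.\<close>

lemma indicator_modular_large:
  assumes s: "1 \<le> s"
  shows "modular r (\<lambda>y. indicator (cbox a (a + s *\<^sub>R One)) y / (Kavg * s powr (nn / l))) \<le> 1"
proof -
  let ?Q = "cbox a (a + s *\<^sub>R (One :: real ^ 'n))"
  define \<alpha> where "\<alpha> = s powr (- nn / l)"
  have s0: "0 < s" using s by simp
  have \<alpha>: "0 < \<alpha>" "\<alpha> \<le> 1"
  proof -
    show "0 < \<alpha>" using s by (simp add: \<alpha>_def)
    have "s powr (- nn / l) \<le> s powr 0" using s l_ge nn_ge by (intro powr_mono) auto
    then show "\<alpha> \<le> 1" using s by (simp add: \<alpha>_def)
  qed
  let ?h = "\<lambda>y. decay (nn + 1) y :: real"
  have inv: "1 / (Kavg * s powr (nn / l)) = \<alpha> / Kavg"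
    by (simp add: \<alpha>_def powr_minus_divide)
  have pw: "(\<alpha> / Kavg) powr r y \<le> (Cinf / Kavg) * s powr (- nn) + 1 / Kavg * ?h y" for y
  proof -
    have "(\<alpha> / Kavg) powr r y = \<alpha> powr r y / Kavg powr r y"
      by (rule powr_divide)
    also have "\<dots> \<le> (Cinf * \<alpha> powr l + ?h y) / Kavg"
    proof (rule frac_le)
      show "\<alpha> powr r y \<le> Cinf * \<alpha> powr l + ?h y"
        unfolding Cinf_def using \<alpha> nn_ge by (intro powr_swap) auto
      show "Kavg \<le> Kavg powr r y" using powr_mono[of 1 "r y" Kavg] Kavg_ge r_ge[of y] by simp
    qed (use Kavg_ge Cinf_ge decay_pos in \<open>auto intro!: add_nonneg_nonneg less_imp_le[OF decay_pos]\<close>)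
    also have "\<alpha> powr l = s powr (- nn)" using l_ge by (simp add: \<alpha>_def powr_powr)
    finally show ?thesis by (simp add: add_divide_distrib)
  qed
  have "modular r (\<lambda>y. indicator ?Q y / (Kavg * s powr (nn / l)))
    \<le> (\<integral>\<^sup>+ y. ennreal ((Cinf / Kavg) * s powr (- nn)) * indicator ?Q y + ennreal (1 / Kavg) * ennreal (?h y) \<partial>lebesgue)"
    unfolding modular_def
  proof (rule nn_integral_mono)
    fix y
    show "ennreal (\<bar>indicator ?Q y / (Kavg * s powr (nn / l))\<bar> powr r y)
      \<le> ennreal ((Cinf / Kavg) * s powr (- nn)) * indicator ?Q y + ennreal (1 / Kavg) * ennreal (?h y)"
    proof (cases "y \<in> ?Q")
      case True
      then have "ennreal (\<bar>indicator ?Q y / (Kavg * s powr (nn / l))\<bar> powr r y) = ennreal ((\<alpha> / Kavg) powr r y)"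
        using inv \<alpha> Kavg_ge by simp
      also have "\<dots> \<le> ennreal ((Cinf / Kavg) * s powr (- nn) + 1 / Kavg * ?h y)"
        by (rule ennreal_leI[OF pw])
      also have "\<dots> = ennreal ((Cinf / Kavg) * s powr (- nn)) + ennreal (1 / Kavg) * ennreal (?h y)"
        using Kavg_ge Cinf_ge decay_pos[of "nn + 1" y] by (subst ennreal_mult[symmetric]) auto
      finally show ?thesis using True by simp
    qed simp
  qed
  also have "\<dots> = ennreal ((Cinf / Kavg) * s powr (- nn)) * ennreal (s powr nn) + ennreal (1 / Kavg) * ennreal decay_mass"
  proof -
    have Q: "?Q \<in> sets lebesgue" by simp
    have m1: "(\<lambda>y. k * indicator ?Q y) \<in> borel_measurable lebesgue" for k :: ennreal
      using Q by measurable
    have m2: "(\<lambda>y. ennreal (?h y)) \<in> borel_measurable lebesgue" by measurable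
    have m3: "(\<lambda>y. k * ennreal (?h y)) \<in> borel_measurable lebesgue" for k :: ennreal
      using m2 by measurable
    show ?thesis
      unfolding nn_integral_add[OF m1 m3] nn_integral_cmult_indicator[OF Q] nn_integral_cmult[OF m2] decay_mass(1)
        emeasure_cube_powr[OF s0] by (simp only: nn_def)
  qed
  also have "\<dots> = ennreal ((Cinf / Kavg) * s powr (- nn) * s powr nn + 1 / Kavg * decay_mass)"
    using Kavg_ge Cinf_ge decay_mass by (subst (1 2) ennreal_mult[symmetric]) auto
  also have "\<dots> = ennreal ((Cinf + decay_mass) / Kavg)"
    using s0 by (simp add: powr_minus_divide add_divide_distrib)
  also have "\<dots> \<le> ennreal 1"
    using Kavg_ge decay_mass Cloc_ge by (intro ennreal_leI) (simp add: Kavg_def)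
  finally show ?thesis by simp
qed

section \<open>A substitute for Jensen's inequality with a variable exponent\<close>

text \<open>\<open>2 powr R\<close> pays for halving the average, one factor
  \<open>exp (m * D)\<close> for passing to the exponent \<open>l\<close> under the average and the
  other for returning to \<open>r x\<close>, and \<open>Cloc\<close> for the exchange on small
  cubes.\<close>

definition Kpw :: "real \<Rightarrow> real"
  where "Kpw m = 2 powr R * (exp (m * D) * exp (m * D) + Cloc)"

lemma Kpw_ge: "0 \<le> m \<Longrightarrow> 1 \<le> Kpw m" "0 \<le> m \<Longrightarrow> 2 powr R * (exp (m * D) * exp (m * D)) \<le> Kpw m"
  "0 \<le> m \<Longrightarrow> 2 powr R \<le> Kpw m" "2 powr R * Cloc \<le> Kpw m"
proof -
  have R: "1 \<le> (2 :: real) powr R" using r_ge[of 0] r_le[of 0] by (intro ge_one_powr_ge_zero) auto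
  show "2 powr R \<le> Kpw m" if "0 \<le> m"
    using mult_left_mono[of 1 "exp (m * D) * exp (m * D) + Cloc" "2 powr R"] Cloc_ge R
    by (simp add: Kpw_def add_increasing)
  then show "1 \<le> Kpw m" if "0 \<le> m" using R that by fastforce
  show "2 powr R * (exp (m * D) * exp (m * D)) \<le> Kpw m" "2 powr R * Cloc \<le> Kpw m"
    unfolding Kpw_def using Cloc_ge by (auto intro!: mult_left_mono)
qed

text \<open>The size of \<open>b = A / 2\<close> decides which regularity is at hand. Below
  \<open>decay m x\<close> the weight at \<open>x\<close> suffices. Between it and 1 all exponents
  are moved to \<open>l\<close> by the decay condition. For \<open>1 \<le> b\<close> the bound
  \<open>A_le\<close> yields \<open>b \<le> 1 / |Q|\<close>, so the cube is small and the local
  condition applies.\<close>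

lemma powr_avg_bound:
  assumes f [measurable]: "f \<in> borel_measurable lebesgue" and f0: "\<And>y. 0 \<le> f y"
    and x: "x \<in> cbox a (a + s *\<^sub>R One)" and s: "0 < s" and m: "0 \<le> m"
    and A: "avg (cbox a (a + s *\<^sub>R One)) (\<lambda>y. ennreal (f y)) = ennreal A" "0 \<le> A"
    and A_le: "A \<le> 1 + 1 / s powr nn"
  shows "ennreal (A powr r x)
    \<le> ennreal (Kpw m) * (avg (cbox a (a + s *\<^sub>R One)) (\<lambda>y. ennreal (f y powr r y + decay m y)) + ennreal (decay m x))"
proof -
  let ?Q = "cbox a (a + s *\<^sub>R (One :: real ^ 'n))"
  let ?X = "avg ?Q (\<lambda>y. ennreal (f y powr r y + decay m y))"
  define e where "e = exp (m * D)"
  have e: "1 \<le> e" using m D_nonneg by (simp add: e_def)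
  \<comment> \<open>the threshold is half the average, so that its own contribution can be absorbed\<close>
  define b where "b = A / 2"
  have AR: "A powr r x \<le> 2 powr R * b powr r x"
  proof -
    have "A powr r x = 2 powr r x * b powr r x" by (simp add: b_def powr_mult[symmetric])
    also have "\<dots> \<le> 2 powr R * b powr r x" using r_le[of x] by (intro mult_right_mono powr_mono) auto
    finally show ?thesis .
  qed
  have [measurable]: "(\<lambda>y. f y powr r y) \<in> borel_measurable lebesgue" by measurable
  \<comment> \<open>As \<open>b powr (k - 1) * A = 2 * b powr k\<close>, averaging the pointwise
    bound gives \<open>b powr k\<close> twice on the left and once on the right; being finite, it
    cancels.\<close>
  have absorb: "ennreal (b powr k) \<le> ennreal c * ?X"
    if b: "0 < b" and c: "1 \<le> c"
      and pw: "\<And>y. y \<in> ?Q \<Longrightarrow> b powr (k - 1) * f y \<le> b powr k + c * (f y powr r y + decay m y)" for k c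
  proof -
    have eq: "b powr (k - 1) * A = 2 * b powr k" using b by (simp add: b_def powr_diff)
    have "ennreal (2 * b powr k) = ennreal (b powr (k - 1)) * avg ?Q (\<lambda>y. ennreal (f y))"
      unfolding A(1) eq[symmetric] using A by (simp add: ennreal_mult)
    also have "\<dots> = avg ?Q (\<lambda>y. ennreal (b powr (k - 1) * f y))"
      using s by (subst avg_cmult[symmetric]) (auto simp: ennreal_mult f0 cubesI)
    also have "\<dots> \<le> ennreal (b powr k) + ennreal c * ?X"
      using c s by (intro avg_affine_le pw cubesI) (auto intro!: add_nonneg_nonneg less_imp_le[OF decay_pos])
    finally have "ennreal (b powr k) + ennreal (b powr k) \<le> ennreal (b powr k) + ennreal c * ?X"
      by (simp add: ennreal_plus[symmetric] del: ennreal_plus)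
    then show ?thesis by (simp add: ennreal_add_left_cancel_le)
  qed
  consider "b = 0" | "0 < b" "b < decay m x" | "decay m x \<le> b" "b < 1" | "1 \<le> b"
    using A by (fastforce simp: b_def)
  then show ?thesis
  proof cases
    case 1
    then show ?thesis using AR by simp
  next
    case 2
    have "b powr r x \<le> b" using 2 decay_le_1[OF m, of x] powr_mono'[of 1 "r x" b] r_ge[of x] by simp
    then have "2 powr R * b powr r x \<le> 2 powr R * decay m x" using 2 by (intro mult_left_mono) auto
    with AR have "A powr r x \<le> 2 powr R * decay m x" by linarith
    also have "\<dots> \<le> Kpw m * decay m x"
      using Kpw_ge(3)[OF m] decay_pos[of m x] by (intro mult_right_mono) auto
    finally have "ennreal (A powr r x) \<le> ennreal (Kpw m) * ennreal (decay m x)"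
      using Kpw_ge(1)[OF m] decay_pos[of m x] by (subst ennreal_mult[symmetric]) (auto intro: ennreal_leI)
    then show ?thesis by (auto simp: distrib_left intro: order_trans add_increasing)
  next
    case 3
    have b0: "0 < b" using 3 decay_pos[of m x] by linarith
    have pw: "b powr (l - 1) * f y \<le> b powr l + e * (f y powr r y + decay m y)" for y
    proof -
      have bl: "b powr (l - 1) \<le> 1" using b0 3 l_ge powr_mono'[of 0 "l - 1" b] by simp
      have d: "0 \<le> e * decay m y" "0 \<le> e * f y powr r y" using e decay_pos[of m y] by auto
      consider "f y \<le> b" | "b < f y" "f y < 1" | "1 \<le> f y" by linarith
      then show ?thesis
      proof cases
        case 1
        then have "b powr (l - 1) * f y \<le> b powr (l - 1) * b" by (intro mult_left_mono) auto
        also have "\<dots> = b powr l" using b0 by (simp add: powr_diff)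
        finally show ?thesis using d by (simp add: distrib_left)
      next
        case 2
        then have "b powr (l - 1) * f y \<le> f y powr (l - 1) * f y"
          using b0 l_ge by (intro mult_right_mono powr_mono2) auto
        also have "\<dots> = f y powr l" using 2 b0 by (simp add: powr_diff)
        also have "\<dots> \<le> e * f y powr r y + decay m y"
          unfolding e_def using 2 b0 m by (intro powr_swap) auto
        also have "decay m y \<le> e * decay m y" using e decay_pos[of m y] by simp
        finally show ?thesis using b0 by (simp add: distrib_left add_increasing)
      next
        case 3
        have "b powr (l - 1) * f y \<le> 1 * f y" using bl f0 by (intro mult_right_mono) auto
        also have "\<dots> \<le> f y powr r y" using 3 powr_mono[of 1 "r y" "f y"] r_ge[of y] by simp
        also have "\<dots> \<le> e * f y powr r y" using e mult_right_mono[of 1 e "f y powr r y"] by simp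
        finally show ?thesis using d by (simp add: distrib_left add_increasing)
      qed
    qed
    have "b powr (r x - l) \<le> exp (1 * m * D)"
      using 3 m by (intro powr_infinity[where x = x]) auto
    then have "b powr l * b powr (r x - l) \<le> b powr l * e" by (intro mult_left_mono) (auto simp: e_def)
    then have "b powr r x \<le> e * b powr l" using b0 by (simp add: powr_add[symmetric] mult.commute)
    then have "2 powr R * b powr r x \<le> 2 powr R * (e * b powr l)" by (intro mult_left_mono) auto
    from order_trans[OF AR this] have "A powr r x \<le> (2 powr R * e) * b powr l" by (simp only: mult.assoc)
    then have "ennreal (A powr r x) \<le> ennreal (2 powr R * e) * ennreal (b powr l)"
      using e by (subst ennreal_mult[symmetric]) (auto intro: ennreal_leI)
    also have "\<dots> \<le> ennreal (2 powr R * e) * (ennreal e * ?X)"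
      by (intro mult_left_mono absorb b0 e pw) auto
    also have "\<dots> = ennreal (2 powr R * (e * e)) * ?X"
      using e by (simp add: mult.assoc[symmetric] ennreal_mult)
    also have "\<dots> \<le> ennreal (Kpw m) * ?X"
      using Kpw_ge(2)[OF m] by (intro mult_right_mono ennreal_leI) (auto simp: e_def)
    also have "\<dots> \<le> ennreal (Kpw m) * (?X + ennreal (decay m x))" by (intro mult_left_mono) auto
    finally show ?thesis .
  next
    case 4
    \<comment> \<open>\<open>2 * b \<le> 1 + 1 / |Q|\<close> and \<open>1 \<le> b\<close>: the
      halving of the average removes the summand 1.\<close>
    have b: "b \<le> 1 / s powr nn" using A_le 4 by (simp add: b_def)
    have s1: "s \<le> 1"
    proof (rule ccontr)
      assume "\<not> s \<le> 1"
      then have "1 < s powr nn" using nn_ge by (intro gr_one_powr) auto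
      then have "1 / s powr nn < 1" by (simp add: divide_less_eq)
      then show False using b 4 by linarith
    qed
    have pw: "b powr (r x - 1) * f y \<le> b powr r x + Cloc * (f y powr r y + decay m y)" if y: "y \<in> ?Q" for y
    proof -
      have "b powr (r x - 1) * f y \<le> b powr (r x - 1) * (b + f y powr r y * b powr (1 - r y))"
        using 4 r_ge[of y] f0[of y] by (intro mult_left_mono young_threshold) auto
      also have "\<dots> = b powr r x + f y powr r y * b powr (r x - r y)"
        using 4 by (simp add: powr_diff distrib_left)
      also have "\<dots> \<le> b powr r x + f y powr r y * Cloc"
        using 4 b by (intro add_left_mono mult_left_mono powr_local[OF x y s s1]) (auto simp: powr_minus_divide)
      also have "\<dots> \<le> b powr r x + Cloc * (f y powr r y + decay m y)"
        using Cloc_ge decay_pos[of m y] by (simp add: distrib_left mult.commute)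
      finally show ?thesis .
    qed
    have "ennreal (A powr r x) \<le> ennreal (2 powr R) * ennreal (b powr r x)"
      using AR by (subst ennreal_mult[symmetric]) (auto intro: ennreal_leI)
    also have "\<dots> \<le> ennreal (2 powr R) * (ennreal Cloc * ?X)"
      using 4 Cloc_ge by (intro mult_left_mono absorb pw) auto
    also have "\<dots> = ennreal (2 powr R * Cloc) * ?X"
      using Cloc_ge by (simp add: mult.assoc[symmetric] ennreal_mult)
    also have "\<dots> \<le> ennreal (Kpw m) * ?X"
      using Kpw_ge(4) by (intro mult_right_mono ennreal_leI) auto
    also have "\<dots> \<le> ennreal (Kpw m) * (?X + ennreal (decay m x))" by (intro mult_left_mono) auto
    finally show ?thesis .
  qed
qed

end

section \<open>From the defined exponents to locale instances\<close>

text \<open>The bound in the decay condition tends to 0, so its constant \<open>l\<close> is the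
  limit of \<open>p\<close> and agrees with the value of \<open>Lim\<close>. As a limit of values of
  \<open>p\<close> it is also at least \<open>finf p\<close>.\<close>

lemma log_exponentE:
  fixes p :: "real ^ 'n \<Rightarrow> real"
  assumes "log_exponent p"
  obtains C D R where "log_hoelder p R C D (exponent_at_infinity p)" "1 < finf p"
    "\<And>x. finf p \<le> p x" "finf p \<le> exponent_at_infinity p" "(p \<longlongrightarrow> exponent_at_infinity p) at_infinity"
proof -
  from assms have v: "var_exponent p" by (simp add: log_exponent_def)
  from assms obtain C where C: "0 < C" "\<And>x y. \<bar>p x - p y\<bar> \<le> C / ln (exp 1 + 1 / norm (x - y))"
    by (auto simp: log_exponent_def)
  from assms obtain D l where D: "0 < D" "\<And>x. \<bar>p x - l\<bar> \<le> D / ln (exp 1 + norm x)"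
    by (auto simp: log_exponent_def)
  from v obtain R where R: "\<And>x. p x \<le> R" by (auto simp: var_exponent_def bdd_above_def)
  have low: "finf p \<le> p x" for x
    unfolding finf_def
    by (rule cINF_lower) (use v in \<open>auto simp: var_exponent_def bdd_below_def intro!: exI[of _ 1] less_imp_le\<close>)
  have "((\<lambda>x. p x - l) \<longlongrightarrow> 0) at_infinity"
  proof (rule Lim_null_comparison)
    show "\<forall>\<^sub>F x in at_infinity. norm (p x - l) \<le> D / ln (exp 1 + norm x)"
      using D by (auto intro!: always_eventually)
    have "filterlim (\<lambda>x :: real ^ 'n. exp 1 + norm x) at_top at_infinity"
      by (intro filterlim_tendsto_add_at_top[OF tendsto_const] filterlim_norm_at_top)
    then have "filterlim (\<lambda>x :: real ^ 'n. ln (exp 1 + norm x)) at_top at_infinity"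
      by (rule filterlim_compose[OF ln_at_top])
    then show "((\<lambda>x :: real ^ 'n. D / ln (exp 1 + norm x)) \<longlongrightarrow> 0) at_infinity"
      by (rule real_tendsto_divide_at_top[OF tendsto_const])
  qed
  then have lim: "(p \<longlongrightarrow> l) at_infinity" by (simp add: Lim_null[symmetric])
  then have l: "exponent_at_infinity p = l"
    unfolding exponent_at_infinity_def by (intro tendsto_Lim trivial_limit_at_infinity)
  have ll: "finf p \<le> l"
    by (rule tendsto_lowerbound[OF lim _ trivial_limit_at_infinity]) (auto simp: low)
  show ?thesis
  proof (rule that)
    show "log_hoelder p R C D (exponent_at_infinity p)"
      unfolding l by standard (use v C D R ll in \<open>auto simp: var_exponent_def less_imp_le\<close>)
  qed (use v low lim ll l in \<open>auto simp: var_exponent_def\<close>)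
qed

lemma log_hoelder_divide:
  assumes "log_hoelder r R C D l" "0 < c" "\<And>x. c \<le> r x" "c \<le> l"
  shows "log_hoelder (\<lambda>x. r x / c) (R / c) (C / c) (D / c) (l / c)"
proof -
  interpret log_hoelder r R C D l by fact
  have abs: "\<bar>u / c - v / c\<bar> = \<bar>u - v\<bar> / c" for u v
    using assms(2) by (simp add: diff_divide_distrib[symmetric])
  show ?thesis
  proof
    fix x y
    show "\<bar>r x / c - r y / c\<bar> \<le> C / c / ln (exp 1 + 1 / norm (x - y))"
      unfolding abs using divide_right_mono[OF local[of x y], of c] assms(2) by (simp add: mult.commute)
    show "\<bar>r x / c - l / c\<bar> \<le> D / c / ln (exp 1 + norm x)"
      unfolding abs using divide_right_mono[OF infinity[of x], of c] assms(2) by (simp add: mult.commute)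
  qed (use assms r_le C_nonneg D_nonneg in \<open>auto intro: divide_right_mono\<close>)
qed

section \<open>The fractional maximal estimate\<close>

lemma decay_antimono:
  assumes "k \<le> m"
  shows "decay m x \<le> decay k x"
  unfolding decay_def using base_ge_1[of x] assms by (intro powr_mono) auto

lemma powr_sum_le:
  fixes u v c :: real
  assumes "0 \<le> u" "0 \<le> v" "0 \<le> c"
  shows "(u + v) powr c \<le> 2 powr c * (u powr c + v powr c)"
proof -
  have "(u + v) powr c \<le> (2 * max u v) powr c" using assms by (intro powr_mono2) auto
  also have "\<dots> = 2 powr c * max u v powr c" using assms by (simp add: powr_mult)
  also have "max u v powr c \<le> u powr c + v powr c" by (simp add: max_def)
  finally show ?thesis by simp
qed

text \<open>\<open>\<theta>\<close> bounds \<open>1 - \<delta> x * l / n\<close> from below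
  uniformly in \<open>x\<close>. It is the exponent left over on large cubes in the worst case, and
  \<open>m\<close> is chosen so that \<open>decay m x powr \<theta>\<close> is the integrable
  \<open>decay (n + 1) x\<close>.\<close>

locale fractional = log_hoelder r R C D l for r :: "real ^ 'n \<Rightarrow> real" and R C D l +
  fixes c m \<theta> Rq :: real and q \<delta> :: "real ^ 'n \<Rightarrow> real"
  assumes c1: "1 < c" and c_le: "\<And>x. c \<le> r x" and c_le_l: "c \<le> l"
    and q: "\<And>x. 1 \<le> q x" "\<And>x. q x \<le> Rq"
    and \<delta>_pos: "\<And>x. 0 < \<delta> x"
    and \<delta>_eq: "\<And>x. \<delta> x / real CARD('n) = 1 / r x - 1 / q x"
    and \<theta>_pos: "0 < \<theta>" and \<theta>_le_1: "\<theta> \<le> 1"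
    and \<theta>_le: "\<And>x. \<theta> \<le> 1 - \<delta> x * l / real CARD('n)"
    and m_def: "m = (real CARD('n) + 1) / \<theta>"
begin

lemmas \<delta> = \<delta>_pos \<delta>_eq[folded nn_def]
lemmas \<theta> = \<theta>_pos \<theta>_le_1 \<theta>_le[folded nn_def]
lemmas m_eq = m_def[folded nn_def]

lemma m_bounds: "nn + 1 \<le> m" "0 \<le> m"
proof -
  have "(nn + 1) * \<theta> \<le> (nn + 1) * 1" using \<theta>_le_1 nn_ge by (intro mult_left_mono) auto
  then show "nn + 1 \<le> m" using \<theta>_pos by (simp add: m_eq pos_le_divide_eq)
  then show "0 \<le> m" using nn_ge by simp
qed

definition Kfrac :: real where "Kfrac = Kavg powr Rq * (exp (Rq * m * D) + 1)"

lemma Kfrac_ge: "1 \<le> Kfrac"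
proof -
  have "1 \<le> Kavg powr Rq" using Kavg_ge q(1)[of 0] q(2)[of 0] by (intro ge_one_powr_ge_zero) auto
  then have "1 * 1 \<le> Kavg powr Rq * (exp (Rq * m * D) + 1)" by (intro mult_mono) auto
  then show ?thesis by (simp add: Kfrac_def)
qed

text \<open>Hedberg's argument cube by cube: the a priori bound converts the side into a negative
  power of the average, so that \<open>s powr \<delta> x * A\<close> is at most a multiple of
  \<open>B powr (1 - \<kappa>)\<close>. On small cubes \<open>(1 - \<kappa>) * q x\<close> equals
  \<open>r x\<close> by the relation between \<open>\<delta>\<close>, \<open>r\<close> and
  \<open>q\<close>. On large ones it misses \<open>r x\<close>, and the decay condition or the
  weight has to make up for this.\<close>

lemma fractional_average_bound:
  assumes f: "f \<in> borel_measurable lebesgue" "\<And>y. 0 \<le> f y"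
    and mod: "(\<integral>\<^sup>+ y. ennreal (f y powr r y) \<partial>lebesgue) \<le> 1"
    and x: "x \<in> cbox a (a + s *\<^sub>R One)" and s: "0 < s"
    and A: "avg (cbox a (a + s *\<^sub>R One)) (\<lambda>y. ennreal (f y)) = ennreal A" "0 < A"
  shows "(s powr \<delta> x * A) powr q x \<le> Kfrac * (A powr r x + decay (nn + 1) x)"
proof -
  \<comment> \<open>\<open>l'\<close> is the exponent governing cubes of this size; \<open>B\<close>
    sheds the constant, so that \<open>B \<le> s powr (- nn / l')\<close> holds without a
    factor.\<close>
  define l' where "l' = (if s \<le> 1 then r x else l)"
  have l': "0 < l'" using r_ge[of x] l_ge by (auto simp: l'_def)
  define B where "B = A / Kavg"
  have B: "0 < B" "B \<le> A" "A = Kavg * B" using A Kavg_ge by (auto simp: B_def field_simps)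
  have "ennreal A \<le> ennreal (Kavg * s powr (- nn / l'))"
    using modular_avg_bound_small[OF f mod x s] modular_avg_bound_large[OF f mod, of s a] A
    by (auto simp: l'_def)
  then have "A \<le> Kavg * s powr (- nn / l')" using Kavg_ge by (subst (asm) ennreal_le_iff) auto
  then have Bs: "B \<le> s powr (- nn / l')" using Kavg_ge by (simp add: B_def field_simps)
  define \<kappa> where "\<kappa> = \<delta> x * l' / nn"
  have \<kappa>: "0 < \<kappa>" using \<delta>(1)[of x] l' nn_ge by (simp add: \<kappa>_def)
  have rx: "0 < r x" "0 < q x" using r_ge[of x] q(1)[of x] by auto
  have \<kappa>r: "\<delta> x * r x / nn = 1 - r x / q x"
  proof -
    have "\<delta> x * r x / nn = r x * (\<delta> x / nn)" by simp
    also have "\<dots> = 1 - r x / q x" unfolding \<delta>(2) using rx by (simp add: right_diff_distrib)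
    finally show ?thesis .
  qed
  have \<kappa>1: "\<kappa> < 1"
    using \<kappa>r rx \<theta>(1) \<theta>(3)[of x] by (auto simp: \<kappa>_def l'_def)
  have "(s powr (- nn / l')) powr (- \<kappa>) \<le> B powr (- \<kappa>)"
    using B Bs \<kappa> by (intro powr_mono2') auto
  moreover have "(s powr (- nn / l')) powr (- \<kappa>) = s powr \<delta> x"
    using l' nn_ge by (simp add: powr_powr \<kappa>_def)
  ultimately have "s powr \<delta> x * A \<le> B powr (- \<kappa>) * (Kavg * B)"
    using A B by (metis mult_right_mono less_imp_le)
  also have "\<dots> = Kavg * B powr (1 - \<kappa>)" using B by (simp add: powr_diff powr_minus_divide)
  finally have "(s powr \<delta> x * A) powr q x \<le> (Kavg * B powr (1 - \<kappa>)) powr q x"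
    using A rx by (intro powr_mono2) auto
  also have "\<dots> = Kavg powr q x * B powr ((1 - \<kappa>) * q x)"
    using Kavg_ge by (simp add: powr_mult powr_powr)
  also have "\<dots> \<le> Kavg powr Rq * B powr ((1 - \<kappa>) * q x)"
    using Kavg_ge q(2)[of x] by (intro mult_right_mono powr_mono) auto
  finally have 1: "(s powr \<delta> x * A) powr q x \<le> Kavg powr Rq * B powr ((1 - \<kappa>) * q x)" .
  have 2: "B powr ((1 - \<kappa>) * q x) \<le> (exp (Rq * m * D) + 1) * (A powr r x + decay (nn + 1) x)"
  proof -
    define E where "E = exp (Rq * m * D)"
    have E: "1 \<le> E" using m_bounds D_nonneg q(1)[of x] q(2)[of x] by (simp add: E_def)
    have Br: "B powr r x \<le> A powr r x" using B rx by (intro powr_mono2) auto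
    have nonneg: "0 \<le> A powr r x" "0 < decay (nn + 1) x" by (auto simp: decay_pos)
    have "B powr ((1 - \<kappa>) * q x) \<le> E * A powr r x + decay (nn + 1) x"
    proof (cases "s \<le> 1")
      case True
      then have "(1 - \<kappa>) * q x = r x" using \<kappa>r rx by (simp add: \<kappa>_def l'_def)
      then show ?thesis using Br E nonneg mult_right_mono[of 1 E "A powr r x"] by simp
    next
      case False
      then have ll: "l' = l" by (simp add: l'_def)
      have B1: "B \<le> 1"
      proof -
        have "s powr (- nn / l') \<le> s powr 0" using False l' nn_ge by (intro powr_mono) auto
        then show ?thesis using Bs False by simp
      qed
      show ?thesis
      proof (cases "decay m x \<le> B")
        case True
        \<comment> \<open>The mismatch \<open>e\<close> is \<open>q x * \<delta> x / nn\<close>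
          times \<open>r x - l\<close>, and the factor is at most \<open>Rq\<close>; hence
          \<open>powr_infinity\<close> applies with \<open>k = Rq\<close>.\<close>
        define e where "e = (1 - \<kappa>) * q x - r x"
        have "e = q x * (\<delta> x / nn) * (r x - l)"
        proof -
          have "r x = q x * (1 - \<delta> x * r x / nn)" unfolding \<kappa>r using rx by simp
          then have "e = (1 - \<kappa>) * q x - q x * (1 - \<delta> x * r x / nn)" unfolding e_def by metis
          then show ?thesis by (simp add: \<kappa>_def ll algebra_simps diff_divide_distrib)
        qed
        moreover have "q x * (\<delta> x / nn) \<le> Rq * 1"
        proof (rule mult_mono)
          show "\<delta> x / nn \<le> 1"
          proof -
            have "1 / r x \<le> 1" "0 \<le> 1 / q x" using rx r_ge[of x] by auto
            then show ?thesis unfolding \<delta>(2) by linarith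
          qed
        qed (use q[of x] rx \<delta>(1)[of x] nn_ge in auto)
        then have "q x * (\<delta> x / nn) * \<bar>r x - l\<bar> \<le> Rq * \<bar>r x - l\<bar>" by (intro mult_right_mono) auto
        moreover have "\<bar>q x * (\<delta> x / nn)\<bar> = q x * (\<delta> x / nn)"
          using rx \<delta>(1)[of x] nn_ge by (intro abs_of_nonneg) auto
        ultimately have "\<bar>e\<bar> \<le> Rq * \<bar>r x - l\<bar>" by (simp only: abs_mult)
        then have "B powr e \<le> E" unfolding E_def
          using True B1 m_bounds q(1)[of x] q(2)[of x] by (intro powr_infinity[where x = x]) auto
        then have "B powr r x * B powr e \<le> A powr r x * E" using Br by (intro mult_mono) auto
        then show ?thesis using nonneg by (simp add: e_def powr_add[symmetric] mult.commute)
      next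
        case False
        \<comment> \<open>Below the threshold the exact exponent is irrelevant: \<open>B\<close> is
          at most 1, so any exponent that is at least \<open>\<theta>\<close> gives the integrable
          weight.\<close>
        have "\<theta> \<le> (1 - \<kappa>) * q x"
        proof -
          have "\<theta> \<le> 1 - \<kappa>" using \<theta>(3)[of x] by (simp add: \<kappa>_def ll)
          also have "\<dots> \<le> (1 - \<kappa>) * q x" using \<kappa>1 q(1)[of x] by simp
          finally show ?thesis .
        qed
        then have "B powr ((1 - \<kappa>) * q x) \<le> B powr \<theta>" using B B1 by (intro powr_mono') auto
        also have "\<dots> \<le> decay m x powr \<theta>" using False B \<theta> by (intro powr_mono2) auto
        also have "\<dots> = decay (nn + 1) x" using \<theta> by (simp add: decay_powr m_eq)
        finally show ?thesis using E nonneg by (simp add: add_increasing)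
      qed
    qed
    also have "\<dots> \<le> (E + 1) * (A powr r x + decay (nn + 1) x)"
      using E nonneg by (simp add: algebra_simps)
    finally show ?thesis by (simp add: E_def)
  qed
  from mult_left_mono[OF 2, of "Kavg powr Rq"] 1 show ?thesis
    by (simp add: Kfrac_def mult.assoc)
qed

text \<open>One integrable \<open>W\<close> dominates all cubes through \<open>x\<close> at once,
  with \<open>K\<close> independent of \<open>f\<close>. Speaking of cubes instead of their supremum
  keeps all quantities real; \<open>A \<le> 1 + W x\<close> is recorded because it gives the
  finiteness of the maximal function.\<close>

lemma fractional_maximal_bound:
  obtains K where "1 \<le> K"
    "\<And>f. f \<in> borel_measurable lebesgue \<Longrightarrow> (\<And>y. 0 \<le> f y) \<Longrightarrow>
      (\<integral>\<^sup>+ y. ennreal (f y powr r y) \<partial>lebesgue) \<le> 1 \<Longrightarrow>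
      \<exists>W \<in> borel_measurable lebesgue. (\<forall>x. 0 \<le> W x) \<and>
        (\<integral>\<^sup>+ x. ennreal (W x) \<partial>lebesgue) \<le> ennreal K \<and>
        (AE x in lebesgue. \<forall>a s. 0 < s \<longrightarrow> x \<in> cbox a (a + s *\<^sub>R One) \<longrightarrow>
          (\<exists>A\<ge>0. avg (cbox a (a + s *\<^sub>R One)) (\<lambda>y. ennreal (f y)) = ennreal A \<and>
             A \<le> 1 + W x \<and> (s powr \<delta> x * A) powr q x \<le> W x))"
proof -
  interpret s: log_hoelder "\<lambda>x. r x / c" "R / c" "C / c" "D / c" "l / c"
    by (rule log_hoelder_divide) (unfold_locales, use c1 c_le c_le_l in auto)
  obtain KM where KM: "0 \<le> KM"
    "\<And>(g :: real ^ 'n \<Rightarrow> real) u. g \<in> borel_measurable lebesgue \<Longrightarrow> u \<in> borel_measurable lebesgue \<Longrightarrow>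
      (\<And>x. 0 \<le> g x) \<Longrightarrow> (\<And>x. 0 \<le> u x) \<Longrightarrow> (\<And>x. ennreal (u x) \<le> maxi (\<lambda>y. ennreal (g y)) x) \<Longrightarrow>
      (\<integral>\<^sup>+ x. ennreal (u x powr c) \<partial>lebesgue) \<le> ennreal KM * (\<integral>\<^sup>+ x. ennreal (g x powr c) \<partial>lebesgue)"
    by (rule maximal_strong_type[OF c1, where 'n = 'n]) blast
  define K1 where "K1 = s.Kpw m powr c * 2 powr c"
  have K1: "0 \<le> K1" by (simp add: K1_def)
  define K2 where "K2 = Kfrac * (K1 + 1)"
  have K2: "Kfrac * K1 + Kfrac = K2" "0 \<le> K2" "K1 \<le> K2" "K1 + 1 \<le> K2"
  proof -
    show "K1 + 1 \<le> K2" using Kfrac_ge K1 mult_right_mono[of 1 Kfrac "K1 + 1"] by (simp add: K2_def)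
    then show "0 \<le> K2" "K1 \<le> K2" using K1 by auto
  qed (simp add: K2_def algebra_simps)
  define G where "G = 2 powr c * (1 + decay_mass)"
  have G: "0 \<le> G" using decay_mass by (simp add: G_def)
  define K where "K = 1 + K2 * (KM * G + decay_mass)"
  show ?thesis
  proof (rule that)
    show "1 \<le> K" using K2 KM(1) G decay_mass by (simp add: K_def)
    fix f :: "real ^ 'n \<Rightarrow> real"
    assume f [measurable]: "f \<in> borel_measurable lebesgue" and f0: "\<And>y. 0 \<le> f y"
      and mod: "(\<integral>\<^sup>+ y. ennreal (f y powr r y) \<partial>lebesgue) \<le> 1"
    \<comment> \<open>The weight is added before the maximal operator is applied, since its average
      over the cube occurs in the substitute for Jensen's inequality at the exponent
      \<open>r / c\<close>.\<close>
    define g where "g y = f y powr (r y / c) + decay m y" for y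
    note [measurable] = powr_exponent_measurable[OF f] s.powr_exponent_measurable[OF f]
    have g [measurable]: "g \<in> borel_measurable lebesgue" unfolding g_def by measurable
    have g0: "0 \<le> g y" for y using decay_pos[of m y] by (simp add: g_def)
    let ?M = "maxi (\<lambda>y. ennreal (g y))"
    let ?h = "\<lambda>x. decay (nn + 1) x :: real"
    have dm: "decay m x powr c \<le> ?h x" for x
    proof -
      have "decay m x powr c \<le> decay m x powr 1"
        using c1 decay_le_1[OF m_bounds(2), of x] decay_pos[of m x] by (intro powr_mono') auto
      also have "\<dots> \<le> ?h x" using decay_antimono[OF m_bounds(1), of x] decay_pos[of m x] by simp
      finally show ?thesis .
    qed
    have gc: "(\<integral>\<^sup>+ x. ennreal (g x powr c) \<partial>lebesgue) \<le> ennreal G"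
    proof -
      have "ennreal (g x powr c) \<le> ennreal (2 powr c) * (ennreal (f x powr r x) + ennreal (?h x))" for x
      proof -
        have "g x powr c \<le> 2 powr c * ((f x powr (r x / c)) powr c + decay m x powr c)"
          unfolding g_def using c1 decay_pos[of m x] by (intro powr_sum_le) auto
        also have "\<dots> \<le> 2 powr c * (f x powr r x + ?h x)"
          using dm[of x] c1 by (intro mult_left_mono add_mono) (auto simp: powr_powr)
        finally have "ennreal (g x powr c) \<le> ennreal (2 powr c * (f x powr r x + ?h x))" by (rule ennreal_leI)
        also have "\<dots> = ennreal (2 powr c) * (ennreal (f x powr r x) + ennreal (?h x))"
          using decay_pos[of "nn + 1" x] by (subst ennreal_mult) auto
        finally show ?thesis .
      qed
      then have "(\<integral>\<^sup>+ x. ennreal (g x powr c) \<partial>lebesgue)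
        \<le> (\<integral>\<^sup>+ x. ennreal (2 powr c) * (ennreal (f x powr r x) + ennreal (?h x)) \<partial>lebesgue)"
        by (intro nn_integral_mono)
      also have "\<dots> = ennreal (2 powr c) * ((\<integral>\<^sup>+ x. ennreal (f x powr r x) \<partial>lebesgue) + ennreal decay_mass)"
        by (simp add: nn_integral_cmult nn_integral_add decay_mass(1))
      also have "\<dots> \<le> ennreal (2 powr c) * (1 + ennreal decay_mass)"
        using mod by (intro mult_left_mono add_right_mono) auto
      also have "\<dots> = ennreal G" using decay_mass(2) by (simp add: G_def ennreal_mult)
      finally show ?thesis .
    qed
    have fin: "AE x in lebesgue. ?M x < \<infinity>"
      by (rule maxi_finite_AE[OF g g0 c1]) (use gc in \<open>auto intro: order_le_less_trans\<close>)
    \<comment> \<open>A real minorant of the maximal function everywhere, as the strong type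
      inequality demands, and equal to it almost everywhere.\<close>
    define u where "u x = enn2real (?M x)" for x
    have u [measurable]: "u \<in> borel_measurable lebesgue" unfolding u_def by measurable
    have u0: "0 \<le> u x" for x by (simp add: u_def)
    have uM: "ennreal (u x) \<le> ?M x" for x
      by (cases "?M x") (auto simp: u_def)
    define W where "W x = K2 * (u x powr c + ?h x)" for x
    have W0: "0 \<le> W x" for x using K2 decay_pos[of "nn + 1" x] by (simp add: W_def)
    show "\<exists>W \<in> borel_measurable lebesgue. (\<forall>x. 0 \<le> W x) \<and>
        (\<integral>\<^sup>+ x. ennreal (W x) \<partial>lebesgue) \<le> ennreal K \<and>
        (AE x in lebesgue. \<forall>a s. 0 < s \<longrightarrow> x \<in> cbox a (a + s *\<^sub>R One) \<longrightarrow>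
          (\<exists>A\<ge>0. avg (cbox a (a + s *\<^sub>R One)) (\<lambda>y. ennreal (f y)) = ennreal A \<and>
             A \<le> 1 + W x \<and> (s powr \<delta> x * A) powr q x \<le> W x))"
    proof (intro bexI[of _ W] conjI allI W0)
      show "W \<in> borel_measurable lebesgue" unfolding W_def by measurable
      have "(\<integral>\<^sup>+ x. ennreal (W x) \<partial>lebesgue)
        = (\<integral>\<^sup>+ x. ennreal K2 * (ennreal (u x powr c) + ennreal (?h x)) \<partial>lebesgue)"
      proof (intro nn_integral_cong)
        fix x
        show "ennreal (W x) = ennreal K2 * (ennreal (u x powr c) + ennreal (?h x))"
          unfolding W_def using K2(2) decay_pos[of "nn + 1" x] by (subst ennreal_mult) auto
      qed
      also have "\<dots> = ennreal K2 * ((\<integral>\<^sup>+ x. ennreal (u x powr c) \<partial>lebesgue) + ennreal decay_mass)"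
        by (simp add: nn_integral_cmult nn_integral_add decay_mass(1))
      also have "\<dots> \<le> ennreal K2 * (ennreal KM * ennreal G + ennreal decay_mass)"
      proof (intro mult_left_mono add_right_mono)
        have "(\<integral>\<^sup>+ x. ennreal (u x powr c) \<partial>lebesgue) \<le> ennreal KM * (\<integral>\<^sup>+ x. ennreal (g x powr c) \<partial>lebesgue)"
          by (rule KM(2)[OF g u g0 u0 uM])
        also have "\<dots> \<le> ennreal KM * ennreal G" using gc by (intro mult_left_mono) auto
        finally show "(\<integral>\<^sup>+ x. ennreal (u x powr c) \<partial>lebesgue) \<le> ennreal KM * ennreal G" .
      qed auto
      also have "\<dots> = ennreal (K2 * (KM * G + decay_mass))"
        using K2 KM(1) G decay_mass(2) by (simp add: ennreal_mult)
      also have "\<dots> \<le> ennreal K" by (intro ennreal_leI) (simp add: K_def)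
      finally show "(\<integral>\<^sup>+ x. ennreal (W x) \<partial>lebesgue) \<le> ennreal K" .
      from fin show "AE x in lebesgue. \<forall>a s. 0 < s \<longrightarrow> x \<in> cbox a (a + s *\<^sub>R One) \<longrightarrow>
          (\<exists>A\<ge>0. avg (cbox a (a + s *\<^sub>R One)) (\<lambda>y. ennreal (f y)) = ennreal A \<and>
             A \<le> 1 + W x \<and> (s powr \<delta> x * A) powr q x \<le> W x)"
      proof eventually_elim
        case (elim x)
        then have Mx: "?M x = ennreal (u x)" by (simp add: u_def less_top)
        show ?case
        proof (intro allI impI)
          fix a s assume s: "0 < s" and x: "x \<in> cbox a (a + s *\<^sub>R (One :: real ^ 'n))"
          let ?Q = "cbox a (a + s *\<^sub>R (One :: real ^ 'n))"
          have Q: "?Q \<in> cubes" using s by (rule cubesI)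
          \<comment> \<open>The crude bound \<open>f \<le> 1 + f powr r\<close> shows that
            \<open>A\<close> is finite and provides exactly the size restriction \<open>A_le\<close>
            of \<open>powr_avg_bound\<close>.\<close>
          have "avg ?Q (\<lambda>y. ennreal (f y)) \<le> ennreal 1 + ennreal 1 * avg ?Q (\<lambda>y. ennreal (f y powr r y))"
          proof (rule avg_affine_le)
            fix y
            show "f y \<le> 1 + 1 * f y powr r y"
              using young_threshold[OF f0[of y], of 1 "r y"] r_ge[of y] by simp
          qed (use Q in auto)
          also have "\<dots> \<le> ennreal 1 + ennreal 1 * ennreal (1 / s powr nn)"
            unfolding nn_def using mod s by (intro add_left_mono mult_left_mono avg_le_integral) auto
          also have "\<dots> = ennreal (1 + 1 / s powr nn)" by simp
          finally have le: "avg ?Q (\<lambda>y. ennreal (f y)) \<le> ennreal (1 + 1 / s powr nn)" .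
          then obtain A where A: "0 \<le> A" "avg ?Q (\<lambda>y. ennreal (f y)) = ennreal A"
            by (cases "avg ?Q (\<lambda>y. ennreal (f y))") (auto simp: top_unique)
          have A_le: "A \<le> 1 + 1 / s powr nn"
            using le unfolding A(2) by (subst (asm) ennreal_le_iff) auto
          have nn_eq: "s.nn = nn" by (simp add: nn_def s.nn_def)
          have "ennreal (A powr (r x / c)) \<le> ennreal (s.Kpw m) * (avg ?Q (\<lambda>y. ennreal (g y)) + ennreal (decay m x))"
            unfolding g_def
            by (rule s.powr_avg_bound) (use f f0 x s m_bounds A A_le nn_eq in auto)
          also have "\<dots> \<le> ennreal (s.Kpw m) * (ennreal (u x) + ennreal (decay m x))"
            using avg_le_maxi[OF Q x, of "\<lambda>y. ennreal (g y)"] unfolding Mx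
            by (intro mult_left_mono add_right_mono) auto
          also have "\<dots> = ennreal (s.Kpw m * (u x + decay m x))"
            using u0[of x] decay_pos[of m x] s.Kpw_ge(1)[OF m_bounds(2)] by (subst ennreal_mult) auto
          finally have "A powr (r x / c) \<le> s.Kpw m * (u x + decay m x)"
            using u0[of x] decay_pos[of m x] s.Kpw_ge(1)[OF m_bounds(2)] by (subst (asm) ennreal_le_iff) auto
          then have "(A powr (r x / c)) powr c \<le> (s.Kpw m * (u x + decay m x)) powr c"
            using c1 by (intro powr_mono2) auto
          also have "\<dots> = s.Kpw m powr c * (u x + decay m x) powr c"
            using u0[of x] decay_pos[of m x] s.Kpw_ge(1)[OF m_bounds(2)] by (simp add: powr_mult)
          also have "\<dots> \<le> s.Kpw m powr c * (2 powr c * (u x powr c + decay m x powr c))"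
            using u0[of x] decay_pos[of m x] c1 by (intro mult_left_mono powr_sum_le) auto
          also have "\<dots> \<le> s.Kpw m powr c * (2 powr c * (u x powr c + ?h x))"
            using dm[of x] by (intro mult_left_mono add_left_mono) auto
          finally have Ar: "A powr r x \<le> K1 * (u x powr c + ?h x)"
            using c1 by (simp add: powr_powr K1_def mult.assoc)
          have nonneg: "0 \<le> u x powr c + ?h x" using decay_pos[of "nn + 1" x] by simp
          have "A powr r x \<le> W x"
            using Ar mult_right_mono[OF K2(3) nonneg] by (simp add: W_def)
          moreover have "A \<le> 1 + A powr r x" using young_threshold[OF A(1), of 1 "r x"] r_ge[of x] by simp
          ultimately have "A \<le> 1 + W x" by linarith
          moreover have "(s powr \<delta> x * A) powr q x \<le> W x"
          proof (cases "A = 0")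
            case True
            then show ?thesis using W0 by simp
          next
            case False
            with A have "0 < A" by simp
            have "(s powr \<delta> x * A) powr q x \<le> Kfrac * (A powr r x + ?h x)"
              by (rule fractional_average_bound[OF f f0 mod x s A(2) \<open>0 < A\<close>])
            also have "\<dots> \<le> Kfrac * (K1 * (u x powr c + ?h x) + (u x powr c + ?h x))"
              using Ar Kfrac_ge by (intro mult_left_mono add_mono) auto
            also have "\<dots> = W x" unfolding W_def K2(1)[symmetric] by (simp add: algebra_simps)
            finally show ?thesis .
          qed
          ultimately show "\<exists>A\<ge>0. avg ?Q (\<lambda>y. ennreal (f y)) = ennreal A \<and>
             A \<le> 1 + W x \<and> (s powr \<delta> x * A) powr q x \<le> W x" using A by blast
        qed
      qed
    qed
  qed
qed

end

section \<open>Boundedness of the commutator\<close>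

text \<open>Since \<open>K powr p x \<ge> K\<close>, dividing a function by \<open>K\<close> divides
  its modular at least by \<open>K\<close>. A modular bounded by \<open>K\<close> thus becomes a
  norm bounded by \<open>K\<close>.\<close>

lemma modular_scale:
  assumes p [measurable]: "p \<in> borel_measurable lebesgue" and p1: "\<And>x. 1 \<le> p x"
    and f [measurable]: "f \<in> borel_measurable lebesgue" and K: "1 \<le> K"
  shows "modular p (\<lambda>x. f x / (K * t)) \<le> ennreal (1 / K) * modular p (\<lambda>x. f x / t)"
proof -
  have "modular p (\<lambda>x. f x / (K * t)) \<le> (\<integral>\<^sup>+ x. ennreal (1 / K) * ennreal (\<bar>f x / t\<bar> powr p x) \<partial>lebesgue)"
    unfolding modular_def
  proof (rule nn_integral_mono)
    fix x
    have "\<bar>f x / (K * t)\<bar> powr p x = \<bar>f x / t\<bar> powr p x / K powr p x"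
      using K by (simp add: powr_divide[symmetric] abs_mult mult.commute)
    also have "\<dots> \<le> \<bar>f x / t\<bar> powr p x / K"
      using K p1[of x] powr_mono[of 1 "p x" K] by (intro divide_left_mono) auto
    finally have "ennreal (\<bar>f x / (K * t)\<bar> powr p x) \<le> ennreal (1 / K * \<bar>f x / t\<bar> powr p x)"
      by (intro ennreal_leI) simp
    also have "\<dots> = ennreal (1 / K) * ennreal (\<bar>f x / t\<bar> powr p x)"
      using K by (intro ennreal_mult) auto
    finally show "ennreal (\<bar>f x / (K * t)\<bar> powr p x) \<le> ennreal (1 / K) * ennreal (\<bar>f x / t\<bar> powr p x)" .
  qed
  also have "\<dots> = ennreal (1 / K) * modular p (\<lambda>x. f x / t)"
    unfolding modular_def by (rule nn_integral_cmult) measurable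
  finally show ?thesis .
qed

lemma var_Lp_norm_le: "0 < t \<Longrightarrow> modular p (\<lambda>x. f x / t) \<le> 1 \<Longrightarrow> var_Lp_norm p f \<le> t"
  unfolding var_Lp_norm_def by (rule cInf_lower) (auto intro: bdd_belowI[of _ 0])

lemma var_Lp_norm_set_nonempty:
  assumes p: "p \<in> borel_measurable lebesgue" "\<And>x. 1 \<le> p x" and f: "f \<in> var_Lp p"
  shows "{t. 0 < t \<and> modular p (\<lambda>x. f x / t) \<le> 1} \<noteq> {}"
proof -
  from f have fm: "f \<in> borel_measurable lebesgue" by (simp add: var_Lp_def)
  from f obtain t where t: "0 < t" "modular p (\<lambda>x. f x / t) < \<infinity>" by (auto simp: var_Lp_def)
  then obtain M where M: "0 \<le> M" "modular p (\<lambda>x. f x / t) = ennreal M"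
    by (cases "modular p (\<lambda>x. f x / t)") auto
  define K where "K = 1 + M"
  have "modular p (\<lambda>x. f x / (K * t)) \<le> ennreal (1 / K) * ennreal M"
    using modular_scale[OF p fm, of K t] M by (simp add: K_def)
  also have "\<dots> = ennreal (M / K)" using M by (subst ennreal_mult[symmetric]) (auto simp: K_def)
  also have "\<dots> \<le> ennreal 1" using M by (intro ennreal_leI) (auto simp: K_def)
  finally have "modular p (\<lambda>x. f x / (K * t)) \<le> 1" by simp
  moreover have "0 < K * t" using M t by (simp add: K_def add_pos_nonneg)
  ultimately show ?thesis by blast
qed

text \<open>With a divisor strictly above the infimum, the question whether the infimum is attained
  does not arise: a smaller admissible divisor exists, and the modular decreases in the
  divisor.\<close>

lemma var_Lp_norm_less_modular:
  assumes p: "p \<in> borel_measurable lebesgue" "\<And>x. 1 \<le> p x" and f: "f \<in> var_Lp p"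
    and t: "var_Lp_norm p f < t"
  shows "modular p (\<lambda>x. f x / t) \<le> 1"
proof -
  from cInf_lessD[OF var_Lp_norm_set_nonempty[OF p f] t[unfolded var_Lp_norm_def]]
  obtain u where u: "0 < u" "modular p (\<lambda>x. f x / u) \<le> 1" "u < t" by auto
  have "modular p (\<lambda>x. f x / t) \<le> modular p (\<lambda>x. f x / u)"
    unfolding modular_def
  proof (intro nn_integral_mono ennreal_leI powr_mono2)
    fix x
    show "\<bar>f x / t\<bar> \<le> \<bar>f x / u\<bar>" using u by (simp add: frac_le)
    show "0 \<le> p x" using p(2)[of x] by simp
  qed simp
  with u show ?thesis by simp
qed

lemma avg_cong_AE:
  assumes "AE y in lebesgue. f y = g y"
  shows "avg Q f = avg Q g"
proof -
  have "(\<integral>\<^sup>+ y \<in> Q. f y \<partial>lebesgue) = (\<integral>\<^sup>+ y \<in> Q. g y \<partial>lebesgue)"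
    by (rule nn_integral_cong_AE) (use assms in eventually_elim, simp)
  then show ?thesis by (simp add: avg_def)
qed

context fractional
begin

text \<open>On a cube through \<open>x\<close>, replacing \<open>b' y\<close> by \<open>b' x\<close>
  under the average changes it by at most \<open>L * s powr \<delta> x\<close> times the average of
  \<open>\<bar>f\<bar>\<close>, hence by at most \<open>L * t * w\<close>. This error does not
  depend on the cube, so it survives the supremum in both directions. Nonnegativity of
  \<open>b'\<close> identifies \<open>\<bar>b' y * f y\<bar>\<close> with
  \<open>b' y * \<bar>f y\<bar>\<close> and lets \<open>b' x\<close> pass through the
  supremum.\<close>

lemma commutator_modular_bound:
  assumes b [measurable]: "b \<in> borel_measurable lebesgue" and eq: "AE x in lebesgue. b' x = b x"
    and b'0: "\<And>x. 0 \<le> b' x" and L: "1 \<le> L"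
    and lip: "\<And>a s x y. 0 < s \<Longrightarrow> x \<in> cbox a (a + s *\<^sub>R One) \<Longrightarrow> y \<in> cbox a (a + s *\<^sub>R One) \<Longrightarrow>
      \<bar>b' x - b' y\<bar> \<le> L * s powr \<delta> x"
    and f [measurable]: "f \<in> borel_measurable lebesgue" and t: "0 < t"
    and W: "\<And>x. 0 \<le> W x"
    and est: "AE x in lebesgue. \<forall>a s. 0 < s \<longrightarrow> x \<in> cbox a (a + s *\<^sub>R One) \<longrightarrow>
          (\<exists>A\<ge>0. avg (cbox a (a + s *\<^sub>R One)) (\<lambda>y. ennreal (\<bar>f y\<bar> / t)) = ennreal A \<and>
             A \<le> 1 + W x \<and> (s powr \<delta> x * A) powr q x \<le> W x)"
  shows "AE x in lebesgue. commutator_defined b f x \<and>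
    \<bar>maximal_commutator b f x / (L * t)\<bar> powr q x \<le> W x"
proof -
  have b'm [measurable]: "b' \<in> borel_measurable lebesgue"
  proof (rule borel_measurable_AE[OF b])
    show "AE x in lebesgue. b x = b' x" using eq by eventually_elim simp
  qed
  \<comment> \<open>Averages ignore null sets, so here \<open>b\<close> is replaced by
    \<open>b'\<close> at every point; only the factor in front of the first maximal function needs
    the exceptional set.\<close>
  have max_eq: "maximal (\<lambda>y. b y * f y) = maxi (\<lambda>y. ennreal \<bar>b' y * f y\<bar>)"
    unfolding maximal_eq_maxi maxi_def fun_eq_iff
  proof (intro allI SUP_cong refl avg_cong_AE)
    show "AE y in lebesgue. ennreal \<bar>b y * f y\<bar> = ennreal \<bar>b' y * f y\<bar>"
      using eq by eventually_elim simp
  qed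
  from eq est show ?thesis
  proof eventually_elim
    case (elim x)
    define w where "w = W x powr (1 / q x)"
    have qx: "0 < q x" using q(1)[of x] by simp
    have w: "0 \<le> w" "w powr q x = W x" using qx W[of x] by (auto simp: w_def powr_powr)
    let ?F = "\<lambda>y. ennreal \<bar>f y\<bar>" and ?B = "\<lambda>y. ennreal \<bar>b' y * f y\<bar>"
    \<comment> \<open>The two one-sided comparisons are stated additively, since differences in
      \<open>ennreal\<close> would be truncated.\<close>
    have cube: "\<exists>A\<ge>0. avg Q ?F = ennreal (t * A) \<and> A \<le> 1 + W x \<and>
        avg Q ?B \<le> ennreal (b' x * (t * A) + L * t * w) \<and>
        ennreal (b' x * (t * A)) \<le> avg Q ?B + ennreal (L * t * w)"
      if Q: "Q \<in> cubes" "x \<in> Q" for Q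
    proof -
      from Q(1) obtain a s where s: "0 < s" and Qeq: "Q = cbox a (a + s *\<^sub>R One)" by (auto elim: cubesE)
      with elim Q obtain A where A: "0 \<le> A" "avg Q (\<lambda>y. ennreal (\<bar>f y\<bar> / t)) = ennreal A"
        "A \<le> 1 + W x" "(s powr \<delta> x * A) powr q x \<le> W x" by auto
      have "((s powr \<delta> x * A) powr q x) powr (1 / q x) \<le> w"
        unfolding w_def using A(4) qx by (intro powr_mono2) auto
      then have Aw: "s powr \<delta> x * A \<le> w" using qx A(1) by (simp add: powr_powr)
      have F: "avg Q ?F = ennreal (t * A)"
      proof -
        have "avg Q ?F = avg Q (\<lambda>y. ennreal t * ennreal (\<bar>f y\<bar> / t))"
          using t by (intro arg_cong[where f = "avg Q"] ext) (simp add: ennreal_mult[symmetric])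
        also have "\<dots> = ennreal (t * A)"
          using Q t A by (subst avg_cmult) (auto simp: ennreal_mult)
        finally show ?thesis .
      qed
      define k where "k = L * s powr \<delta> x"
      have k: "0 \<le> k" using L by (simp add: k_def)
      have kA: "k * (t * A) \<le> L * t * w"
      proof -
        have "k * (t * A) = L * t * (s powr \<delta> x * A)" by (simp add: k_def)
        also have "\<dots> \<le> L * t * w" using L t Aw by (intro mult_left_mono) auto
        finally show ?thesis .
      qed
      have lipQ: "\<bar>b' x - b' y\<bar> \<le> k" if "y \<in> Q" for y
        unfolding k_def using that Q s unfolding Qeq by (intro lip) auto
      have 1: "avg Q ?B \<le> ennreal (b' x * (t * A) + L * t * w)"
      proof -
        have "avg Q ?B \<le> avg Q (\<lambda>y. ennreal (b' x + k) * ?F y)"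
        proof (rule avg_mono)
          fix y assume "y \<in> Q"
          then have "b' y \<le> b' x + k" using lipQ by fastforce
          then have "\<bar>b' y * f y\<bar> \<le> (b' x + k) * \<bar>f y\<bar>"
            using b'0[of y] by (simp add: abs_mult mult_right_mono)
          then show "?B y \<le> ennreal (b' x + k) * ?F y"
            using b'0[of x] k by (subst ennreal_mult[symmetric]) (auto intro: ennreal_leI)
        qed
        also have "\<dots> = ennreal ((b' x + k) * (t * A))"
          using Q b'0[of x] k t A by (subst avg_cmult) (auto simp: F ennreal_mult)
        also have "\<dots> \<le> ennreal (b' x * (t * A) + L * t * w)"
          using kA by (intro ennreal_leI) (simp add: distrib_right)
        finally show ?thesis .
      qed
      have 2: "ennreal (b' x * (t * A)) \<le> avg Q ?B + ennreal (L * t * w)"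
      proof -
        have "ennreal (b' x * (t * A)) = avg Q (\<lambda>y. ennreal (b' x) * ?F y)"
          using Q b'0[of x] t A by (subst avg_cmult) (auto simp: F ennreal_mult)
        also have "\<dots> \<le> avg Q (\<lambda>y. ?B y + ennreal k * ?F y)"
        proof (rule avg_mono)
          fix y assume "y \<in> Q"
          then have "b' x \<le> b' y + k" using lipQ by fastforce
          then have "b' x * \<bar>f y\<bar> \<le> \<bar>b' y * f y\<bar> + k * \<bar>f y\<bar>"
            using b'0[of y] mult_right_mono[of "b' x" "b' y + k" "\<bar>f y\<bar>"] by (simp add: abs_mult distrib_right)
          then have "ennreal (b' x * \<bar>f y\<bar>) \<le> ennreal (\<bar>b' y * f y\<bar> + k * \<bar>f y\<bar>)" by (rule ennreal_leI)
          then show "ennreal (b' x) * ?F y \<le> ?B y + ennreal k * ?F y"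
            using b'0[of x] k by (simp add: ennreal_mult)
        qed
        also have "\<dots> = avg Q ?B + ennreal (k * (t * A))"
          using Q k t A by (subst avg_add) (auto simp: avg_cmult F ennreal_mult)
        also have "\<dots> \<le> avg Q ?B + ennreal (L * t * w)" using kA by (intro add_left_mono ennreal_leI)
        finally show ?thesis .
      qed
      show ?thesis using A F 1 2 by blast
    qed
    have "maxi ?F x \<le> ennreal (t * (1 + W x))"
      unfolding maxi_def
    proof (rule SUP_least)
      fix Q assume "Q \<in> {Q \<in> cubes. x \<in> Q}"
      with cube obtain A where "0 \<le> A" "avg Q ?F = ennreal (t * A)" "A \<le> 1 + W x" by blast
      then show "avg Q ?F \<le> ennreal (t * (1 + W x))" using t by (simp add: ennreal_leI)
    qed
    then obtain \<Phi> where \<Phi>: "0 \<le> \<Phi>" "maxi ?F x = ennreal \<Phi>"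
      by (cases "maxi ?F x") (auto simp: top_unique)
    have "maxi ?B x \<le> ennreal (b' x * \<Phi> + L * t * w)"
      unfolding maxi_def[of ?B]
    proof (rule SUP_least)
      fix Q assume "Q \<in> {Q \<in> cubes. x \<in> Q}"
      then have Q: "Q \<in> cubes" "x \<in> Q" by auto
      with cube obtain A where A: "0 \<le> A" "avg Q ?F = ennreal (t * A)"
        "avg Q ?B \<le> ennreal (b' x * (t * A) + L * t * w)" by blast
      have "t * A \<le> \<Phi>"
        using avg_le_maxi[OF Q, of ?F] \<Phi> unfolding A(2) by (simp add: ennreal_le_iff)
      then have "b' x * (t * A) \<le> b' x * \<Phi>" using b'0 by (intro mult_left_mono) auto
      then have "ennreal (b' x * (t * A) + L * t * w) \<le> ennreal (b' x * \<Phi> + L * t * w)"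
        by (intro ennreal_leI) auto
      with A(3) show "avg Q ?B \<le> ennreal (b' x * \<Phi> + L * t * w)" by (rule order_trans)
    qed
    moreover from this obtain \<Psi> where \<Psi>: "0 \<le> \<Psi>" "maxi ?B x = ennreal \<Psi>"
      by (cases "maxi ?B x") (auto simp: top_unique)
    moreover have Lw: "0 \<le> L * t * w" using L t w by simp
    ultimately have up: "\<Psi> \<le> b' x * \<Phi> + L * t * w"
      using b'0[of x] \<Phi> by (metis add_nonneg_nonneg ennreal_le_iff mult_nonneg_nonneg)
    have "ennreal (b' x) * maxi ?F x \<le> ennreal (\<Psi> + L * t * w)"
      unfolding maxi_def[of ?F] SUP_mult_left_ennreal
    proof (rule SUP_least)
      fix Q assume "Q \<in> {Q \<in> cubes. x \<in> Q}"
      then have Q: "Q \<in> cubes" "x \<in> Q" by auto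
      with cube obtain A where A: "0 \<le> A" "avg Q ?F = ennreal (t * A)"
        "ennreal (b' x * (t * A)) \<le> avg Q ?B + ennreal (L * t * w)" by blast
      have "ennreal (b' x) * avg Q ?F = ennreal (b' x * (t * A))"
        unfolding A(2) using b'0[of x] A(1) t by (simp add: ennreal_mult)
      also have "\<dots> \<le> ennreal \<Psi> + ennreal (L * t * w)"
        using A(3) avg_le_maxi[OF Q, of ?B] unfolding \<Psi>(2) by (meson add_right_mono order_trans)
      finally show "ennreal (b' x) * avg Q ?F \<le> ennreal (\<Psi> + L * t * w)" using \<Psi> Lw by simp
    qed
    then have "ennreal (b' x * \<Phi>) \<le> ennreal (\<Psi> + L * t * w)"
      using b'0[of x] \<Phi> by (simp add: ennreal_mult)
    then have low: "b' x * \<Phi> \<le> \<Psi> + L * t * w" using \<Psi> Lw by (subst (asm) ennreal_le_iff) auto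
    have def: "commutator_defined b f x"
      unfolding commutator_defined_def max_eq using \<Phi> \<Psi> by (simp add: maximal_eq_maxi)
    have "maximal_commutator b f x = b' x * \<Phi> - \<Psi>"
      unfolding maximal_commutator_def max_eq using \<Phi> \<Psi> elim(1) by (simp add: maximal_eq_maxi)
    then have "\<bar>maximal_commutator b f x\<bar> \<le> L * t * w" using up low by (simp add: abs_le_iff)
    then have "\<bar>maximal_commutator b f x / (L * t)\<bar> \<le> w"
      using L t by (simp add: abs_mult field_simps)
    then have "\<bar>maximal_commutator b f x / (L * t)\<bar> powr q x \<le> w powr q x"
      using qx by (intro powr_mono2) auto
    with def w show ?case by simp
  qed
qed

lemma commutator_bounded:
  assumes b [measurable]: "b \<in> borel_measurable lebesgue" and eq: "AE x in lebesgue. b' x = b x"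
    and b'0: "\<And>x. 0 \<le> b' x" and lip: "b' \<in> var_Lipschitz \<delta>"
    and qm [measurable]: "q \<in> borel_measurable lebesgue" and \<delta>n: "\<And>x. \<delta> x \<le> nn"
  shows "var_Lp_bounded_operator r q (commutator_defined b) (maximal_commutator b)"
proof -
  from lip obtain C0 where C0: "\<And>x y. \<bar>b' x - b' y\<bar> \<le> C0 * norm (x - y) powr \<delta> x"
    by (auto simp: var_Lipschitz_def)
  \<comment> \<open>Two points of the cube are at distance at most \<open>nn * s\<close>, and
    \<open>\<delta> x \<le> nn\<close> turns \<open>nn powr \<delta> x\<close> into the constant
    \<open>nn powr nn\<close>.\<close>
  define L where "L = max C0 1 * nn powr nn"
  have "1 \<le> nn powr nn" using nn_ge by (intro ge_one_powr_ge_zero) auto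
  then have L: "1 \<le> L" unfolding L_def using mult_mono[of 1 "max C0 1" 1 "nn powr nn"] by simp
  have lipL: "\<bar>b' x - b' y\<bar> \<le> L * s powr \<delta> x"
    if "0 < s" "x \<in> cbox a (a + s *\<^sub>R One)" "y \<in> cbox a (a + s *\<^sub>R One)" for a s x y
  proof -
    have "\<bar>b' x - b' y\<bar> \<le> max C0 1 * norm (x - y) powr \<delta> x"
      using C0[of x y] by (meson max.cobounded1 mult_right_mono order_trans powr_ge_zero)
    also have "\<dots> \<le> max C0 1 * (nn * s) powr \<delta> x"
      using norm_diff_cube[OF that(2,3)] \<delta>_pos[of x]
      by (intro mult_left_mono powr_mono2) (auto simp: nn_def)
    also have "(nn * s) powr \<delta> x = nn powr \<delta> x * s powr \<delta> x"
      using nn_ge that by (simp add: powr_mult)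
    also have "max C0 1 * \<dots> \<le> max C0 1 * (nn powr nn * s powr \<delta> x)"
      using \<delta>n[of x] nn_ge by (intro mult_left_mono mult_right_mono powr_mono) auto
    finally show ?thesis by (simp add: L_def mult.assoc)
  qed
  obtain K where K: "1 \<le> K"
    "\<And>f. f \<in> borel_measurable lebesgue \<Longrightarrow> (\<And>y. 0 \<le> f y) \<Longrightarrow>
      (\<integral>\<^sup>+ y. ennreal (f y powr r y) \<partial>lebesgue) \<le> 1 \<Longrightarrow>
      \<exists>W \<in> borel_measurable lebesgue. (\<forall>x. 0 \<le> W x) \<and>
        (\<integral>\<^sup>+ x. ennreal (W x) \<partial>lebesgue) \<le> ennreal K \<and>
        (AE x in lebesgue. \<forall>a s. 0 < s \<longrightarrow> x \<in> cbox a (a + s *\<^sub>R One) \<longrightarrow>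
          (\<exists>A\<ge>0. avg (cbox a (a + s *\<^sub>R One)) (\<lambda>y. ennreal (f y)) = ennreal A \<and>
             A \<le> 1 + W x \<and> (s powr \<delta> x * A) powr q x \<le> W x))"
    by (rule fractional_maximal_bound) blast
  show ?thesis
    unfolding var_Lp_bounded_operator_def
  proof (intro exI[of _ "L * K"] ballI)
    fix f assume f: "f \<in> var_Lp r"
    then have fm [measurable]: "f \<in> borel_measurable lebesgue" by (simp add: var_Lp_def)
    let ?T = "maximal_commutator b f"
    have Tm [measurable]: "?T \<in> borel_measurable lebesgue"
      unfolding maximal_commutator_def maximal_eq_maxi by measurable
    \<comment> \<open>Proved for each \<open>t\<close> admissible in the norm of \<open>f\<close>;
      passing to the infimum over \<open>t\<close> at the end gives the norm inequality.\<close>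
    have key: "(AE x in lebesgue. commutator_defined b f x) \<and> modular q (\<lambda>x. ?T x / (K * (L * t))) \<le> 1"
      if t: "0 < t" "modular r (\<lambda>x. f x / t) \<le> 1" for t
    proof -
      have abs: "\<bar>f y / t\<bar> = \<bar>f y\<bar> / t" for y using t by simp
      obtain W where W: "W \<in> borel_measurable lebesgue" "\<And>x. 0 \<le> W x"
        "(\<integral>\<^sup>+ x. ennreal (W x) \<partial>lebesgue) \<le> ennreal K"
        "AE x in lebesgue. \<forall>a s. 0 < s \<longrightarrow> x \<in> cbox a (a + s *\<^sub>R One) \<longrightarrow>
          (\<exists>A\<ge>0. avg (cbox a (a + s *\<^sub>R One)) (\<lambda>y. ennreal (\<bar>f y\<bar> / t)) = ennreal A \<and>
             A \<le> 1 + W x \<and> (s powr \<delta> x * A) powr q x \<le> W x)"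
        using K(2)[of "\<lambda>y. \<bar>f y\<bar> / t"] t by (auto simp: modular_def abs)
      have AE: "AE x in lebesgue. commutator_defined b f x \<and> \<bar>?T x / (L * t)\<bar> powr q x \<le> W x"
        by (rule commutator_modular_bound[OF b eq b'0 L lipL fm t(1) W(2) W(4)])
      have "modular q (\<lambda>x. ?T x / (L * t)) \<le> (\<integral>\<^sup>+ x. ennreal (W x) \<partial>lebesgue)"
        unfolding modular_def
        by (rule nn_integral_mono_AE) (use AE in eventually_elim, auto intro: ennreal_leI)
      then have "modular q (\<lambda>x. ?T x / (L * t)) \<le> ennreal K" using W(3) by (rule order_trans)
      then have "ennreal (1 / K) * modular q (\<lambda>x. ?T x / (L * t)) \<le> ennreal (1 / K) * ennreal K"
        by (rule mult_left_mono) simp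
      also have "\<dots> = 1" using K(1) by (simp add: ennreal_mult[symmetric])
      finally have "ennreal (1 / K) * modular q (\<lambda>x. ?T x / (L * t)) \<le> 1" .
      with modular_scale[OF qm q(1) Tm K(1), of "L * t"]
      have "modular q (\<lambda>x. ?T x / (K * (L * t))) \<le> 1" by (rule order_trans)
      moreover from AE have "AE x in lebesgue. commutator_defined b f x" by eventually_elim simp
      ultimately show ?thesis by blast
    qed
    let ?S = "{t. 0 < t \<and> modular r (\<lambda>x. f x / t) \<le> 1}"
    have S: "?S \<noteq> {}" by (rule var_Lp_norm_set_nonempty[OF meas r_ge f])
    then obtain t0 where t0: "0 < t0" "modular r (\<lambda>x. f x / t0) \<le> 1" by auto
    have Tin: "?T \<in> var_Lp q"
      unfolding var_Lp_def
    proof (intro CollectI conjI Tm exI[of _ "K * (L * t0)"])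
      show "0 < K * (L * t0)" using K(1) L t0 by (simp add: zero_less_mult_iff)
      show "modular q (\<lambda>x. ?T x / (K * (L * t0))) < \<infinity>"
        using key[OF t0] by (auto intro: order_le_less_trans)
    qed
    have "var_Lp_norm q ?T / (L * K) \<le> var_Lp_norm r f"
      unfolding var_Lp_norm_def[of r]
    proof (rule cInf_greatest[OF S])
      fix t assume "t \<in> ?S"
      then have t: "0 < t" "modular r (\<lambda>x. f x / t) \<le> 1" by auto
      have "var_Lp_norm q ?T \<le> K * (L * t)"
        using key[OF t] K(1) L t by (intro var_Lp_norm_le) (auto simp: zero_less_mult_iff)
      then show "var_Lp_norm q ?T / (L * K) \<le> t"
        using K(1) L by (simp add: divide_le_eq zero_less_mult_iff mult_ac)
    qed
    then have "var_Lp_norm q ?T \<le> L * K * var_Lp_norm r f"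
      using K(1) L by (simp add: divide_le_eq zero_less_mult_iff mult_ac)
    then show "(AE x in lebesgue. commutator_defined b f x) \<and> ?T \<in> var_Lp q \<and>
      var_Lp_norm q ?T \<le> L * K * var_Lp_norm r f"
      using key[OF t0] Tin by blast
  qed
qed

end

section \<open>Oscillation estimates from boundedness\<close>

lemma avg_eq_integral:
  fixes f :: "real ^ 'n \<Rightarrow> real"
  assumes f: "f absolutely_integrable_on cbox a (a + s *\<^sub>R One)" and s: "0 < s"
    and f0: "\<And>y. y \<in> cbox a (a + s *\<^sub>R One) \<Longrightarrow> 0 \<le> f y"
  shows "avg (cbox a (a + s *\<^sub>R One)) (\<lambda>y. ennreal (f y))
    = ennreal (integral (cbox a (a + s *\<^sub>R One)) f / s ^ CARD('n))"
proof -
  let ?Q = "cbox a (a + s *\<^sub>R (One :: real ^ 'n))"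
  have "(\<integral>\<^sup>+ y \<in> ?Q. ennreal (f y) \<partial>lebesgue) = (\<integral>\<^sup>+ y. ennreal (indicator ?Q y *\<^sub>R f y) \<partial>lebesgue)"
    by (intro nn_integral_cong) (auto simp: indicator_def)
  also have "\<dots> = ennreal (LINT y|lebesgue. indicator ?Q y *\<^sub>R f y)"
    using f unfolding set_integrable_def by (rule nn_integral_eq_integral) (auto simp: indicator_def f0)
  also have "(LINT y|lebesgue. indicator ?Q y *\<^sub>R f y) = integral ?Q f"
    using set_lebesgue_integral_eq_integral(2)[OF f] by (simp add: set_lebesgue_integral_def)
  finally have "(\<integral>\<^sup>+ y \<in> ?Q. ennreal (f y) \<partial>lebesgue) = ennreal (integral ?Q f)" .
  moreover have "0 \<le> integral ?Q f" by (rule integral_nonneg) (use f f0 set_lebesgue_integral_eq_integral(1) in auto)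
  moreover have "emeasure lebesgue ?Q = ennreal (s ^ CARD('n))" using s by (intro emeasure_cube) auto
  ultimately show ?thesis using s by (simp only: avg_def divide_ennreal zero_less_power)
qed

text \<open>The cubes have \<open>x\<close> as lower corner, not as centre. The means in the
  telescoping argument are therefore anchored at lower corners as well.\<close>

lemma lebesgue_differentiation:
  fixes f :: "real ^ 'n \<Rightarrow> real"
  assumes "\<And>a b. f integrable_on cbox a b"
  obtains N where "negligible N"
    "\<And>x. x \<notin> N \<Longrightarrow> ((\<lambda>h. integral (cbox x (x + h *\<^sub>R One)) f / h ^ CARD('n)) \<longlongrightarrow> f x) (at_right 0)"
proof -
  obtain N where N: "negligible N"
    "\<And>x e. x \<notin> N \<Longrightarrow> 0 < e \<Longrightarrow> \<exists>d>0. \<forall>h. 0 < h \<and> h < d \<longrightarrow>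
       norm (integral (cbox x (x + h *\<^sub>R One)) f /\<^sub>R h ^ DIM(real ^ 'n) - f x) < e"
    using integrable_ccontinuous_explicit[OF assms] by metis
  show ?thesis
  proof (rule that[OF N(1)], rule tendstoI)
    fix x :: "real ^ 'n" and e :: real assume "x \<notin> N" "0 < e"
    from N(2)[OF this] obtain d where "0 < d" "\<And>h. 0 < h \<Longrightarrow> h < d \<Longrightarrow>
       norm (integral (cbox x (x + h *\<^sub>R One)) f /\<^sub>R h ^ DIM(real ^ 'n) - f x) < e" by blast
    then show "\<forall>\<^sub>F h in at_right 0. dist (integral (cbox x (x + h *\<^sub>R One)) f / h ^ CARD('n)) (f x) < e"
      unfolding eventually_at_right_field
      by (intro exI[of _ d]) (simp add: dist_norm divide_inverse mult.commute)
  qed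
qed

lemma locally_integrable_cbox: "locally_integrable b \<Longrightarrow> b absolutely_integrable_on cbox x y"
  by (simp add: locally_integrable_def)

lemma locally_integrable_measurable:
  fixes b :: "real ^ 'n \<Rightarrow> real"
  assumes "locally_integrable b"
  shows "b \<in> borel_measurable lebesgue"
proof (rule borel_measurable_LIMSEQ_real)
  let ?Q = "\<lambda>k. cball 0 (real k) :: (real ^ 'n) set"
  show "(\<lambda>x. indicator (?Q k) x *\<^sub>R b x) \<in> borel_measurable lebesgue" for k
  proof -
    have "b absolutely_integrable_on ?Q k" using assms by (simp add: locally_integrable_def)
    then show ?thesis unfolding set_integrable_def by (rule borel_measurable_integrable)
  qed
  show "(\<lambda>k. indicator (?Q k) x *\<^sub>R b x) \<longlonglongrightarrow> b x" for x
  proof (rule tendsto_eventually)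
    obtain K where "norm x \<le> real K" using real_arch_simple by blast
    then show "\<forall>\<^sub>F k in sequentially. indicator (?Q k) x *\<^sub>R b x = b x"
      by (intro eventually_sequentiallyI[of K]) (auto simp: indicator_def)
  qed
qed

lemma avg_mono_AE:
  assumes "AE y in lebesgue. y \<in> Q \<longrightarrow> f y \<le> g y"
  shows "avg Q f \<le> avg Q g"
  unfolding avg_def
proof (intro divide_right_mono_ennreal nn_integral_mono_AE)
  show "AE y in lebesgue. f y * indicator Q y \<le> g y * indicator Q y"
    using assms by eventually_elim (auto simp: indicator_def)
qed

section \<open>Testing the commutator on indicators of cubes\<close>

text \<open>Boundedness bounds the norm of the commutator by that of the indicator, of order
  \<open>s powr (n / r')\<close>; the a priori bound for the exponent \<open>q\<close> turns this
  into an average with a further factor \<open>s powr (- n / q')\<close>. On small cubes the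
  exponents are taken at \<open>x\<close> and combine to \<open>\<delta> x\<close>, on large ones
  they are the limits at infinity.\<close>

lemma commutator_average_bound:
  fixes b r q \<delta> :: "real ^ 'n \<Rightarrow> real"
  assumes r: "log_hoelder r Rr Cr Dr lr" and q: "log_hoelder q Rq Cq Dq lq"
    and \<delta>: "\<And>x. \<delta> x / real CARD('n) = 1 / r x - 1 / q x"
    and bounded: "var_Lp_bounded_operator r q (commutator_defined b) (maximal_commutator b)"
  obtains K where "0 \<le> K"
    "\<And>a s x. 0 < s \<Longrightarrow> x \<in> cbox a (a + s *\<^sub>R One) \<Longrightarrow>
      (AE y in lebesgue. commutator_defined b (indicator (cbox a (a + s *\<^sub>R One))) y) \<and>
      avg (cbox a (a + s *\<^sub>R One)) (\<lambda>y. ennreal \<bar>maximal_commutator b (indicator (cbox a (a + s *\<^sub>R One))) y\<bar>)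
        \<le> ennreal (K * s powr (if s \<le> 1 then \<delta> x else real CARD('n) * (1 / lr - 1 / lq)))"
proof -
  interpret r: log_hoelder r Rr Cr Dr lr by fact
  interpret q: log_hoelder q Rq Cq Dq lq by fact
  define n where "n = real CARD('n)"
  have n: "r.nn = n" "0 < n" by (simp_all add: r.nn_def n_def)
  from bounded obtain C where C: "\<And>f. f \<in> var_Lp r \<Longrightarrow> (AE x in lebesgue. commutator_defined b f x) \<and>
      maximal_commutator b f \<in> var_Lp q \<and> var_Lp_norm q (maximal_commutator b f) \<le> C * var_Lp_norm r f"
    unfolding var_Lp_bounded_operator_def by blast
  define K where "K = (\<bar>C\<bar> + 1) * r.Kavg * q.Kavg"
  have Kpos: "0 < r.Kavg" "0 < q.Kavg" using r.Kavg_ge q.Kavg_ge by auto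
  show ?thesis
  proof (rule that)
    show "0 \<le> K" using Kpos by (simp add: K_def)
    fix a :: "real ^ 'n" and s x assume s: "0 < s" and x: "x \<in> cbox a (a + s *\<^sub>R One)"
    let ?Q = "cbox a (a + s *\<^sub>R (One :: real ^ 'n))"
    define f where "f = (indicator ?Q :: real ^ 'n \<Rightarrow> real)"
    define r' q' where "r' = (if s \<le> 1 then r x else lr)" and "q' = (if s \<le> 1 then q x else lq)"
    define t where "t = r.Kavg * s powr (n / r')"
    have t: "0 < t" using Kpos s by (simp add: t_def)
    have mod: "modular r (\<lambda>y. f y / t) \<le> 1"
      using r.indicator_modular_small[OF x s] r.indicator_modular_large[of s a]
      by (auto simp: f_def t_def r'_def n)
    have f: "f \<in> var_Lp r"
      unfolding var_Lp_def
    proof (intro CollectI conjI exI[of _ t] t)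
      show "f \<in> borel_measurable lebesgue" unfolding f_def by (intro borel_measurable_indicator) simp
      show "modular r (\<lambda>y. f y / t) < \<infinity>" using mod by (auto intro: order_le_less_trans)
    qed
    let ?T = "maximal_commutator b f"
    have T: "AE y in lebesgue. commutator_defined b f y" "?T \<in> var_Lp q"
      "var_Lp_norm q ?T \<le> C * var_Lp_norm r f" using C[OF f] by auto
    have Tm [measurable]: "?T \<in> borel_measurable lebesgue" using T(2) by (simp add: var_Lp_def)
    have nf: "0 \<le> var_Lp_norm r f" "var_Lp_norm r f \<le> t"
    proof -
      show "0 \<le> var_Lp_norm r f" unfolding var_Lp_norm_def
        by (rule cInf_greatest[OF var_Lp_norm_set_nonempty[OF r.meas r.r_ge f]]) auto
      show "var_Lp_norm r f \<le> t" by (rule var_Lp_norm_le[OF t mod])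
    qed
    \<comment> \<open>\<open>\<bar>C\<bar>\<close> because the sign of \<open>C\<close> is unknown,
      and \<open>+ 1\<close> to lie strictly above the norm, where the modular is known to be at
      most 1.\<close>
    define u where "u = (\<bar>C\<bar> + 1) * t"
    have u: "0 < u" using t by (simp add: u_def add_nonneg_pos)
    have "C * var_Lp_norm r f \<le> \<bar>C\<bar> * t" using nf by (intro mult_mono) auto
    also have "\<dots> < u" using t by (simp add: u_def distrib_right)
    finally have "var_Lp_norm q ?T < u" using T(3) by simp
    from var_Lp_norm_less_modular[OF q.meas q.r_ge T(2) this]
    have mod2: "modular q (\<lambda>y. ?T y / u) \<le> 1" .
    define g where "g y = \<bar>?T y / u\<bar>" for y
    have gm: "g \<in> borel_measurable lebesgue" unfolding g_def by measurable
    have g0: "0 \<le> g y" for y by (simp add: g_def)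
    have gmod: "(\<integral>\<^sup>+ y. ennreal (g y powr q y) \<partial>lebesgue) \<le> 1" using mod2 by (simp add: g_def modular_def)
    have "avg ?Q (\<lambda>y. ennreal (g y)) \<le> ennreal (q.Kavg * s powr (- n / q'))"
      using q.modular_avg_bound_small[OF gm g0 gmod x s] q.modular_avg_bound_large[OF gm g0 gmod, of s a]
      by (auto simp: q'_def n)
    then have le: "ennreal u * avg ?Q (\<lambda>y. ennreal (g y)) \<le> ennreal u * ennreal (q.Kavg * s powr (- n / q'))"
      by (rule mult_left_mono) simp
    have "avg ?Q (\<lambda>y. ennreal \<bar>?T y\<bar>) = avg ?Q (\<lambda>y. ennreal u * ennreal (g y))"
      using u by (intro arg_cong[where f = "avg ?Q"] ext) (simp add: g_def ennreal_mult[symmetric] abs_mult)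
    also have "\<dots> = ennreal u * avg ?Q (\<lambda>y. ennreal (g y))"
      using gm s by (intro avg_cmult cubesI) auto
    also note le
    also have "ennreal u * ennreal (q.Kavg * s powr (- n / q')) = ennreal (u * (q.Kavg * s powr (- n / q')))"
      using u Kpos by (intro ennreal_mult[symmetric]) auto
    also have "u * (q.Kavg * s powr (- n / q')) = K * (s powr (n / r') * s powr (- n / q'))"
      by (simp add: u_def t_def K_def)
    also have "s powr (n / r') * s powr (- n / q') = s powr (n * (1 / r' - 1 / q'))"
      by (simp add: powr_add[symmetric] right_diff_distrib)
    also have "n * (1 / r' - 1 / q') = (if s \<le> 1 then \<delta> x else n * (1 / lr - 1 / lq))"
      using \<delta>[of x] n(2) by (simp add: r'_def q'_def n_def field_simps)
    finally show "(AE y in lebesgue. commutator_defined b (indicator ?Q) y) \<and>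
      avg ?Q (\<lambda>y. ennreal \<bar>maximal_commutator b (indicator ?Q) y\<bar>)
        \<le> ennreal (K * s powr (if s \<le> 1 then \<delta> x else real CARD('n) * (1 / lr - 1 / lq)))"
      using T(1) unfolding f_def n_def by blast
  qed
qed

lemma maximal_indicator_cube:
  assumes Q: "Q \<in> cubes" and x: "x \<in> Q"
  shows "maximal (indicator Q) x = 1"
proof (rule antisym)
  show "maximal (indicator Q) x \<le> 1"
    unfolding maximal_eq_maxi maxi_def
  proof (rule SUP_least)
    fix P assume "P \<in> {P \<in> cubes. x \<in> P}"
    then have "avg P (\<lambda>y. 1 :: ennreal) = 1" by (intro avg_const) auto
    moreover have "avg P (\<lambda>y. ennreal \<bar>indicator Q y\<bar>) \<le> avg P (\<lambda>y. 1 :: ennreal)"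
      by (rule avg_mono) (simp add: indicator_def)
    ultimately show "avg P (\<lambda>y. ennreal \<bar>indicator Q y\<bar>) \<le> 1" by simp
  qed
  have "avg Q (\<lambda>y. 1 :: ennreal) = 1" by (intro avg_const Q)
  moreover have "avg Q (\<lambda>y. 1 :: ennreal) \<le> avg Q (\<lambda>y. ennreal \<bar>indicator Q y\<bar>)"
    by (rule avg_mono) simp
  ultimately show "1 \<le> maximal (indicator Q) x"
    unfolding maximal_eq_maxi using avg_le_maxi[OF Q x, of "\<lambda>y. ennreal \<bar>indicator Q y\<bar>"] by simp
qed

text \<open>On \<open>Q\<close> the commutator of the indicator is \<open>b - M\<close>, where
  \<open>M\<close> is the maximal function of \<open>b\<close> restricted to \<open>Q\<close>. The
  mean of \<open>b\<close> is below \<open>M\<close> by taking \<open>Q\<close> itself as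
  competitor, and \<open>\<bar>b y\<bar>\<close> by taking cubes inside \<open>Q\<close> that shrink
  to a Lebesgue point \<open>y\<close> of \<open>\<bar>b\<bar>\<close>.\<close>

lemma commutator_lower_bound:
  fixes b :: "real ^ 'n \<Rightarrow> real"
  assumes b: "locally_integrable b" and s: "0 < s"
    and def: "AE y in lebesgue. commutator_defined b (indicator (cbox a (a + s *\<^sub>R One))) y"
  shows "AE y in lebesgue. y \<in> cbox a (a + s *\<^sub>R One) \<longrightarrow>
    integral (cbox a (a + s *\<^sub>R One)) b / s ^ CARD('n) - b y
      \<le> \<bar>maximal_commutator b (indicator (cbox a (a + s *\<^sub>R One))) y\<bar> \<and>
    \<bar>b y\<bar> - b y \<le> \<bar>maximal_commutator b (indicator (cbox a (a + s *\<^sub>R One))) y\<bar>"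
proof -
  let ?Q = "cbox a (a + s *\<^sub>R (One :: real ^ 'n))"
  have ai: "b absolutely_integrable_on cbox x y" for x y by (rule locally_integrable_cbox[OF b])
  have abs_ai: "(\<lambda>y. \<bar>b y\<bar>) absolutely_integrable_on cbox x y" for x y
    using absolutely_integrable_norm[OF ai[of x y]] by (simp add: o_def)
  have int: "b integrable_on cbox x y" "(\<lambda>y. \<bar>b y\<bar>) integrable_on cbox x y" for x y
    using ai abs_ai set_lebesgue_integral_eq_integral(1) by blast+
  obtain N where N: "negligible N"
    "\<And>x. x \<notin> N \<Longrightarrow> ((\<lambda>h. integral (cbox x (x + h *\<^sub>R One)) (\<lambda>y. \<bar>b y\<bar>) / h ^ CARD('n)) \<longlongrightarrow> \<bar>b x\<bar>) (at_right 0)"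
    using lebesgue_differentiation[OF int(2)] by blast
  \<comment> \<open>Points on the upper faces are discarded: cubes with such a lower corner would
    leave \<open>Q\<close>.\<close>
  have "negligible (?Q - box a (a + s *\<^sub>R One))" by (rule negligible_frontier_interval)
  with N(1) have "negligible (N \<union> (?Q - box a (a + s *\<^sub>R One)))" by simp
  then have "AE y in lebesgue. y \<notin> N \<union> (?Q - box a (a + s *\<^sub>R One))"
    by (intro AE_not_in) (simp add: negligible_iff_null_sets)
  with def show ?thesis
  proof eventually_elim
    case (elim y)
    show ?case
    proof
      assume y: "y \<in> ?Q"
      with elim have yN: "y \<notin> N" and ybox: "y \<in> box a (a + s *\<^sub>R One)" by auto
      let ?g = "\<lambda>z. ennreal \<bar>b z * indicator ?Q z\<bar>"
      have Q: "?Q \<in> cubes" using s by (rule cubesI)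
      obtain M where M: "0 \<le> M" "maxi ?g y = ennreal M"
        using elim(1) by (cases "maxi ?g y") (auto simp: commutator_defined_def maximal_eq_maxi)
      have T: "maximal_commutator b (indicator ?Q) y = b y - M"
        using M maximal_indicator_cube[OF Q y] unfolding maximal_commutator_def maximal_eq_maxi by simp
      have mean_le: "integral (cbox x (x + h *\<^sub>R One)) (\<lambda>y. \<bar>b y\<bar>) / h ^ CARD('n) \<le> M"
        if h: "0 < h" and sub: "cbox x (x + h *\<^sub>R One) \<subseteq> ?Q" and yx: "y \<in> cbox x (x + h *\<^sub>R One)" for x h
      proof -
        have "ennreal (integral (cbox x (x + h *\<^sub>R One)) (\<lambda>y. \<bar>b y\<bar>) / h ^ CARD('n))
          = avg (cbox x (x + h *\<^sub>R One)) (\<lambda>y. ennreal \<bar>b y\<bar>)"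
          by (rule avg_eq_integral[symmetric, OF abs_ai h]) simp
        also have "\<dots> \<le> avg (cbox x (x + h *\<^sub>R One)) ?g"
          by (rule avg_mono) (use sub in auto)
        also have "\<dots> \<le> maxi ?g y" by (rule avg_le_maxi[OF cubesI[OF h] yx])
        finally show ?thesis using M by (simp add: ennreal_le_iff)
      qed
      have "integral ?Q b / s ^ CARD('n) \<le> integral ?Q (\<lambda>y. \<bar>b y\<bar>) / s ^ CARD('n)"
        using s int by (intro divide_right_mono integral_le) auto
      also have "\<dots> \<le> M" by (rule mean_le[OF s _ y]) simp
      finally have 1: "integral ?Q b / s ^ CARD('n) \<le> M" .
      have "\<bar>b y\<bar> \<le> M"
      proof (rule tendsto_upperbound[OF N(2)[OF yN]])
        \<comment> \<open>The distance from \<open>y\<close> to the nearest upper face, hence the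
          room for cubes with lower corner \<open>y\<close>.\<close>
        define d where "d = Min (range (\<lambda>i. a $ i + s - y $ i))"
        have yi: "a $ i \<le> y $ i" "y $ i < a $ i + s" for i using ybox by (auto simp: mem_box_cart less_imp_le)
        have d: "0 < d" unfolding d_def using yi by (subst Min_gr_iff) (auto simp: algebra_simps)
        have di: "d \<le> a $ i + s - y $ i" for i unfolding d_def by (rule Min_le) auto
        show "\<forall>\<^sub>F h in at_right 0. integral (cbox y (y + h *\<^sub>R One)) (\<lambda>y. \<bar>b y\<bar>) / h ^ CARD('n) \<le> M"
          unfolding eventually_at_right_field
        proof (intro exI[of _ d] conjI d allI impI)
          fix h assume h: "0 < h" "h < d"
          have "cbox y (y + h *\<^sub>R One) \<subseteq> ?Q"
          proof
            fix z assume z: "z \<in> cbox y (y + h *\<^sub>R One)"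
            show "z \<in> ?Q" unfolding mem_cube
            proof
              fix i
              have "y $ i \<le> z $ i" "z $ i \<le> y $ i + h" using z unfolding mem_cube by auto
              then show "a $ i \<le> z $ i \<and> z $ i \<le> a $ i + s" using di[of i] yi[of i] h by linarith
            qed
          qed
          then show "integral (cbox y (y + h *\<^sub>R One)) (\<lambda>y. \<bar>b y\<bar>) / h ^ CARD('n) \<le> M"
            using h by (intro mean_le) (auto simp: mem_cube)
        qed
      qed simp
      with 1 show "integral ?Q b / s ^ CARD('n) - b y \<le> \<bar>maximal_commutator b (indicator ?Q) y\<bar> \<and>
        \<bar>b y\<bar> - b y \<le> \<bar>maximal_commutator b (indicator ?Q) y\<bar>"
        unfolding T by linarith
    qed
  qed
qed

text \<open>Only \<open>m - b y\<close>, with \<open>m\<close> the mean of \<open>b\<close>, is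
  bounded by the commutator, not its absolute value. But \<open>\<bar>b y - m\<bar>\<close> is twice
  the positive part of \<open>m - b y\<close> plus \<open>b y - m\<close>, and the last term has
  integral 0; hence the factor 2.\<close>

lemma commutator_oscillation:
  fixes b :: "real ^ 'n \<Rightarrow> real"
  assumes b: "locally_integrable b" and s: "0 < s" and E: "0 \<le> E"
    and def: "AE y in lebesgue. commutator_defined b (indicator (cbox a (a + s *\<^sub>R One))) y"
    and le: "avg (cbox a (a + s *\<^sub>R One)) (\<lambda>y. ennreal \<bar>maximal_commutator b (indicator (cbox a (a + s *\<^sub>R One))) y\<bar>) \<le> ennreal E"
  shows "integral (cbox a (a + s *\<^sub>R One)) (\<lambda>y. \<bar>b y - integral (cbox a (a + s *\<^sub>R One)) b / s ^ CARD('n)\<bar>)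
      \<le> 2 * E * s ^ CARD('n)"
    and "integral (cbox a (a + s *\<^sub>R One)) (\<lambda>y. \<bar>b y\<bar> - b y) \<le> E * s ^ CARD('n)"
proof -
  let ?Q = "cbox a (a + s *\<^sub>R (One :: real ^ 'n))"
  let ?T = "\<lambda>y. \<bar>maximal_commutator b (indicator ?Q) y\<bar>"
  define m where "m = integral ?Q b / s ^ CARD('n)"
  have ai: "b absolutely_integrable_on ?Q" by (rule locally_integrable_cbox[OF b])
  have abs_ai: "(\<lambda>y. \<bar>b y\<bar>) absolutely_integrable_on ?Q"
    using absolutely_integrable_norm[OF ai] by (simp add: o_def)
  have const: "(\<lambda>y. c :: real) absolutely_integrable_on ?Q" for c by (rule absolutely_integrable_on_const) simp
  have low: "AE y in lebesgue. y \<in> ?Q \<longrightarrow> m - b y \<le> ?T y \<and> \<bar>b y\<bar> - b y \<le> ?T y"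
    unfolding m_def by (rule commutator_lower_bound[OF b s def])
  have bound: "integral ?Q g \<le> E * s ^ CARD('n)"
    if g: "g absolutely_integrable_on ?Q" "\<And>y. y \<in> ?Q \<Longrightarrow> 0 \<le> g y"
      and gT: "AE y in lebesgue. y \<in> ?Q \<longrightarrow> g y \<le> ?T y" for g
  proof -
    have "ennreal (integral ?Q g / s ^ CARD('n)) = avg ?Q (\<lambda>y. ennreal (g y))"
      by (rule avg_eq_integral[symmetric, OF g(1) s g(2)])
    also have "\<dots> \<le> avg ?Q (\<lambda>y. ennreal (?T y))"
      by (rule avg_mono_AE) (use gT in eventually_elim, auto intro: ennreal_leI)
    also note le
    finally have "integral ?Q g / s ^ CARD('n) \<le> E" using E by (simp add: ennreal_le_iff)
    then show ?thesis using s by (simp add: divide_le_eq)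
  qed
  have g1: "(\<lambda>y. max 0 (m - b y)) absolutely_integrable_on ?Q"
    by (intro absolutely_integrable_max_1 const set_integral_diff ai)
  have 1: "integral ?Q (\<lambda>y. max 0 (m - b y)) \<le> E * s ^ CARD('n)"
    by (rule bound[OF g1]) (use low in \<open>auto elim!: eventually_mono\<close>)
  have g2: "(\<lambda>y. \<bar>b y\<bar> - b y) absolutely_integrable_on ?Q"
    by (intro set_integral_diff ai abs_ai)
  show "integral ?Q (\<lambda>y. \<bar>b y\<bar> - b y) \<le> E * s ^ CARD('n)"
    by (rule bound[OF g2]) (use low in \<open>auto elim!: eventually_mono\<close>)
  have int: "b integrable_on ?Q" "(\<lambda>y. max 0 (m - b y)) integrable_on ?Q"
    using ai g1 set_lebesgue_integral_eq_integral(1) by blast+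
  have diff: "((\<lambda>y. b y - m) has_integral integral ?Q b - integral ?Q (\<lambda>y. m)) ?Q"
    using int(1) by (intro has_integral_diff integrable_integral integrable_const)
  have "((\<lambda>y. 2 * max 0 (m - b y) + (b y - m)) has_integral
      2 * integral ?Q (\<lambda>y. max 0 (m - b y)) + (integral ?Q b - integral ?Q (\<lambda>y. m))) ?Q"
    using int(2) diff by (intro has_integral_add has_integral_mult_right integrable_integral)
  moreover have "2 * max 0 (m - b y) + (b y - m) = \<bar>b y - m\<bar>" for y by (simp add: max_def)
  ultimately have "integral ?Q (\<lambda>y. \<bar>b y - m\<bar>)
      = 2 * integral ?Q (\<lambda>y. max 0 (m - b y)) + (integral ?Q b - integral ?Q (\<lambda>y. m))"
    by (simp add: integral_unique)
  also have "integral ?Q (\<lambda>y. m) = m * s ^ CARD('n)"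
  proof -
    have "measure lebesgue ?Q = s ^ CARD('n)"
      using emeasure_cube[of s a] s by (simp add: measure_def del: emeasure_completion)
    then show ?thesis by (simp add: measure_completion)
  qed
  also have "integral ?Q b - m * s ^ CARD('n) = 0" using s by (simp add: m_def)
  finally show "integral ?Q (\<lambda>y. \<bar>b y - integral ?Q b / s ^ CARD('n)\<bar>) \<le> 2 * E * s ^ CARD('n)"
    using 1 by (simp add: m_def)
qed

section \<open>Telescoping means over nested cubes\<close>

text \<open>\<open>d\<close> stands for \<open>\<delta>_\<infinity>\<close>: the oscillation of \<open>b\<close> on a cube of side \<open>s\<close> through \<open>x\<close> scales like this.\<close>

definition scale :: "('a \<Rightarrow> real) \<Rightarrow> real \<Rightarrow> 'a \<Rightarrow> real \<Rightarrow> real"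
  where "scale \<delta> d x s = s powr (if s \<le> 1 then \<delta> x else d)"

text \<open>Provides the geometric decay of the telescoping sum. If \<open>k * s\<close> and
  \<open>s\<close> lie on different sides of 1 the two scales have different exponents; the common
  lower bound \<open>\<epsilon>\<close> mediates, since lowering an exponent increases powers of
  \<open>k * s \<le> 1\<close> and raising it increases powers of \<open>s > 1\<close>.\<close>

lemma scale_shrink:
  assumes "\<epsilon> \<le> \<delta> x" "\<epsilon> \<le> d" "0 < k" "k \<le> 1" "0 < s"
  shows "scale \<delta> d x (k * s) \<le> k powr \<epsilon> * scale \<delta> d x s"
proof -
  have le: "(k * s) powr e \<le> k powr \<epsilon> * s powr e" if "\<epsilon> \<le> e" for e
  proof -
    have "(k * s) powr e = k powr e * s powr e" using assms by (simp add: powr_mult)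
    also have "\<dots> \<le> k powr \<epsilon> * s powr e" using assms that by (intro mult_right_mono powr_mono') auto
    finally show ?thesis .
  qed
  have ks: "k * s \<le> s" using assms by (simp add: mult_le_cancel_right1)
  consider "s \<le> 1" | "1 < k * s" | "1 < s" "k * s \<le> 1" by linarith
  then show ?thesis
  proof cases
    case 1
    then have "k * s \<le> 1" using ks by linarith
    then show ?thesis using 1 le[of "\<delta> x"] assms by (simp add: scale_def)
  next
    case 2
    then have "\<not> s \<le> 1" using ks by linarith
    then show ?thesis using 2 le[of d] assms by (simp add: scale_def)
  next
    case 3
    have "(k * s) powr \<delta> x \<le> (k * s) powr \<epsilon>" using 3 assms by (intro powr_mono') auto
    also have "\<dots> = k powr \<epsilon> * s powr \<epsilon>" using assms by (simp add: powr_mult)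
    also have "\<dots> \<le> k powr \<epsilon> * s powr d" using 3 assms by (intro mult_left_mono powr_mono) auto
    finally show ?thesis using 3 by (simp add: scale_def)
  qed
qed

definition mean :: "(real ^ 'n \<Rightarrow> real) \<Rightarrow> real ^ 'n \<Rightarrow> real \<Rightarrow> real"
  where "mean b a s = integral (cbox a (a + s *\<^sub>R One)) b / s ^ CARD('n)"

text \<open>The oscillation bound holds for every \<open>x\<close> of the cube, so that the same
  cube can be measured with the exponent of whichever of its points is being compared.\<close>

locale oscillation =
  fixes b \<delta> :: "real ^ 'n \<Rightarrow> real" and d \<epsilon> K :: real
  assumes b: "locally_integrable b" and K: "0 \<le> K"
    and \<epsilon>: "0 < \<epsilon>" "\<And>x. \<epsilon> \<le> \<delta> x" "\<epsilon> \<le> d"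
    and osc: "\<And>a s x. 0 < s \<Longrightarrow> x \<in> cbox a (a + s *\<^sub>R One) \<Longrightarrow>
      integral (cbox a (a + s *\<^sub>R One)) (\<lambda>y. \<bar>b y - mean b a s\<bar>) \<le> K * scale \<delta> d x s * s ^ CARD('n)"
begin

text \<open>The inner cube has at least half the side, so averaging
  \<open>\<bar>b - mean b a s\<bar>\<close> over it instead of the outer one costs at most the
  volume ratio \<open>2 ^ n\<close>.\<close>

lemma mean_diff:
  assumes t: "0 < t" and s: "0 < s" and st: "s \<le> 2 * t" and x: "x \<in> cbox a (a + s *\<^sub>R One)"
    and sub: "cbox c (c + t *\<^sub>R One) \<subseteq> cbox a (a + s *\<^sub>R One)"
  shows "\<bar>mean b c t - mean b a s\<bar> \<le> 2 ^ CARD('n) * K * scale \<delta> d x s"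
proof -
  let ?Q = "cbox a (a + s *\<^sub>R (One :: real ^ 'n))" and ?P = "cbox c (c + t *\<^sub>R (One :: real ^ 'n))"
  let ?m = "mean b a s"
  have bi: "b absolutely_integrable_on cbox x y" for x y by (rule locally_integrable_cbox[OF b])
  have const: "(\<lambda>y. ?m) absolutely_integrable_on cbox x y" for x y :: "real ^ 'n"
    by (rule absolutely_integrable_on_const) simp
  have diff: "(\<lambda>y. b y - ?m) absolutely_integrable_on cbox x y" for x y
    by (intro set_integral_diff bi const)
  have absdiff: "(\<lambda>y. \<bar>b y - ?m\<bar>) absolutely_integrable_on cbox x y" for x y
    using absolutely_integrable_norm[OF diff[of x y]] by (simp add: o_def)
  note int = set_lebesgue_integral_eq_integral(1)
  have content: "integral ?P (\<lambda>y. ?m) = ?m * t ^ CARD('n)"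
  proof -
    have "measure lebesgue ?P = t ^ CARD('n)"
      using emeasure_cube[of t c] t by (simp add: measure_def del: emeasure_completion)
    then show ?thesis by (simp add: measure_completion)
  qed
  have "((\<lambda>y. b y - ?m) has_integral integral ?P b - integral ?P (\<lambda>y. ?m)) ?P"
    using int[OF bi] by (intro has_integral_diff integrable_integral integrable_const)
  then have "integral ?P (\<lambda>y. b y - ?m) = t ^ CARD('n) * (mean b c t - ?m)"
    using t by (simp add: integral_unique content mean_def[of b c t] algebra_simps)
  then have "t ^ CARD('n) * \<bar>mean b c t - ?m\<bar> = \<bar>integral ?P (\<lambda>y. b y - ?m)\<bar>"
    using t by (simp add: abs_mult)
  also have "\<dots> \<le> integral ?P (\<lambda>y. \<bar>b y - ?m\<bar>)"
    using integral_norm_bound_integral[OF int[OF diff] int[OF absdiff], of c "c + t *\<^sub>R One"] by simp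
  also have "\<dots> \<le> integral ?Q (\<lambda>y. \<bar>b y - ?m\<bar>)"
    by (rule integral_subset_le[OF sub int[OF absdiff] int[OF absdiff]]) simp
  also have "\<dots> \<le> K * scale \<delta> d x s * s ^ CARD('n)" by (rule osc[OF s x])
  also have "\<dots> \<le> K * scale \<delta> d x s * (2 * t) ^ CARD('n)"
    using st s K by (intro mult_left_mono power_mono mult_nonneg_nonneg) (auto simp: scale_def)
  also have "\<dots> = t ^ CARD('n) * (2 ^ CARD('n) * K * scale \<delta> d x s)" by (simp add: power_mult_distrib)
  finally show ?thesis using t by simp
qed

text \<open>The cost of one halving times the sum of the geometric series of ratio
  \<open>2 powr (- \<epsilon>)\<close>.\<close>

definition Ktel :: real where "Ktel = 2 ^ CARD('n) * K / (1 - 2 powr (- \<epsilon>))"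

lemma Ktel_nonneg: "0 \<le> Ktel"
  using K \<epsilon>(1) by (simp add: Ktel_def powr_minus inverse_le_1_iff ge_one_powr_ge_zero)

lemma mean_halving:
  assumes s: "0 < s"
  shows "\<bar>mean b x (s / 2 ^ k) - mean b x s\<bar> \<le> Ktel * scale \<delta> d x s"
proof -
  define \<rho> where "\<rho> = 2 powr (- \<epsilon>)"
  have \<rho>: "0 < \<rho>" "\<rho> < 1" using \<epsilon>(1) by (auto simp: \<rho>_def powr_less_one)
  define A where "A = 2 ^ CARD('n) * K * scale \<delta> d x s"
  have A: "0 \<le> A" using K by (simp add: A_def scale_def)
  have step: "\<bar>mean b x (s / 2 ^ Suc j) - mean b x (s / 2 ^ j)\<bar> \<le> A * \<rho> ^ j" for j
  proof -
    have "\<bar>mean b x (s / 2 ^ Suc j) - mean b x (s / 2 ^ j)\<bar> \<le> 2 ^ CARD('n) * K * scale \<delta> d x (s / 2 ^ j)"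
    proof (rule mean_diff)
      show "cbox x (x + (s / 2 ^ Suc j) *\<^sub>R One) \<subseteq> cbox x (x + (s / 2 ^ j) *\<^sub>R One)"
      proof
        fix z :: "real ^ 'n" assume z: "z \<in> cbox x (x + (s / 2 ^ Suc j) *\<^sub>R One)"
        have "s / 2 ^ Suc j \<le> s / 2 ^ j" using s by (intro divide_left_mono) auto
        then show "z \<in> cbox x (x + (s / 2 ^ j) *\<^sub>R One)"
          using z unfolding mem_cube by (meson add_left_mono order_trans)
      qed
    qed (use s in \<open>auto simp: mem_cube\<close>)
    also have "\<dots> \<le> 2 ^ CARD('n) * K * (\<rho> ^ j * scale \<delta> d x s)"
    proof (rule mult_left_mono)
      have "scale \<delta> d x ((1 / 2 ^ j) * s) \<le> (1 / 2 ^ j) powr \<epsilon> * scale \<delta> d x s"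
        using s \<epsilon> by (intro scale_shrink) auto
      also have "(1 / 2 ^ j) powr \<epsilon> = \<rho> ^ j"
        by (simp add: \<rho>_def powr_power powr_realpow[symmetric] powr_divide powr_powr powr_minus_divide mult.commute)
      finally show "scale \<delta> d x (s / 2 ^ j) \<le> \<rho> ^ j * scale \<delta> d x s" by simp
    qed (use K in simp)
    finally show ?thesis by (simp add: A_def mult_ac)
  qed
  have "\<bar>mean b x (s / 2 ^ k) - mean b x s\<bar> \<le> A * (\<Sum>j<k. \<rho> ^ j)"
  proof (induction k)
    case (Suc k)
    then show ?case using step[of k] by (simp add: distrib_left)
  qed simp
  also have "\<dots> \<le> A * (1 / (1 - \<rho>))"
    using \<rho> A by (intro mult_left_mono) (auto simp: sum_gp_strict divide_right_mono)
  finally show ?thesis by (simp add: A_def Ktel_def \<rho>_def mult_ac)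
qed

lemma lebesgue_point_mean:
  assumes s: "0 < s" and lim: "((\<lambda>h. mean b x h) \<longlongrightarrow> b x) (at_right 0)"
  shows "\<bar>b x - mean b x s\<bar> \<le> Ktel * scale \<delta> d x s"
proof -
  have "(\<lambda>k. s * (1 / 2) ^ k) \<longlonglongrightarrow> s * 0"
    by (intro tendsto_mult tendsto_const LIMSEQ_power_zero) simp
  then have "(\<lambda>k. s / 2 ^ k) \<longlonglongrightarrow> 0" by (simp add: power_divide)
  then have "filterlim (\<lambda>k. s / 2 ^ k) (at_right 0) sequentially"
    by (rule tendsto_imp_filterlim_at_right) (use s in simp)
  then have "(\<lambda>k. mean b x (s / 2 ^ k)) \<longlonglongrightarrow> b x"
    by (rule filterlim_compose[OF lim])
  then have "(\<lambda>k. \<bar>mean b x (s / 2 ^ k) - mean b x s\<bar>) \<longlonglongrightarrow> \<bar>b x - mean b x s\<bar>"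
    by (intro tendsto_intros)
  then show ?thesis by (rule LIMSEQ_le_const2) (auto intro: mean_halving[OF s])
qed

text \<open>Both cubes of side \<open>s\<close> with lower corners \<open>x\<close> and
  \<open>y\<close> lie in the cube of side \<open>2 * s\<close> whose lower corner is the
  componentwise minimum. The chain runs from \<open>b x\<close> to the mean at \<open>x\<close>, to
  the common mean, to the mean at \<open>y\<close> and to \<open>b y\<close>.\<close>

lemma lebesgue_point_diff:
  assumes x: "((\<lambda>h. mean b x h) \<longlongrightarrow> b x) (at_right 0)"
    and y: "((\<lambda>h. mean b y h) \<longlongrightarrow> b y) (at_right 0)" and xy: "x \<noteq> y"
  defines "s \<equiv> norm (x - y)"
  shows "\<bar>b x - b y\<bar> \<le> Ktel * (scale \<delta> d x s + scale \<delta> d y s) + 2 * (2 ^ CARD('n) * K * scale \<delta> d x (2 * s))"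
proof -
  have s: "0 < s" using xy by (simp add: s_def)
  define a where "a = (\<chi> i. min (x $ i) (y $ i))"
  have comp: "\<bar>x $ i - y $ i\<bar> \<le> s" for i
    using component_le_norm_cart[of "x - y" i] by (simp add: s_def)
  have sub: "cbox z (z + s *\<^sub>R One) \<subseteq> cbox a (a + (2 * s) *\<^sub>R One)" if z: "z = x \<or> z = y" for z
  proof
    fix w assume w: "w \<in> cbox z (z + s *\<^sub>R One)"
    show "w \<in> cbox a (a + (2 * s) *\<^sub>R One)" unfolding mem_cube
    proof
      fix i
      have "z $ i \<le> w $ i" "w $ i \<le> z $ i + s" using w unfolding mem_cube by auto
      moreover have "a $ i \<le> z $ i" "z $ i \<le> a $ i + s" using z comp[of i] by (auto simp: a_def min_def abs_le_iff)
      ultimately show "a $ i \<le> w $ i \<and> w $ i \<le> a $ i + 2 * s" by linarith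
    qed
  qed
  have xQ: "x \<in> cbox a (a + (2 * s) *\<^sub>R One)"
    by (rule subsetD[OF sub[of x]]) (use s in \<open>auto simp: mem_cube\<close>)
  have m: "\<bar>mean b z s - mean b a (2 * s)\<bar> \<le> 2 ^ CARD('n) * K * scale \<delta> d x (2 * s)" if "z = x \<or> z = y" for z
    by (rule mean_diff[OF s _ _ xQ sub[OF that]]) (use s in auto)
  show ?thesis
    using m[of x] m[of y] lebesgue_point_mean[OF s x] lebesgue_point_mean[OF s y]
    by (simp add: distrib_left abs_le_iff)
qed

end

section \<open>Removing the exceptional null set\<close>

text \<open>The complement of \<open>N\<close> is dense. Near an exceptional point \<open>b\<close>
  is bounded along any sequence from the complement, so some subsequence of values converges, and
  its limit serves as the new value. No uniqueness has to be checked: the estimate passes to any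
  such limits, because \<open>\<delta>\<close> is continuous.\<close>

lemma extend_from_full_measure:
  fixes b \<delta> :: "real ^ 'n \<Rightarrow> real"
  assumes N: "negligible N" and C: "0 \<le> C"
    and lip: "\<And>x y. x \<notin> N \<Longrightarrow> y \<notin> N \<Longrightarrow> \<bar>b x - b y\<bar> \<le> C * norm (x - y) powr \<delta> x"
    and b0: "\<And>x. x \<notin> N \<Longrightarrow> 0 \<le> b x"
    and \<delta>: "\<And>x. 0 < \<delta> x" "continuous_on UNIV \<delta>"
  obtains b' where "\<And>x. x \<notin> N \<Longrightarrow> b' x = b x" "b' \<in> var_Lipschitz \<delta>" "\<And>x. 0 \<le> b' x"
proof -
  \<comment> \<open>Points outside \<open>N\<close> get the constant sequence, so that
    \<open>b\<close> is not changed there and all points can be treated alike.\<close>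
  have seq: "\<exists>u v. (\<forall>k. u k \<notin> N) \<and> u \<longlonglongrightarrow> x \<and> (\<lambda>k. b (u k)) \<longlonglongrightarrow> v \<and> (x \<notin> N \<longrightarrow> v = b x)" for x
  proof (cases "x \<in> N")
    case False
    then show ?thesis by (intro exI[of _ "\<lambda>_. x"] exI[of _ "b x"]) auto
  next
    case True
    have "\<exists>y. y \<notin> N \<and> dist y x < inverse (real (Suc k))" for k
    proof (rule ccontr)
      assume "\<not> ?thesis"
      then have "ball x (inverse (real (Suc k))) \<subseteq> N" by (auto simp: dist_commute)
      then have "negligible (ball x (inverse (real (Suc k))))" using N negligible_subset by blast
      then show False using open_not_negligible[of "ball x (inverse (real (Suc k)))"] by simp
    qed
    then obtain y where y: "\<And>k. y k \<notin> N" "\<And>k. dist (y k) x < inverse (real (Suc k))" by metis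
    have ylim: "y \<longlonglongrightarrow> x"
      by (rule metric_tendsto_imp_tendsto[OF LIMSEQ_inverse_real_of_nat]) (use y(2) in \<open>auto simp: less_imp_le\<close>)
    have "bounded (range (\<lambda>k. b (y k)))"
    proof (rule boundedI)
      fix z assume "z \<in> range (\<lambda>k. b (y k))"
      then obtain k where k: "z = b (y k)" by auto
      have "norm (y 0 - y k) \<le> 2"
      proof -
        have "dist (y 0) x < 1" "dist (y k) x < 1"
          using y(2)[of 0] less_le_trans[OF y(2)[of k], of 1] by (auto simp: inverse_le_1_iff)
        then show ?thesis using dist_triangle2[of "y 0" "y k" x] by (simp add: dist_norm)
      qed
      then have "norm (y 0 - y k) powr \<delta> (y 0) \<le> 2 powr \<delta> (y 0)"
        using \<delta>(1)[of "y 0"] by (intro powr_mono2) auto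
      then have "\<bar>b (y 0) - b (y k)\<bar> \<le> C * 2 powr \<delta> (y 0)"
        using lip[OF y(1) y(1), of 0 k] C by (meson mult_left_mono order_trans)
      then show "norm z \<le> \<bar>b (y 0)\<bar> + C * 2 powr \<delta> (y 0)" unfolding k by simp
    qed
    then obtain v \<phi> where v: "strict_mono (\<phi> :: nat \<Rightarrow> nat)" "((\<lambda>k. b (y k)) \<circ> \<phi>) \<longlonglongrightarrow> v"
      using bounded_imp_convergent_subsequence by metis
    have "(y \<circ> \<phi>) \<longlonglongrightarrow> x" by (rule LIMSEQ_subseq_LIMSEQ[OF ylim v(1)])
    then show ?thesis using True v y
      by (intro exI[of _ "y \<circ> \<phi>"] exI[of _ v]) (auto simp: o_def)
  qed
  then obtain u b' where u: "\<And>x k. u x k \<notin> N" "\<And>x. u x \<longlonglongrightarrow> x"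
    "\<And>x. (\<lambda>k. b (u x k)) \<longlonglongrightarrow> b' x" "\<And>x. x \<notin> N \<Longrightarrow> b' x = b x" by metis
  show ?thesis
  proof (rule that[OF u(4)])
    show "0 \<le> b' x" for x
      by (rule LIMSEQ_le_const[OF u(3)]) (use b0 u(1) in auto)
    have "\<bar>b' x - b' z\<bar> \<le> C * norm (x - z) powr \<delta> x" for x z
    proof (cases "x = z")
      case False
      have "(\<lambda>k. \<delta> (u x k)) \<longlonglongrightarrow> \<delta> x"
        using \<delta>(2) by (intro isCont_tendsto_compose[OF _ u(2)]) (simp add: continuous_on_eq_continuous_at)
      then have lim: "(\<lambda>k. C * norm (u x k - u z k) powr \<delta> (u x k)) \<longlonglongrightarrow> C * norm (x - z) powr \<delta> x"
        using False by (intro tendsto_intros u(2)) auto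
      have "(\<lambda>k. \<bar>b (u x k) - b (u z k)\<bar>) \<longlonglongrightarrow> \<bar>b' x - b' z\<bar>"
        by (intro tendsto_intros u(3))
      then show ?thesis
        by (rule LIMSEQ_le[OF _ lim]) (use lip u(1) in auto)
    qed simp
    then show "b' \<in> var_Lipschitz \<delta>" by (auto simp: var_Lipschitz_def)
  qed
qed

lemma (in log_hoelder) exponent_isCont: "isCont r x"
proof -
  have "filterlim (\<lambda>y. norm (y - x)) (at_right 0) (at x)"
  proof (rule tendsto_imp_filterlim_at_right)
    have "((\<lambda>y. norm (y - x)) \<longlongrightarrow> norm (x - x)) (at x)" by (intro tendsto_intros)
    then show "((\<lambda>y. norm (y - x)) \<longlongrightarrow> 0) (at x)" by simp
    show "\<forall>\<^sub>F y in at x. 0 < norm (y - x)" by (auto simp: eventually_at_filter)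
  qed
  then have "filterlim (\<lambda>y. inverse (norm (y - x))) at_top (at x)"
    by (rule filterlim_compose[OF filterlim_inverse_at_top_right])
  then have "filterlim (\<lambda>y. exp 1 + inverse (norm (y - x))) at_top (at x)"
    by (intro filterlim_tendsto_add_at_top[OF tendsto_const])
  then have "filterlim (\<lambda>y. ln (exp 1 + inverse (norm (y - x)))) at_top (at x)"
    by (rule filterlim_compose[OF ln_at_top])
  then have lim: "((\<lambda>y. C / ln (exp 1 + inverse (norm (y - x)))) \<longlongrightarrow> 0) (at x)"
    by (rule real_tendsto_divide_at_top[OF tendsto_const])
  have "((\<lambda>y. r y - r x) \<longlongrightarrow> 0) (at x)"
    by (rule Lim_null_comparison[OF _ lim]) (use local in \<open>auto simp: divide_inverse intro!: always_eventually\<close>)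
  then show ?thesis by (simp add: isCont_def Lim_null[symmetric])
qed

lemma reciprocal_diff_le:
  assumes "1 \<le> (a :: real)" "1 \<le> b"
  shows "\<bar>1 / a - 1 / b\<bar> \<le> \<bar>a - b\<bar>"
proof -
  have "1 / a - 1 / b = (b - a) / (a * b)" using assms by (simp add: diff_divide_eq_iff field_simps)
  then have "\<bar>1 / a - 1 / b\<bar> = \<bar>a - b\<bar> / (a * b)" using assms by (simp add: abs_mult abs_minus_commute)
  also have "\<dots> \<le> \<bar>a - b\<bar> / 1"
    using assms mult_mono[of 1 a 1 b] by (intro divide_left_mono) auto
  finally show ?thesis by simp
qed

text \<open>The telescoping estimate involves the scales at \<open>x\<close> and at
  \<open>y\<close>, and the exponent \<open>d\<close> on large cubes. All have to be reduced to
  \<open>norm (x - y) powr \<delta> x\<close>: log-Hoelder continuity of \<open>p\<close> handles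
  \<open>\<delta> y\<close> at small distances, \<open>d \<le> \<delta> x\<close> handles large
  ones.\<close>

lemma commutator_bounded_imp_Lipschitz:
  fixes b p q r \<delta> :: "real ^ 'n \<Rightarrow> real"
  assumes p: "log_hoelder p Rp Cp Dp lp" and q: "log_hoelder q Rq Cq Dq lq" and r: "log_hoelder r Rr Cr Dr lr"
    and b: "locally_integrable b"
    and \<delta>p: "\<And>x. \<delta> x = real CARD('n) * (1 / \<beta> - 1 / p x)"
    and \<delta>rq: "\<And>x. \<delta> x / real CARD('n) = 1 / r x - 1 / q x"
    and \<delta>_bounds: "0 < \<epsilon>" "\<And>x. \<epsilon> \<le> \<delta> x" "\<And>x. \<delta> x \<le> real CARD('n)"
    and d: "d = real CARD('n) * (1 / lr - 1 / lq)" "\<epsilon> \<le> d"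
    and d_le: "AE x in lebesgue. d \<le> \<delta> x"
    and bounded: "var_Lp_bounded_operator r q (commutator_defined b) (maximal_commutator b)"
  shows "\<exists>b'. (AE x in lebesgue. b' x = b x) \<and> b' \<in> var_Lipschitz \<delta> \<and> (\<forall>x. 0 \<le> b' x)"
proof -
  interpret p: log_hoelder p Rp Cp Dp lp by fact
  define n where "n = real CARD('n)"
  have n: "0 < n" "p.nn = n" by (simp_all add: n_def p.nn_def)
  have \<delta>0: "0 < \<delta> x" for x using \<delta>_bounds(1) \<delta>_bounds(2)[of x] by linarith
  obtain K where osc_bound: "0 \<le> K"
    "\<And>a s x. 0 < s \<Longrightarrow> x \<in> cbox a (a + s *\<^sub>R One) \<Longrightarrow>
      (AE y in lebesgue. commutator_defined b (indicator (cbox a (a + s *\<^sub>R One))) y) \<and>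
      avg (cbox a (a + s *\<^sub>R One)) (\<lambda>y. ennreal \<bar>maximal_commutator b (indicator (cbox a (a + s *\<^sub>R One))) y\<bar>)
        \<le> ennreal (K * scale \<delta> d x s)"
    unfolding scale_def d(1) by (rule commutator_average_bound[OF r q \<delta>rq bounded]) blast
  have E: "0 \<le> K * scale \<delta> d x s" for x s using osc_bound(1) by (simp add: scale_def)
  interpret oscillation b \<delta> d \<epsilon> "2 * K"
  proof
    fix a s x assume s: "0 < s" and x: "x \<in> cbox a (a + s *\<^sub>R (One :: real ^ 'n))"
    from commutator_oscillation(1)[OF b s E] osc_bound(2)[OF s x]
    show "integral (cbox a (a + s *\<^sub>R One)) (\<lambda>y. \<bar>b y - mean b a s\<bar>) \<le> 2 * K * scale \<delta> d x s * s ^ CARD('n)"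
      unfolding mean_def by (simp add: mult.assoc)
  qed (use b osc_bound(1) \<delta>_bounds d in auto)
  have bi: "b absolutely_integrable_on cbox x y" for x y by (rule locally_integrable_cbox[OF b])
  have nb: "(\<lambda>y. \<bar>b y\<bar> - b y) absolutely_integrable_on cbox x y" for x y
    using set_integral_diff(1)[OF absolutely_integrable_norm[OF bi[of x y]] bi] by (simp add: o_def)
  obtain N1 where N1: "negligible N1" "\<And>x. x \<notin> N1 \<Longrightarrow> ((\<lambda>h. mean b x h) \<longlongrightarrow> b x) (at_right 0)"
    unfolding mean_def
    using lebesgue_differentiation[OF set_lebesgue_integral_eq_integral(1)[OF bi]] by blast
  obtain N2 where N2: "negligible N2"
    "\<And>x. x \<notin> N2 \<Longrightarrow> ((\<lambda>h. mean (\<lambda>y. \<bar>b y\<bar> - b y) x h) \<longlongrightarrow> \<bar>b x\<bar> - b x) (at_right 0)"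
    unfolding mean_def
    using lebesgue_differentiation[OF set_lebesgue_integral_eq_integral(1)[OF nb]] by blast
  obtain N3 where N3: "N3 \<in> null_sets lebesgue" "{x \<in> space lebesgue. \<not> d \<le> \<delta> x} \<subseteq> N3"
    using d_le by (auto simp: eventually_ae_filter)
  \<comment> \<open>Outside \<open>N\<close> lie the points that are Lebesgue points of
    \<open>b\<close> and of \<open>\<bar>b\<bar> - b\<close> and satisfy
    \<open>d \<le> \<delta> x\<close>.\<close>
  define N where "N = N1 \<union> N2 \<union> N3"
  have "negligible N3" using N3(1) by (simp add: negligible_iff_null_sets)
  then have N: "negligible N" using N1(1) N2(1) by (simp add: N_def)
  \<comment> \<open>The mean of \<open>\<bar>b\<bar> - b\<close> over the cube of side
    \<open>h\<close> at \<open>x\<close> tends to its value at \<open>x\<close>, but is also at most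
    \<open>K * h powr \<delta> x\<close>, which tends to 0.\<close>
  have b0: "0 \<le> b x" if x: "x \<notin> N" for x
  proof -
    have "((\<lambda>h. K * h powr \<delta> x) \<longlongrightarrow> K * 0) (at_right 0)"
      using \<delta>0[of x]
      by (intro tendsto_mult tendsto_const tendsto_zero_powrI[where b = "\<delta> x"])
        (auto simp: eventually_at_filter intro!: tendsto_eq_intros)
    then have lim: "((\<lambda>h. K * h powr \<delta> x) \<longlongrightarrow> 0) (at_right 0)" by simp
    have "\<bar>b x\<bar> - b x \<le> 0"
    proof (rule tendsto_le[OF _ lim N2(2)])
      show "x \<notin> N2" using x by (simp add: N_def)
      show "\<forall>\<^sub>F h in at_right 0. mean (\<lambda>y. \<bar>b y\<bar> - b y) x h \<le> K * h powr \<delta> x"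
        unfolding eventually_at_right_field
      proof (intro exI[of _ 1] conjI allI impI)
        fix h :: real assume h: "0 < h" "h < 1"
        have xQ: "x \<in> cbox x (x + h *\<^sub>R One)" using h by (simp add: mem_cube)
        have "integral (cbox x (x + h *\<^sub>R One)) (\<lambda>y. \<bar>b y\<bar> - b y) \<le> K * scale \<delta> d x h * h ^ CARD('n)"
          using commutator_oscillation(2)[OF b h(1) E] osc_bound(2)[OF h(1) xQ] by blast
        then show "mean (\<lambda>y. \<bar>b y\<bar> - b y) x h \<le> K * h powr \<delta> x"
          using h by (simp add: mean_def scale_def divide_le_eq)
      qed simp
    qed simp
    then show ?thesis by simp
  qed
  \<comment> \<open>The constant \<open>Cloc\<close> belonging to \<open>p\<close>: since
    \<open>\<delta>\<close> is affine in \<open>1 / p\<close>, its oscillation is at most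
    \<open>n\<close> times that of \<open>p\<close>.\<close>
  define M where "M = exp (n * (Cp * (1 + ln n)))"
  have \<delta>_log: "s powr \<delta> y \<le> M * s powr \<delta> x" if "x \<noteq> y" "s = norm (x - y)" "s \<le> 1" for x y s
  proof -
    have s: "0 < s" using that by simp
    define a where "a = (\<chi> i. min (x $ i) (y $ i))"
    have comp: "\<bar>x $ i - y $ i\<bar> \<le> s" for i
      using component_le_norm_cart[of "x - y" i] that by simp
    have "x \<in> cbox a (a + s *\<^sub>R One)" "y \<in> cbox a (a + s *\<^sub>R One)"
      unfolding mem_cube a_def using comp s by (auto simp: min_def abs_le_iff algebra_simps)
    from p.local_cube[OF this s that(3)] have "\<bar>p x - p y\<bar> * ln (1 / s) \<le> Cp * (1 + ln n)" by (simp add: n)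
    then have 1: "n * (\<bar>p x - p y\<bar> * ln (1 / s)) \<le> n * (Cp * (1 + ln n))" using n by (intro mult_left_mono) auto
    have "\<delta> x - \<delta> y = n * (1 / p y - 1 / p x)" by (simp add: \<delta>p n_def algebra_simps)
    also have "\<dots> \<le> n * \<bar>p x - p y\<bar>"
      using n reciprocal_diff_le[OF p.r_ge[of y] p.r_ge[of x]] by (intro mult_left_mono) auto
    finally have "(\<delta> x - \<delta> y) * ln (1 / s) \<le> n * \<bar>p x - p y\<bar> * ln (1 / s)"
      using s that(3) by (intro mult_right_mono) auto
    with 1 have "(\<delta> x - \<delta> y) * ln (1 / s) \<le> n * (Cp * (1 + ln n))" by (simp add: mult.assoc)
    moreover have "s powr (\<delta> y - \<delta> x) = exp ((\<delta> x - \<delta> y) * ln (1 / s))"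
      using s by (simp add: powr_def ln_div algebra_simps)
    ultimately have "s powr (\<delta> y - \<delta> x) \<le> M" by (simp add: M_def)
    then have "s powr (\<delta> y - \<delta> x) * s powr \<delta> x \<le> M * s powr \<delta> x" by (intro mult_right_mono) auto
    then show ?thesis by (simp add: powr_add[symmetric])
  qed
  have scale_le: "scale \<delta> d x s \<le> s powr \<delta> x" if "x \<notin> N" "0 < s" for x s
  proof (cases "s \<le> 1")
    case False
    moreover have "d \<le> \<delta> x" using that N3(2) by (auto simp: N_def)
    ultimately show ?thesis by (simp add: scale_def powr_mono)
  qed (simp add: scale_def)
  define B where "B = Ktel * (1 + (M + 1)) + 2 * (2 ^ CARD('n) * (2 * K) * 2 powr n)"
  have B: "0 \<le> B"
    unfolding B_def M_def using Ktel_nonneg osc_bound(1)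
    by (intro add_nonneg_nonneg mult_nonneg_nonneg) auto
  have lip: "\<bar>b x - b y\<bar> \<le> B * norm (x - y) powr \<delta> x" if xy: "x \<notin> N" "y \<notin> N" for x y
  proof (cases "x = y")
    case False
    define s where "s = norm (x - y)"
    have s: "0 < s" using False by (simp add: s_def)
    define P where "P = s powr \<delta> x"
    have P: "0 \<le> P" by (simp add: P_def)
    have 1: "scale \<delta> d x s \<le> P" unfolding P_def by (rule scale_le[OF xy(1) s])
    have 2: "scale \<delta> d y s \<le> (M + 1) * P"
    proof (cases "s \<le> 1")
      case True
      then show ?thesis using \<delta>_log[OF False s_def] P by (simp add: scale_def P_def distrib_right add_increasing2)
    next
      case gt: False
      have "d \<le> \<delta> x" using xy(1) N3(2) by (auto simp: N_def)
      then have "s powr d \<le> P" unfolding P_def using gt by (intro powr_mono) auto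
      moreover have "0 \<le> M * P" using P by (simp add: M_def)
      ultimately show ?thesis using gt by (simp add: scale_def distrib_right)
    qed
    have 3: "scale \<delta> d x (2 * s) \<le> 2 powr n * P"
    proof -
      have "scale \<delta> d x (2 * s) \<le> (2 * s) powr \<delta> x" using s by (intro scale_le[OF xy(1)]) simp
      also have "\<dots> = 2 powr \<delta> x * P" using s by (simp add: powr_mult P_def)
      also have "\<dots> \<le> 2 powr n * P" using \<delta>_bounds(3)[of x] P by (intro mult_right_mono powr_mono) (auto simp: n_def)
      finally show ?thesis .
    qed
    have "\<bar>b x - b y\<bar> \<le> Ktel * (scale \<delta> d x s + scale \<delta> d y s) + 2 * (2 ^ CARD('n) * (2 * K) * scale \<delta> d x (2 * s))"
      unfolding s_def using xy by (intro lebesgue_point_diff N1(2) False) (auto simp: N_def)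
    also have "\<dots> \<le> Ktel * (P + (M + 1) * P) + 2 * (2 ^ CARD('n) * (2 * K) * (2 powr n * P))"
      using Ktel_nonneg osc_bound(1) 1 2 3 by (intro add_mono mult_left_mono) auto
    also have "\<dots> = B * P" by (simp add: B_def algebra_simps)
    finally show ?thesis by (simp add: P_def s_def)
  qed simp
  have cont: "continuous_on UNIV \<delta>"
  proof -
    have "isCont p x" "p x \<noteq> 0" for x using p.exponent_isCont[of x] p.r_ge[of x] by auto
    then have "continuous_on UNIV p" by (simp add: continuous_on_eq_continuous_at)
    moreover have "\<delta> = (\<lambda>x. n * (1 / \<beta> - 1 / p x))" using \<delta>p by (auto simp: n_def)
    moreover have "\<forall>x\<in>UNIV. p x \<noteq> 0" using p.r_ge by (metis not_one_le_zero)
    ultimately show ?thesis by (auto intro!: continuous_intros)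
  qed
  have "\<exists>b'. (\<forall>x. x \<notin> N \<longrightarrow> b' x = b x) \<and> b' \<in> var_Lipschitz \<delta> \<and> (\<forall>x. 0 \<le> b' x)"
    by (rule extend_from_full_measure[OF N B lip b0 \<delta>0 cont]) auto
  then obtain b' where b': "\<And>x. x \<notin> N \<Longrightarrow> b' x = b x" "b' \<in> var_Lipschitz \<delta>" "\<And>x. 0 \<le> b' x"
    by auto
  have "AE x in lebesgue. x \<notin> N" using N by (intro AE_not_in) (simp add: negligible_iff_null_sets)
  then have "AE x in lebesgue. b' x = b x" by eventually_elim (rule b'(1))
  then show ?thesis using b' by blast
qed

theorem corollary3p6:
  fixes \<delta> p q r b :: "real ^ 'n \<Rightarrow> real" and \<beta> :: real
  assumes "\<And>x. 0 < \<delta> x \<and> \<delta> x < real CARD('n)"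
    and "log_exponent p" and "log_exponent q" and "log_exponent r"
    and "1 < \<beta>" and "\<beta> < finf p"
    and "0 < finf \<delta>"
    and "fsup (\<lambda>x. r x * \<delta> x) < real CARD('n)"
    and "exponent_at_infinity r * fsup \<delta> < real CARD('n)"
    and "AE x in lebesgue. exponent_at_infinity p \<le> p x"
    and "1 / \<beta> + 1 / fsup (conj_exponent p) > 1"
    and "\<And>x. 1 / \<beta> - 1 / p x = \<delta> x / real CARD('n)"
    and "\<And>x. \<delta> x / real CARD('n) = 1 / r x - 1 / q x"
    and "locally_integrable b"
  shows "(\<exists>b'. (AE x in lebesgue. b' x = b x) \<and> b' \<in> var_Lipschitz \<delta> \<and> (\<forall>x. 0 \<le> b' x))
    \<longleftrightarrow> var_Lp_bounded_operator r q (commutator_defined b) (maximal_commutator b)"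
proof
  define n where "n = real CARD('n)"
  have n: "0 < n" by (simp add: n_def)
  obtain Cp Dp Rp where p: "log_hoelder p Rp Cp Dp (exponent_at_infinity p)"
    and limp: "(p \<longlongrightarrow> exponent_at_infinity p) at_infinity"
    by (rule log_exponentE[OF assms(2)]) blast
  obtain Cq Dq Rq where q: "log_hoelder q Rq Cq Dq (exponent_at_infinity q)"
    and limq: "(q \<longlongrightarrow> exponent_at_infinity q) at_infinity"
    by (rule log_exponentE[OF assms(3)]) blast
  obtain Cr Dr Rr where r: "log_hoelder r Rr Cr Dr (exponent_at_infinity r)" "1 < finf r"
    "\<And>x. finf r \<le> r x" "finf r \<le> exponent_at_infinity r"
    and limr: "(r \<longlongrightarrow> exponent_at_infinity r) at_infinity"
    by (rule log_exponentE[OF assms(4)]) blast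
  interpret p: log_hoelder p Rp Cp Dp "exponent_at_infinity p" by fact
  interpret q: log_hoelder q Rq Cq Dq "exponent_at_infinity q" by fact
  interpret r: log_hoelder r Rr Cr Dr "exponent_at_infinity r" by fact
  have \<delta>_sup: "\<delta> x \<le> fsup \<delta>" for x
    unfolding fsup_def
    by (rule cSUP_upper) (use assms(1) in \<open>auto simp: bdd_above_def intro!: exI[of _ "real CARD('n)"] less_imp_le\<close>)
  have \<delta>_inf: "finf \<delta> \<le> \<delta> x" for x
    unfolding finf_def
    by (rule cINF_lower) (use assms(1) in \<open>auto simp: bdd_below_def intro!: exI[of _ 0] less_imp_le\<close>)
  {
    assume "\<exists>b'. (AE x in lebesgue. b' x = b x) \<and> b' \<in> var_Lipschitz \<delta> \<and> (\<forall>x. 0 \<le> b' x)"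
    then obtain b' where b': "AE x in lebesgue. b' x = b x" "b' \<in> var_Lipschitz \<delta>" "\<And>x. 0 \<le> b' x" by blast
    \<comment> \<open>Positive by the condition on \<open>r_\<infinity> \<delta>_+\<close>, and
      below all \<open>1 - \<delta> x * r_\<infinity> / n\<close>.\<close>
    define \<theta> where "\<theta> = 1 - fsup \<delta> * exponent_at_infinity r / n"
    have "\<theta> \<le> 1 - \<delta> x * exponent_at_infinity r / n" for x
      unfolding \<theta>_def using \<delta>_sup[of x] r.l_ge n by (intro diff_left_mono divide_right_mono mult_right_mono) auto
    moreover have "0 < \<theta>" using assms(9) n by (simp add: \<theta>_def n_def mult.commute)
    moreover have "\<theta> \<le> 1"
    proof -
      have "0 \<le> fsup \<delta>" using \<delta>_sup[of 0] assms(1)[of 0] by linarith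
      then show ?thesis using n r.l_ge by (simp add: \<theta>_def)
    qed
    ultimately interpret fractional r Rr Cr Dr "exponent_at_infinity r" "finf r" "(n + 1) / \<theta>" \<theta> Rq q \<delta>
      using r assms(1,13) q.r_ge q.r_le by unfold_locales (auto simp: n_def)
    show "var_Lp_bounded_operator r q (commutator_defined b) (maximal_commutator b)"
    proof (rule commutator_bounded[OF locally_integrable_measurable[OF assms(14)] b'(1,3,2) q.meas])
      show "\<delta> x \<le> r.nn" for x using assms(1)[of x] by (simp add: r.nn_def)
    qed
  next
    assume bounded: "var_Lp_bounded_operator r q (commutator_defined b) (maximal_commutator b)"
    have \<delta>p: "\<delta> x = n * (1 / \<beta> - 1 / p x)" for x using assms(12)[of x] n by (simp add: n_def)
    have \<delta>rq: "\<delta> x = n * (1 / r x - 1 / q x)" for x using assms(13)[of x] n by (simp add: n_def field_simps)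
    \<comment> \<open>This exponent comes from \<open>r\<close> and \<open>q\<close>, whereas the
      hypothesis at infinity concerns \<open>p\<close>. Both relations for \<open>\<delta>\<close>
      give its limit at infinity, so uniqueness of limits expresses \<open>d\<close> through
      \<open>p\<close>, and \<open>p \<ge> p_\<infinity>\<close> becomes
      \<open>d \<le> \<delta>\<close>.\<close>
    define d where "d = n * (1 / exponent_at_infinity r - 1 / exponent_at_infinity q)"
    have "((\<lambda>x. n * (1 / r x - 1 / q x)) \<longlongrightarrow> d) at_infinity"
      unfolding d_def using r.l_ge q.l_ge by (intro tendsto_intros limr limq) auto
    then have lim: "(\<delta> \<longlongrightarrow> d) at_infinity" by (simp add: \<delta>rq[symmetric])
    have "((\<lambda>x. n * (1 / \<beta> - 1 / p x)) \<longlongrightarrow> n * (1 / \<beta> - 1 / exponent_at_infinity p)) at_infinity"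
      using p.l_ge by (intro tendsto_intros limp) auto
    then have "(\<delta> \<longlongrightarrow> n * (1 / \<beta> - 1 / exponent_at_infinity p)) at_infinity" by (simp add: \<delta>p[symmetric])
    from tendsto_unique[OF trivial_limit_at_infinity lim this]
    have dp: "d = n * (1 / \<beta> - 1 / exponent_at_infinity p)" .
    have d_le: "AE x in lebesgue. d \<le> \<delta> x"
      using assms(10)
    proof eventually_elim
      case (elim x)
      then have "1 / p x \<le> 1 / exponent_at_infinity p" using p.l_ge by (intro divide_left_mono) auto
      then show ?case unfolding dp \<delta>p using n by (intro mult_left_mono) auto
    qed
    show "\<exists>b'. (AE x in lebesgue. b' x = b x) \<and> b' \<in> var_Lipschitz \<delta> \<and> (\<forall>x. 0 \<le> b' x)"
    proof (rule commutator_bounded_imp_Lipschitz[OF p q r(1) assms(14) \<delta>p[unfolded n_def] assms(13)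
          assms(7) \<delta>_inf _ d_def[unfolded n_def] _ d_le bounded])
      show "\<delta> x \<le> real CARD('n)" for x using assms(1)[of x] by simp
      show "finf \<delta> \<le> d"
        by (rule tendsto_lowerbound[OF lim _ trivial_limit_at_infinity]) (simp add: \<delta>_inf)
    qed
  }
qed

end
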